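(* Let $L>0$ and $\lambda>0$. For every time $T>0$ and every initial datum $y_0\in L^2(0,L)$ there exist two controls $u^1,u^2\in H^1(0,T)$ such that the solution $y$ of $$\begin{cases} y_t+\lambda y_{xx}+y_{xxxx}=0, & (t,x)\in(0,T)\times(0,L),\\ y_x(t,0)=u^1(t),\quad y_{xxx}(t,0)=u^2(t), & t\in(0,T),\\ y_x(t,L)=y_{xxx}(t,L)=0, & t\in(0,T),\\ y(0,x)=y_0(x), & x\in(0,L),\end{cases}$$ satisfies $y(T,x)=0$ for all $x\in(0,L)$.
   Context: All functions are real-valued. Notion of solution: let $A\phi=\lambda\phi_{xx}+\phi_{xxxx}$ on $L^2(0,L)$ with domain $\{\phi\in H^4(0,L):\phi_x(0)=\phi_{xxx}(0)=\phi_x(L)=\phi_{xxx}(L)=0\}$; $-A$ generates a strongly continuous semigroup. Fix $p_1,p_2\in C^\infty([0,L])$ with $p_1'(0)=1$, $p_1'''(0)=0$, $p_2'(0)=0$, $p_2'''(0)=1$ and $p_i'(L)=p_i'''(L)=0$ for $i=1,2$. For $y_0\in L^2(0,L)$ and $u^1,u^2\in H^1(0,T)$ the solution is $y=z+p_1u^1+p_2u^2\in C([0,T];L^2(0,L))$, where $z$ is the mild solution of $z_t+Az=-\sum_{i=1}^2\big(p_iu^i_t+(\lambda p_i''+p_i'''')u^i\big)$, $z(0)=y_0-p_1u^1(0)-p_2u^2(0)$ (independent of the choice of $p_1,p_2$). *)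

theory Defs
  imports "HOL-Analysis.Analysis"
begin

section \<open>The Hilbert space of square integrable functions on the line\<close>

definition square_integrable :: "(real \<Rightarrow> real) \<Rightarrow> bool" where
  "square_integrable f \<longleftrightarrow> f \<in> borel_measurable lborel \<and> integrable lborel (\<lambda>x. (f x)\<^sup>2)"

lemma square_integrable_mult:
  assumes "square_integrable f" "square_integrable g"
  shows "integrable lborel (\<lambda>x. f x * g x)"
proof (rule Bochner_Integration.integrable_bound)
  show "integrable lborel (\<lambda>x. (f x)\<^sup>2 + (g x)\<^sup>2)"
    using assms by (auto simp: square_integrable_def)
  show "(\<lambda>x. f x * g x) \<in> borel_measurable lborel"
    using assms by (auto simp: square_integrable_def)
  have "\<bar>a * b\<bar> \<le> a\<^sup>2 + b\<^sup>2" for a b :: real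
  proof -
    have "2 * \<bar>a\<bar> * \<bar>b\<bar> \<le> a\<^sup>2 + b\<^sup>2"
      using sum_squares_bound[of "\<bar>a\<bar>" "\<bar>b\<bar>"] by simp
    moreover have "0 \<le> \<bar>a\<bar> * \<bar>b\<bar>" by simp
    ultimately have "\<bar>a\<bar> * \<bar>b\<bar> \<le> a\<^sup>2 + b\<^sup>2" by linarith
    then show ?thesis by (simp add: abs_mult)
  qed
  then show "AE x in lborel. norm (f x * g x) \<le> norm ((f x)\<^sup>2 + (g x)\<^sup>2)"
    by auto
qed

lemma square_integrable_zero: "square_integrable (\<lambda>x. 0)"
  by (simp add: square_integrable_def)

lemma square_integrable_scale: "square_integrable f \<Longrightarrow> square_integrable (\<lambda>x. c * f x)"
  by (auto simp: square_integrable_def power_mult_distrib)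

lemma square_integrable_uminus: "square_integrable f \<Longrightarrow> square_integrable (\<lambda>x. - f x)"
  by (auto simp: square_integrable_def)

lemma square_integrable_add:
  assumes "square_integrable f" "square_integrable g"
  shows "square_integrable (\<lambda>x. f x + g x)"
  using assms square_integrable_mult[OF assms]
  by (auto simp: square_integrable_def power2_sum mult.assoc)

lemma square_integrable_diff:
  assumes "square_integrable f" "square_integrable g"
  shows "square_integrable (\<lambda>x. f x - g x)"
  using square_integrable_add[OF assms(1) square_integrable_uminus[OF assms(2)]] by simp

text \<open>The type \<open>l2\<close> below is the quotient of the square integrable functions by equality almost everywhere,
  shown afterwards to be a separable Hilbert space so that the Bochner integral of the library applies.\<close>

definition l2_eq :: "(real \<Rightarrow> real) \<Rightarrow> (real \<Rightarrow> real) \<Rightarrow> bool" where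
  "l2_eq f g \<longleftrightarrow> square_integrable f \<and> square_integrable g \<and> (AE x in lborel. f x = g x)"

lemma part_equivp_l2_eq: "part_equivp l2_eq"
proof (rule part_equivpI)
  show "\<exists>f. l2_eq f f"
    by (intro exI[of _ "\<lambda>x. 0"]) (simp add: l2_eq_def square_integrable_zero)
  show "symp l2_eq"
    by (rule sympI) (auto simp: l2_eq_def elim: eventually_mono)
  show "transp l2_eq"
  proof (rule transpI)
    fix f g h assume *: "l2_eq f g" "l2_eq g h"
    then have "AE x in lborel. f x = g x" "AE x in lborel. g x = h x"
      by (auto simp: l2_eq_def)
    then have "AE x in lborel. f x = h x" by eventually_elim simp
    then show "l2_eq f h" using * by (auto simp: l2_eq_def)
  qed
qed

quotient_type l2 = "real \<Rightarrow> real" / partial: l2_eq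
  morphisms l2_rep l2_class
  by (rule part_equivp_l2_eq)

instantiation l2 :: real_vector
begin

lift_definition zero_l2 :: l2 is "\<lambda>x. 0"
  by (simp add: l2_eq_def square_integrable_zero)

lift_definition plus_l2 :: "l2 \<Rightarrow> l2 \<Rightarrow> l2" is "\<lambda>f g x. f x + g x"
  by (auto simp: l2_eq_def intro: square_integrable_add)

lift_definition uminus_l2 :: "l2 \<Rightarrow> l2" is "\<lambda>f x. - f x"
  by (auto simp: l2_eq_def intro: square_integrable_uminus)

lift_definition minus_l2 :: "l2 \<Rightarrow> l2 \<Rightarrow> l2" is "\<lambda>f g x. f x - g x"
  by (auto simp: l2_eq_def intro: square_integrable_diff)

lift_definition scaleR_l2 :: "real \<Rightarrow> l2 \<Rightarrow> l2" is "\<lambda>c f x. c * f x"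
  by (auto simp: l2_eq_def intro: square_integrable_scale)

instance
  by standard
    (transfer; auto simp: l2_eq_def algebra_simps
      intro: square_integrable_add square_integrable_scale square_integrable_uminus
        square_integrable_diff square_integrable_zero)+

end

instantiation l2 :: real_inner
begin

lift_definition inner_l2 :: "l2 \<Rightarrow> l2 \<Rightarrow> real" is "\<lambda>f g. LINT x|lborel. f x * g x"
  by (intro integral_cong_AE) (auto simp: l2_eq_def square_integrable_def)

definition norm_l2 :: "l2 \<Rightarrow> real" where "norm_l2 f = sqrt (inner f f)"
definition sgn_l2 :: "l2 \<Rightarrow> l2" where "sgn_l2 f = f /\<^sub>R norm f"
definition dist_l2 :: "l2 \<Rightarrow> l2 \<Rightarrow> real" where "dist_l2 f g = norm (f - g)"
definition uniformity_l2 :: "(l2 \<times> l2) filter" where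
  "uniformity_l2 = (INF e\<in>{0<..}. principal {(x, y). dist x y < e})"
definition open_l2 :: "l2 set \<Rightarrow> bool" where
  "open_l2 U = (\<forall>x\<in>U. \<forall>\<^sub>F (x', y) in uniformity. x' = x \<longrightarrow> y \<in> U)"

instance
proof
  fix f g h :: l2 and c :: real
  show "dist f g = norm (f - g)" by (rule dist_l2_def)
  show "sgn f = f /\<^sub>R norm f" by (rule sgn_l2_def)
  show "(uniformity :: (l2 \<times> l2) filter) = (INF e\<in>{0<..}. principal {(x, y). dist x y < e})"
    by (rule uniformity_l2_def)
  show "open U = (\<forall>x\<in>U. \<forall>\<^sub>F (x', y) in uniformity. x' = x \<longrightarrow> y \<in> U)" for U :: "l2 set"
    by (rule open_l2_def)
  show "inner f g = inner g f" by transfer (simp add: mult.commute)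
  show "inner (f + g) h = inner f h + inner g h"
    by transfer (simp add: l2_eq_def square_integrable_mult distrib_right)
  show "inner (c *\<^sub>R f) g = c * inner f g"
    by transfer (simp add: mult.assoc)
  show "0 \<le> inner f f"
    by transfer (simp add: power2_eq_square[symmetric])
  show "inner f f = 0 \<longleftrightarrow> f = 0"
  proof (transfer)
    fix f :: "real \<Rightarrow> real" assume "l2_eq f f"
    then have f: "square_integrable f" by (simp add: l2_eq_def)
    have "(LINT x|lborel. f x * f x) = 0 \<longleftrightarrow> (AE x in lborel. f x * f x = 0)"
      by (rule integral_nonneg_eq_0_iff_AE) (use square_integrable_mult[OF f f] in auto)
    then show "(LINT x|lborel. f x * f x) = 0 \<longleftrightarrow> l2_eq f (\<lambda>x. 0)"
      using f by (simp add: l2_eq_def square_integrable_zero)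
  qed
  show "norm f = sqrt (inner f f)" by (rule norm_l2_def)
qed

end

lemma square_integrable_l2_rep [simp]: "square_integrable (l2_rep f)"
  by (metis Quotient_l2 Quotient_rep_reflp l2_eq_def)

lemma l2_class_rep [simp]: "l2_class (l2_rep f) = f"
  by (metis Quotient_l2 Quotient_abs_rep)

lemma l2_class_eq_iff:
  assumes "square_integrable f" "square_integrable g"
  shows "l2_class f = l2_class g \<longleftrightarrow> (AE x in lborel. f x = g x)"
  using Quotient_rel[OF Quotient_l2, of f g] assms by (auto simp: l2_eq_def)

lemma l2_eq_refl: "square_integrable f \<Longrightarrow> l2_eq f f"
  by (simp add: l2_eq_def)

lemma l2_class_diff:
  "square_integrable f \<Longrightarrow> square_integrable g \<Longrightarrow>
    l2_class f - l2_class g = l2_class (\<lambda>x. f x - g x)"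
  by (rule minus_l2.abs_eq) (auto intro: l2_eq_refl)

lemma l2_class_add:
  "square_integrable f \<Longrightarrow> square_integrable g \<Longrightarrow>
    l2_class f + l2_class g = l2_class (\<lambda>x. f x + g x)"
  by (rule plus_l2.abs_eq) (auto intro: l2_eq_refl)

lemma l2_class_scaleR:
  "square_integrable f \<Longrightarrow> c *\<^sub>R l2_class f = l2_class (\<lambda>x. c * f x)"
  by (rule scaleR_l2.abs_eq) (auto intro: l2_eq_refl)

lemma norm_l2_class_sq:
  "square_integrable f \<Longrightarrow> (norm (l2_class f))\<^sup>2 = (LINT x|lborel. (f x)\<^sup>2)"
  by (simp add: norm_l2_def inner_l2.abs_eq l2_eq_refl power2_eq_square[symmetric])

lemma nn_integral_l2_class:
  assumes "square_integrable f"
  shows "(\<integral>\<^sup>+x. ennreal ((f x)\<^sup>2) \<partial>lborel) = ennreal ((norm (l2_class f))\<^sup>2)"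
  using assms
  by (subst nn_integral_eq_integral) (auto simp: norm_l2_class_sq square_integrable_def)


lemma countable_dense_l2_subspace:
  fixes D :: "'a :: real_normed_vector set"
  assumes "countable D"
  obtains Q where "countable Q" "D \<subseteq> Q" "subspace (closure Q)"
proof
  define comb :: "(rat \<times> 'a) list \<Rightarrow> 'a"
    where "comb xs = (\<Sum>(r, d)\<leftarrow>xs. of_rat r *\<^sub>R d)" for xs
  define Q where "Q = comb ` lists (UNIV \<times> D)"
  show "countable Q"
    unfolding Q_def using assms by (intro countable_image countable_lists countable_SIGMA) auto
  show "D \<subseteq> Q"
  proof
    fix d assume "d \<in> D"
    then show "d \<in> Q"
      unfolding Q_def by (intro image_eqI[of _ _ "[(1, d)]"]) (auto simp: comb_def)
  qed
  have add: "x + y \<in> Q" if "x \<in> Q" "y \<in> Q" for x y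
  proof -
    from that obtain xs ys where "xs \<in> lists (UNIV \<times> D)" "x = comb xs"
      "ys \<in> lists (UNIV \<times> D)" "y = comb ys" unfolding Q_def by blast
    then show ?thesis
      unfolding Q_def by (intro image_eqI[of _ _ "xs @ ys"]) (auto simp: comb_def)
  qed
  have scale: "of_rat r *\<^sub>R x \<in> Q" if "x \<in> Q" for x and r :: rat
  proof -
    from that obtain xs where xs: "xs \<in> lists (UNIV \<times> D)" "x = comb xs"
      unfolding Q_def by blast
    have "of_rat r *\<^sub>R comb xs = comb (map (\<lambda>(q, d). (r * q, d)) xs)" for xs
      by (induction xs) (auto simp: comb_def of_rat_mult scaleR_add_right)
    moreover have "map (\<lambda>(q, d). (r * q, d)) xs \<in> lists (UNIV \<times> D)"
      using xs(1) by (auto simp: lists_eq_set)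
    ultimately show ?thesis unfolding Q_def xs(2) by blast
  qed
  show "subspace (closure Q)"
  proof (rule subspaceI)
    have "0 \<in> Q" unfolding Q_def by (intro image_eqI[of _ _ "[]"]) (auto simp: comb_def)
    then show "0 \<in> closure Q" using closure_subset by blast
  next
    fix x y assume "x \<in> closure Q" "y \<in> closure Q"
    then obtain X Y where "\<And>n. X n \<in> Q" "X \<longlonglongrightarrow> x" "\<And>n. Y n \<in> Q" "Y \<longlonglongrightarrow> y"
      unfolding closure_sequential by blast
    then show "x + y \<in> closure Q"
      unfolding closure_sequential
      by (intro exI[of _ "\<lambda>n. X n + Y n"]) (auto intro: add tendsto_add)
  next
    fix c :: real and x assume "x \<in> closure Q"
    then obtain X where X: "\<And>n. X n \<in> Q" "X \<longlonglongrightarrow> x"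
      unfolding closure_sequential by blast
    have "\<exists>r. c < of_rat r \<and> of_rat r < c + 1 / real (Suc n)" for n
      using of_rat_dense[of c "c + 1 / real (Suc n)"] by simp
    then obtain r where r: "\<And>n. c < of_rat (r n)" "\<And>n. of_rat (r n) < c + 1 / real (Suc n)"
      by metis
    have "(\<lambda>n. of_rat (r n)) \<longlonglongrightarrow> c"
    proof (rule tendsto_sandwich[OF _ _ tendsto_const])
      show "(\<lambda>n. c + 1 / real (Suc n)) \<longlonglongrightarrow> c"
        using tendsto_add[OF tendsto_const[of c] LIMSEQ_inverse_real_of_nat]
        by (simp add: inverse_eq_divide)
    qed (use r in \<open>auto intro!: always_eventually less_imp_le\<close>)
    then have "(\<lambda>n. of_rat (r n) *\<^sub>R X n) \<longlonglongrightarrow> c *\<^sub>R x"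
      using X by (intro tendsto_scaleR)
    then show "c *\<^sub>R x \<in> closure Q"
      unfolding closure_sequential using scale X(1)
      by (intro exI[of _ "\<lambda>n. of_rat (r n) *\<^sub>R X n"]) auto
  qed
qed

lemma square_integrable_indicator:
  fixes A :: "real set"
  assumes "A \<in> sets borel" "emeasure lborel A < \<infinity>"
  shows "square_integrable (indicator A)"
proof -
  have "integrable lborel (indicator A :: real \<Rightarrow> real)"
    using assms by (intro integrable_real_indicator) auto
  moreover have "(\<lambda>x. (indicator A x)\<^sup>2 :: real) = indicator A"
    by (auto simp: indicator_def)
  ultimately show ?thesis
    using assms unfolding square_integrable_def by auto
qed

lemma l2_class_tendstoI:
  assumes "\<And>n. square_integrable (s n)" "square_integrable f"
    and lim: "\<And>x. (\<lambda>n. s n x) \<longlonglongrightarrow> f x"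
    and bound: "\<And>n x. \<bar>s n x\<bar> \<le> 2 * \<bar>f x\<bar>"
  shows "(\<lambda>n. l2_class (s n)) \<longlonglongrightarrow> l2_class f"
proof -
  have "(\<lambda>n. LINT x|lborel. (s n x - f x)\<^sup>2) \<longlonglongrightarrow> (LINT x|(lborel :: real measure). (0::real))"
  proof (rule integral_dominated_convergence)
    show "integrable lborel (\<lambda>x. 9 * (f x)\<^sup>2)"
      using assms(2) by (auto simp: square_integrable_def)
    show "(\<lambda>x. (s n x - f x)\<^sup>2) \<in> borel_measurable lborel" for n
      using assms(1)[of n] assms(2) unfolding square_integrable_def
      by (intro borel_measurable_power borel_measurable_diff) auto
    show "AE x in lborel. (\<lambda>n. (s n x - f x)\<^sup>2) \<longlonglongrightarrow> 0"
    proof (rule AE_I2)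
      fix x
      have "(\<lambda>n. (s n x - f x)\<^sup>2) \<longlonglongrightarrow> (f x - f x)\<^sup>2"
        by (intro tendsto_intros lim)
      then show "(\<lambda>n. (s n x - f x)\<^sup>2) \<longlonglongrightarrow> 0" by simp
    qed
    show "AE x in lborel. norm ((s n x - f x)\<^sup>2) \<le> 9 * (f x)\<^sup>2" for n
    proof (rule AE_I2)
      fix x
      have "\<bar>s n x - f x\<bar> \<le> \<bar>3 * f x\<bar>" using bound[of n x] by linarith
      then have "(s n x - f x)\<^sup>2 \<le> (3 * f x)\<^sup>2" by (simp add: abs_le_square_iff)
      then show "norm ((s n x - f x)\<^sup>2) \<le> 9 * (f x)\<^sup>2" by (simp add: power_mult_distrib)
    qed
  qed auto
  then have "(\<lambda>n. (norm (l2_class (s n) - l2_class f))\<^sup>2) \<longlonglongrightarrow> 0"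
    using assms(1,2) by (simp add: l2_class_diff norm_l2_class_sq square_integrable_diff)
  from tendsto_real_sqrt[OF this]
  have "(\<lambda>n. norm (l2_class (s n) - l2_class f)) \<longlonglongrightarrow> 0" by simp
  then show ?thesis using LIM_zero_iff tendsto_norm_zero_iff by blast
qed

lemma l2_class_sum:
  assumes "finite A" "\<And>i. i \<in> A \<Longrightarrow> square_integrable (f i)"
  shows "square_integrable (\<lambda>x. \<Sum>i\<in>A. f i x) \<and>
    l2_class (\<lambda>x. \<Sum>i\<in>A. f i x) = (\<Sum>i\<in>A. l2_class (f i))"
  using assms
proof (induction A rule: finite_induct)
  case empty
  then show ?case by (simp add: square_integrable_zero zero_l2_def)
next
  case (insert a A)
  then show ?case by (auto simp: l2_class_add[symmetric] intro: square_integrable_add)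
qed

lemma l2_separable: "\<exists>Q :: l2 set. countable Q \<and> closure Q = UNIV"
proof -
  define D where "D = (\<lambda>(a, b). l2_class (indicator {real_of_rat a<..real_of_rat b})) ` UNIV"
  have "countable D" unfolding D_def by auto
  then obtain Q where Q: "countable Q" "D \<subseteq> Q" and V: "subspace (closure Q)"
    by (rule countable_dense_l2_subspace)
  have closedV: "f \<in> closure Q" if "\<And>n. X n \<in> closure Q" "X \<longlonglongrightarrow> f" for X f
    using that closed_sequentially[OF closed_closure, of X Q f] by blast
  have sq: "square_integrable (indicator (A \<inter> {- real n<..real n}))"
    if "A \<in> sets borel" for A and n :: nat
  proof (rule square_integrable_indicator)
    have "emeasure lborel (A \<inter> {- real n<..real n}) \<le> emeasure lborel {- real n<..real n}"
      by (rule emeasure_mono) auto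
    then show "emeasure lborel (A \<inter> {- real n<..real n}) < \<infinity>"
      by (rule le_less_trans) simp
  qed (use that in auto)
  have ind: "l2_class (indicator (A \<inter> {- real n<..real n})) \<in> closure Q"
    if A: "A \<in> sets borel" for A and n :: nat
  proof -
    have "A \<in> sigma_sets UNIV (range (\<lambda>a::real. {..<a}))"
      using A unfolding borel_Iio by (simp add: sets_measure_of)
    then show ?thesis
    proof (rule sigma_sets_induct_disjoint[rotated 2,
          where P = "\<lambda>A. l2_class (indicator (A \<inter> {- real n<..real n})) \<in> closure Q"])
      have rat: "l2_class (indicator {real_of_rat a<..real_of_rat b}) \<in> closure Q" for a b
        using Q(2) closure_subset unfolding D_def by blast
      then have full: "l2_class (indicator {- real n<..real n}) \<in> closure Q"
        using rat[of "- of_nat n" "of_nat n"] by (simp add: of_rat_minus)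
      {
        fix A :: "real set" assume "A \<in> range (\<lambda>a::real. {..<a})"
        then obtain c where A: "A = {..<c}" by blast
        show "l2_class (indicator (A \<inter> {- real n<..real n})) \<in> closure Q"
        proof (cases "c \<le> real n")
          case False
          then have "A \<inter> {- real n<..real n} = {- real n<..real n}" using A by auto
          then show ?thesis using full by simp
        next
          case True
          have "\<exists>q. c - 1 / real (Suc k) < of_rat q \<and> of_rat q < c" for k
            using of_rat_dense[of "c - 1 / real (Suc k)" c] by simp
          then obtain q where q: "\<And>k. c - 1 / real (Suc k) < of_rat (q k)" "\<And>k. of_rat (q k) < c"
            by metis
          have q_lim: "(\<lambda>k. of_rat (q k)) \<longlonglongrightarrow> c"
          proof (rule tendsto_sandwich[OF _ _ _ tendsto_const])
            show "(\<lambda>k. c - 1 / real (Suc k)) \<longlonglongrightarrow> c"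
              using tendsto_diff[OF tendsto_const[of c] LIMSEQ_inverse_real_of_nat]
              by (simp add: inverse_eq_divide)
          qed (use q in \<open>auto intro!: always_eventually less_imp_le\<close>)
          have eq: "A \<inter> {- real n<..real n} = {- real n<..<c}" using A True by auto
          show ?thesis unfolding eq
          proof (rule closedV)
            show "l2_class (indicator {real_of_rat (- of_nat n)<..real_of_rat (q k)}) \<in> closure Q" for k
              by (rule rat)
            show "(\<lambda>k. l2_class (indicator {real_of_rat (- of_nat n)<..real_of_rat (q k)}))
              \<longlonglongrightarrow> l2_class (indicator {- real n<..<c})"
            proof (rule l2_class_tendstoI)
              show "square_integrable (indicator {real_of_rat (- of_nat n)<..real_of_rat (q k)})" for k
                by (rule square_integrable_indicator)
                    (use emeasure_bounded_finite[OF bounded_subset[OF bounded_closed_interval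
                        greaterThanAtMost_subseteq_atLeastAtMost_iff[THEN iffD2]]] in auto)
              show "square_integrable (indicator {- real n<..<c})"
                using sq[of "{..<c}" n] A eq by simp
              fix x
              show "\<bar>indicator {real_of_rat (- of_nat n)<..real_of_rat (q k)} x\<bar>
                  \<le> 2 * \<bar>indicator {- real n<..<c} x :: real\<bar>" for k
                using q(2)[of k] by (auto simp: indicator_def of_rat_minus)
              show "(\<lambda>k. indicator {real_of_rat (- of_nat n)<..real_of_rat (q k)} x)
                \<longlonglongrightarrow> (indicator {- real n<..<c} x :: real)"
              proof (rule tendsto_eventually, cases "x < c")
                case True
                then have "eventually (\<lambda>k. x < of_rat (q k)) sequentially"
                  using order_tendstoD(1)[OF q_lim] by blast
                then show "eventually (\<lambda>k. indicator {real_of_rat (- of_nat n)<..real_of_rat (q k)} x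
                  = (indicator {- real n<..<c} x :: real)) sequentially"
                  by eventually_elim (use True in \<open>auto simp: indicator_def of_rat_minus\<close>)
              next
                case False
                then have "\<not> x \<le> of_rat (q k)" for k using q(2)[of k] by linarith
                then show "eventually (\<lambda>k. indicator {real_of_rat (- of_nat n)<..real_of_rat (q k)} x
                  = (indicator {- real n<..<c} x :: real)) sequentially"
                  using False by (auto simp: indicator_def)
              qed
            qed
          qed
        qed
      next
        have "(indicator {} :: real \<Rightarrow> real) = (\<lambda>x. 0)" by auto
        then have "l2_class (indicator {}) = 0" by (simp add: zero_l2_def)
        then show "l2_class (indicator ({} \<inter> {- real n<..real n})) \<in> closure Q"
          using subspace_0[OF V] by simp
      next
        fix A :: "real set"
        assume A: "A \<in> sigma_sets UNIV (range (\<lambda>a::real. {..<a}))"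
          and IH: "l2_class (indicator (A \<inter> {- real n<..real n})) \<in> closure Q"
        have "A \<in> sets borel"
          using A unfolding borel_Iio by (simp add: sets_measure_of)
        then have "l2_class (indicator ((UNIV - A) \<inter> {- real n<..real n})) =
            l2_class (indicator {- real n<..real n}) - l2_class (indicator (A \<inter> {- real n<..real n}))"
          using sq[of A n] sq[of UNIV n]
          by (simp add: l2_class_diff) (rule arg_cong[where f = l2_class], auto simp: indicator_def)
        then show "l2_class (indicator ((UNIV - A) \<inter> {- real n<..real n})) \<in> closure Q"
          using subspace_diff[OF V full IH] by simp
      next
        fix A :: "nat \<Rightarrow> real set"
        assume dis: "disjoint_family A"
          and A: "range A \<subseteq> sigma_sets UNIV (range (\<lambda>a::real. {..<a}))"
          and IH: "\<And>i. l2_class (indicator (A i \<inter> {- real n<..real n})) \<in> closure Q"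
        have sets: "A i \<in> sets borel" for i
          using A unfolding borel_Iio by (auto simp: sets_measure_of)
        show "l2_class (indicator (\<Union> (range A) \<inter> {- real n<..real n})) \<in> closure Q"
        proof (rule closedV)
          let ?s = "\<lambda>k x. \<Sum>i<k. indicator (A i \<inter> {- real n<..real n}) x :: real"
          have s: "square_integrable (?s k) \<and>
            l2_class (?s k) = (\<Sum>i<k. l2_class (indicator (A i \<inter> {- real n<..real n})))" for k
            by (rule l2_class_sum) (auto intro: sq sets)
          then show "l2_class (?s k) \<in> closure Q" for k
            using subspace_sum[OF V, of "{..<k}"] IH by simp
          have s_eq: "?s k x = indicator ((\<Union>i<k. A i) \<inter> {- real n<..real n}) x" for k x
          proof -
            have "indicator (\<Union>i<k. A i \<inter> {- real n<..real n}) x = ?s k x"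
              by (rule indicator_UN_disjoint)
                (use dis in \<open>auto simp: disjoint_family_on_def\<close>)
            then show ?thesis by (simp add: Int_UN_distrib2)
          qed
          show "(\<lambda>k. l2_class (?s k)) \<longlonglongrightarrow> l2_class (indicator (\<Union> (range A) \<inter> {- real n<..real n}))"
          proof (rule l2_class_tendstoI)
            show "square_integrable (?s k)" for k using s by blast
            show "square_integrable (indicator (\<Union> (range A) \<inter> {- real n<..real n}))"
              using sets by (intro sq) auto
            fix x
            show "\<bar>?s k x\<bar> \<le> 2 * \<bar>indicator (\<Union> (range A) \<inter> {- real n<..real n}) x :: real\<bar>" for k
              unfolding s_eq by (auto simp: indicator_def)
            show "(\<lambda>k. ?s k x) \<longlonglongrightarrow> indicator (\<Union> (range A) \<inter> {- real n<..real n}) x"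
            proof (cases "x \<in> \<Union> (range A)")
              case True
              then obtain i where "x \<in> A i" by blast
              then show ?thesis unfolding s_eq
                by (intro tendsto_eventually eventually_mono[OF eventually_gt_at_top[of i]])
                  (auto simp: indicator_def)
            qed (auto simp: s_eq indicator_def)
          qed
        qed
      }
      have "{..<a} \<inter> {..<b} = {..<min a b}" for a b :: real by auto
      then show "Int_stable (range (\<lambda>a::real. {..<a}))"
        by (auto simp: Int_stable_def)
    qed auto
  qed
  have "f \<in> closure Q" for f
  proof -
    define g where "g = l2_rep f"
    have g: "square_integrable g" and f: "f = l2_class g" by (simp_all add: g_def)
    then obtain F where F: "\<And>i. simple_function lborel (F i)"
      "\<And>x. (\<lambda>i. F i x) \<longlonglongrightarrow> g x" "\<And>i x. \<bar>F i x\<bar> \<le> 2 * \<bar>g x\<bar>"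
      using borel_measurable_implies_sequence_metric[of g lborel 0]
      by (auto simp: square_integrable_def dist_real_def)
    define s where "s i x = (\<Sum>y\<in>range (F i). y * indicator (F i -` {y} \<inter> {- real i<..real i}) x)"
      for i x
    have fin: "finite (range (F i))" for i
      using F(1)[of i] by (simp add: simple_function_def)
    have meas: "F i -` {y} \<in> sets borel" for i y
      using simple_functionD(2)[OF F(1)[of i], of "{y}"] by simp
    have s_eq: "s i x = F i x * indicator {- real i<..real i} x" for i x
    proof -
      have "s i x = (\<Sum>y\<in>range (F i). if y = F i x then F i x * indicator {- real i<..real i} x else 0)"
        unfolding s_def by (intro sum.cong) (auto simp: indicator_def)
      then show ?thesis using fin[of i] by simp
    qed
    have s: "square_integrable (s i) \<and> l2_class (s i) =
        (\<Sum>y\<in>range (F i). l2_class (\<lambda>x. y * indicator (F i -` {y} \<inter> {- real i<..real i}) x))" for i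
      unfolding s_def[abs_def] by (rule l2_class_sum) (auto intro!: fin square_integrable_scale sq meas)
    show ?thesis unfolding f
    proof (rule closedV)
      have "l2_class (\<lambda>x. y * indicator (F i -` {y} \<inter> {- real i<..real i}) x) \<in> closure Q" for i y
        using subspace_scale[OF V ind[OF meas[of i y], of i], of y]
        by (simp add: l2_class_scaleR sq meas)
      then show "l2_class (s i) \<in> closure Q" for i
        using s[of i] by (simp add: subspace_sum[OF V])
      show "(\<lambda>i. l2_class (s i)) \<longlonglongrightarrow> l2_class g"
      proof (rule l2_class_tendstoI)
        show "square_integrable (s i)" for i using s by blast
        show "square_integrable g" by (rule g)
        fix x
        show "\<bar>s i x\<bar> \<le> 2 * \<bar>g x\<bar>" for i
          using F(3)[of i x] by (auto simp: s_eq indicator_def)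
        obtain N :: nat where N: "\<bar>x\<bar> < real N" using reals_Archimedean2 by blast
        have "eventually (\<lambda>i. s i x = F i x) sequentially"
          using eventually_ge_at_top[of N]
          by eventually_elim (use N in \<open>auto simp: s_eq indicator_def\<close>)
        then show "(\<lambda>i. s i x) \<longlonglongrightarrow> g x"
          using F(2)[of x] by (simp add: tendsto_cong)
      qed
    qed
  qed
  then show ?thesis using Q(1) by blast
qed

instance l2 :: second_countable_topology
proof
  obtain Q :: "l2 set" where Q: "countable Q" "closure Q = UNIV" using l2_separable by blast
  define B where "B = (\<lambda>(q, n). ball q (1 / real (Suc n))) ` (Q \<times> UNIV)"
  have "topological_basis B"
  proof (rule topological_basisI)
    show "open b" if "b \<in> B" for b using that unfolding B_def by auto
  next
    fix U :: "l2 set" and x assume "open U" "x \<in> U"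
    then obtain e where e: "e > 0" "ball x e \<subseteq> U" by (meson openE)
    obtain n where n: "2 / e < real n" using reals_Archimedean2 by blast
    then have n': "2 * (1 / real (Suc n)) < e"
      using e(1) by (simp add: field_simps)
    have "x \<in> closure Q" by (simp add: Q)
    then obtain q where q: "q \<in> Q" "dist q x < 1 / real (Suc n)"
      unfolding closure_approachable using divide_pos_pos[of 1 "real (Suc n)"] by (metis of_nat_0_less_iff zero_less_Suc zero_less_one)
    have "ball q (1 / real (Suc n)) \<subseteq> ball x e"
    proof
      fix y assume "y \<in> ball q (1 / real (Suc n))"
      then have "dist q y < 1 / real (Suc n)" by simp
      then have "dist x y < e"
        using dist_triangle[of x y q] q(2) n' by (simp add: dist_commute)
      then show "y \<in> ball x e" by simp
    qed
    moreover have "ball q (1 / real (Suc n)) \<in> B" using q(1) unfolding B_def by auto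
    ultimately show "\<exists>b\<in>B. x \<in> b \<and> b \<subseteq> U" using q(2) e(2) by (intro bexI[of _ "ball q (1 / real (Suc n))"]) auto
  qed
  moreover have "countable B" unfolding B_def using Q(1) by auto
  ultimately show "\<exists>B :: l2 set set. countable B \<and> open = generate_topology B"
    using topological_basis_imp_subbasis by blast
qed

lemma ennreal_suminf_component: "u k \<le> (\<Sum>k. u k :: ennreal)"
  using sum_le_suminf[OF summableI, of "{k}" u] by simp

lemma square_integrableI_nn_integral:
  assumes [measurable]: "f \<in> borel_measurable lborel"
    and "(\<integral>\<^sup>+x. ennreal ((f x)\<^sup>2) \<partial>lborel) < \<infinity>"
  shows "square_integrable f"
  unfolding square_integrable_def
  using assms(2) by (auto intro!: integrableI_nonneg)

instance l2 :: banach
proof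
  fix X :: "nat \<Rightarrow> l2" assume X: "Cauchy X"
  have "\<exists>N. \<forall>m\<ge>N. \<forall>n\<ge>N. dist (X m) (X n) < (1/2) ^ k" for k :: nat
    using X unfolding Cauchy_def by (meson zero_less_divide_1_iff zero_less_numeral zero_less_power)
  then obtain N where N: "\<And>k m n. m \<ge> N k \<Longrightarrow> n \<ge> N k \<Longrightarrow> dist (X m) (X n) < (1/2) ^ k"
    by metis
  define r where "r k = k + (\<Sum>i\<le>k. N i)" for k
  have r_ge: "r k \<ge> k" for k by (simp add: r_def)
  have r_N: "r k \<ge> N k" for k
    using member_le_sum[of k "{..k}" N] by (simp add: r_def)
  have r_mono: "r k \<le> r (Suc k)" for k by (simp add: r_def)
  define f where "f k = l2_rep (X (r k))" for k
  have f_sq: "square_integrable (f k)" and f_X: "l2_class (f k) = X (r k)" for k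
    by (simp_all add: f_def)
  have f_meas [measurable]: "f k \<in> borel_measurable lborel" for k
    using f_sq[of k] by (simp add: square_integrable_def)
  have diff_meas: "(\<lambda>x. ennreal (2 ^ k * (f (Suc k) x - f k x)\<^sup>2)) \<in> borel_measurable lborel" for k
    by measurable
  have "(\<integral>\<^sup>+x. (\<Sum>k. ennreal (2 ^ k * (f (Suc k) x - f k x)\<^sup>2)) \<partial>lborel)
      = (\<Sum>k. \<integral>\<^sup>+x. ennreal (2 ^ k * (f (Suc k) x - f k x)\<^sup>2) \<partial>lborel)"
    by (rule nn_integral_suminf) (rule diff_meas)
  also have "\<dots> \<le> (\<Sum>k. ennreal ((1/2) ^ k))"
  proof (rule suminf_le)
    fix k
    have "(\<integral>\<^sup>+x. ennreal (2 ^ k * (f (Suc k) x - f k x)\<^sup>2) \<partial>lborel)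
        = ennreal (2 ^ k) * (\<integral>\<^sup>+x. ennreal ((f (Suc k) x - f k x)\<^sup>2) \<partial>lborel)"
      by (subst nn_integral_cmult[symmetric]) (auto simp: ennreal_mult)
    also have "(\<integral>\<^sup>+x. ennreal ((f (Suc k) x - f k x)\<^sup>2) \<partial>lborel) = ennreal ((dist (X (r (Suc k))) (X (r k)))\<^sup>2)"
      by (simp add: nn_integral_l2_class square_integrable_diff f_sq l2_class_diff[symmetric] f_X dist_norm)
    also have "ennreal (2 ^ k) * \<dots> \<le> ennreal (2 ^ k) * ennreal (((1/2) ^ k)\<^sup>2)"
    proof -
      have "dist (X (r (Suc k))) (X (r k)) \<le> (1/2) ^ k"
        by (rule less_imp_le, rule N) (use r_N[of k] r_mono[of k] in auto)
      then show ?thesis by (intro mult_left_mono ennreal_leI power_mono) auto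
    qed
    also have "\<dots> = ennreal ((1/2) ^ k)"
      by (simp add: ennreal_mult[symmetric] power2_eq_square power_divide)
    finally show "(\<integral>\<^sup>+x. ennreal (2 ^ k * (f (Suc k) x - f k x)\<^sup>2) \<partial>lborel) \<le> ennreal ((1/2) ^ k)" .
  qed auto
  also have "\<dots> = ennreal (\<Sum>k. (1/2) ^ k)"
    by (rule suminf_ennreal2) (auto intro: summable_geometric)
  also have "\<dots> < \<infinity>" by simp
  finally have "AE x in lborel. (\<Sum>k. ennreal (2 ^ k * (f (Suc k) x - f k x)\<^sup>2)) \<noteq> \<infinity>"
    by (intro nn_integral_noteq_infinite) auto
  then have conv: "AE x in lborel. convergent (\<lambda>k. f k x)"
  proof eventually_elim
    case (elim x)
    define G where "G = enn2real (\<Sum>k. ennreal (2 ^ k * (f (Suc k) x - f k x)\<^sup>2))"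
    have G: "ennreal G = (\<Sum>k. ennreal (2 ^ k * (f (Suc k) x - f k x)\<^sup>2))"
      unfolding G_def using elim by (simp add: less_top)
    have G_nn: "G \<ge> 0" by (simp add: G_def)
    have bound: "\<bar>f (Suc k) x - f k x\<bar> \<le> sqrt G * (1 / sqrt 2) ^ k" for k
    proof -
      have "ennreal (2 ^ k * (f (Suc k) x - f k x)\<^sup>2) \<le> ennreal G"
        unfolding G by (rule ennreal_suminf_component)
      then have "2 ^ k * (f (Suc k) x - f k x)\<^sup>2 \<le> G" using G_nn by simp
      then have "sqrt (2 ^ k * (f (Suc k) x - f k x)\<^sup>2) \<le> sqrt G" by simp
      then have "sqrt 2 ^ k * \<bar>f (Suc k) x - f k x\<bar> \<le> sqrt G"
        by (simp only: real_sqrt_mult real_sqrt_abs real_sqrt_power[of 2])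
      then have "\<bar>f (Suc k) x - f k x\<bar> \<le> sqrt G / sqrt 2 ^ k"
        by (simp add: pos_le_divide_eq mult.commute)
      then show ?thesis by (simp add: power_one_over)
    qed
    have "summable (\<lambda>k. sqrt G * (1 / sqrt 2) ^ k)"
      by (intro summable_mult summable_geometric) auto
    then have "summable (\<lambda>k. f (Suc k) x - f k x)"
      by (rule summable_comparison_test[rotated]) (use bound in auto)
    then have "convergent (\<lambda>n. \<Sum>k<n. f (Suc k) x - f k x)"
      by (simp add: summable_iff_convergent)
    then have "convergent (\<lambda>n. (f n x - f 0 x) + f 0 x)"
      by (intro convergent_add convergent_const) (simp add: sum_lessThan_telescope[of "\<lambda>k. f k x"])
    then show ?case by simp
  qed
  define F where "F x = lim (\<lambda>k. f k x)" for x
  have F_meas [measurable]: "F \<in> borel_measurable lborel"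
    unfolding F_def by (rule borel_measurable_lim_metric) (rule f_meas)
  have est: "(\<integral>\<^sup>+x. ennreal ((F x - l2_rep (X n) x)\<^sup>2) \<partial>lborel) \<le> ennreal (((1/2) ^ j)\<^sup>2)"
    if n: "n \<ge> N j" for n j
  proof -
    let ?g = "l2_rep (X n)"
    have g_meas [measurable]: "?g \<in> borel_measurable lborel"
      using square_integrable_l2_rep[of "X n"] by (simp add: square_integrable_def)
    have "(\<integral>\<^sup>+x. ennreal ((F x - ?g x)\<^sup>2) \<partial>lborel)
        = (\<integral>\<^sup>+x. liminf (\<lambda>k. ennreal ((f k x - ?g x)\<^sup>2)) \<partial>lborel)"
    proof (rule nn_integral_cong_AE)
      show "AE x in lborel. ennreal ((F x - ?g x)\<^sup>2) = liminf (\<lambda>k. ennreal ((f k x - ?g x)\<^sup>2))"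
        using conv
      proof eventually_elim
        case (elim x)
        then have "(\<lambda>k. f k x) \<longlonglongrightarrow> F x" unfolding F_def by (simp add: convergent_LIMSEQ_iff)
        then have "(\<lambda>k. ennreal ((f k x - ?g x)\<^sup>2)) \<longlonglongrightarrow> ennreal ((F x - ?g x)\<^sup>2)"
          by (intro tendsto_ennrealI tendsto_intros)
        then show ?case using lim_imp_Liminf trivial_limit_sequentially by metis
      qed
    qed
    also have "\<dots> \<le> liminf (\<lambda>k. \<integral>\<^sup>+x. ennreal ((f k x - ?g x)\<^sup>2) \<partial>lborel)"
      by (rule nn_integral_liminf) measurable
    also have "\<dots> \<le> ennreal (((1/2) ^ j)\<^sup>2)"
    proof (rule Liminf_le)
      show "\<forall>\<^sub>F k in sequentially. (\<integral>\<^sup>+x. ennreal ((f k x - ?g x)\<^sup>2) \<partial>lborel) \<le> ennreal (((1/2) ^ j)\<^sup>2)"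
        using eventually_ge_at_top[of "N j"]
      proof eventually_elim
        case (elim k)
        have "(\<integral>\<^sup>+x. ennreal ((f k x - ?g x)\<^sup>2) \<partial>lborel) = ennreal ((dist (X (r k)) (X n))\<^sup>2)"
          by (simp add: nn_integral_l2_class square_integrable_diff f_sq l2_class_diff[symmetric] f_X dist_norm)
        moreover have "dist (X (r k)) (X n) \<le> (1/2) ^ j"
          by (rule less_imp_le, rule N) (use n elim r_ge[of k] in auto)
        ultimately show ?case by (auto intro!: ennreal_leI power_mono)
      qed
    qed simp
    finally show ?thesis .
  qed
  have diff_sq: "square_integrable (\<lambda>x. F x - l2_rep (X n) x)" if "n \<ge> N j" for n j
  proof (rule square_integrableI_nn_integral)
    have "l2_rep (X n) \<in> borel_measurable lborel"
      using square_integrable_l2_rep[of "X n"] by (simp add: square_integrable_def)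
    then show "(\<lambda>x. F x - l2_rep (X n) x) \<in> borel_measurable lborel" by measurable
    show "(\<integral>\<^sup>+x. ennreal ((F x - l2_rep (X n) x)\<^sup>2) \<partial>lborel) < \<infinity>"
      by (rule le_less_trans[OF est[OF that]]) simp
  qed
  have F_sq: "square_integrable F"
    using square_integrable_add[OF diff_sq[of 0 "N 0"] square_integrable_l2_rep[of "X (N 0)"]]
    by simp
  have "X \<longlonglongrightarrow> l2_class F"
  proof (rule metric_LIMSEQ_I)
    fix e :: real assume "e > 0"
    then obtain j where j: "(1/2) ^ j < e" using real_arch_pow_inv[of e "1/2"] by auto
    have "dist (X n) (l2_class F) < e" if "n \<ge> N j" for n
    proof -
      have "l2_class (\<lambda>x. F x - l2_rep (X n) x) = l2_class F - X n"
        using l2_class_diff[OF F_sq square_integrable_l2_rep[of "X n"]] by simp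
      then have "ennreal ((norm (l2_class F - X n))\<^sup>2) \<le> ennreal (((1/2) ^ j)\<^sup>2)"
        using est[OF that] nn_integral_l2_class[OF diff_sq[OF that]] by simp
      then have "(norm (l2_class F - X n))\<^sup>2 \<le> ((1/2) ^ j)\<^sup>2" by simp
      then have "norm (l2_class F - X n) \<le> (1/2) ^ j" by (rule power2_le_imp_le) simp
      then show ?thesis using j by (simp add: dist_norm norm_minus_commute)
    qed
    then show "\<exists>n0. \<forall>n\<ge>n0. dist (X n) (l2_class F) < e" by blast
  qed
  then show "convergent X" by (rule convergentI)
qed


section \<open>Function spaces on an interval\<close>

text \<open>\<open>L\<^sup>2(a, b)\<close> is the closed subspace of classes vanishing almost everywhere outside \<open>(a, b)\<close>
  (extension by zero).\<close>

definition L2_on :: "real \<Rightarrow> real \<Rightarrow> l2 set" where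
  "L2_on a b = {f. AE x in lborel. x \<notin> {a<..<b} \<longrightarrow> l2_rep f x = 0}"

definition square_integrable_on :: "real \<Rightarrow> real \<Rightarrow> (real \<Rightarrow> real) \<Rightarrow> bool" where
  "square_integrable_on a b f \<longleftrightarrow> square_integrable (\<lambda>x. indicator {a<..<b} x * f x)"

definition L2_class_on :: "real \<Rightarrow> real \<Rightarrow> (real \<Rightarrow> real) \<Rightarrow> l2" where
  "L2_class_on a b f = l2_class (\<lambda>x. indicator {a<..<b} x * f x)"

text \<open>Weak derivative on \<open>(a, b)\<close>, tested against \<open>C\<^sup>1\<close> functions \<open>\<psi>\<close> with compact support in
  \<open>(a, b)\<close> (testing against \<open>C\<^sup>\<infinity>\<close> functions gives the same notion).\<close>

definition weak_deriv :: "real \<Rightarrow> real \<Rightarrow> (real \<Rightarrow> real) \<Rightarrow> (real \<Rightarrow> real) \<Rightarrow> bool" where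
  "weak_deriv a b f g \<longleftrightarrow>
    (\<forall>\<psi> \<psi>'. (\<forall>x. (\<psi> has_real_derivative \<psi>' x) (at x)) \<longrightarrow> continuous_on UNIV \<psi>' \<longrightarrow>
      (\<exists>c d. a < c \<and> d < b \<and> (\<forall>x. x \<notin> {c..d} \<longrightarrow> \<psi> x = 0)) \<longrightarrow>
      (LINT x:{a<..<b}|lborel. f x * \<psi>' x) = - (LINT x:{a<..<b}|lborel. g x * \<psi> x))"

text \<open>\<open>D 0 \<in> H\<^sup>n(a, b)\<close> with (representatives of the) weak derivatives \<open>D 1, \<dots>, D n\<close>.\<close>

definition sobolev_derivs :: "real \<Rightarrow> real \<Rightarrow> nat \<Rightarrow> (nat \<Rightarrow> real \<Rightarrow> real) \<Rightarrow> bool" where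
  "sobolev_derivs a b n D \<longleftrightarrow>
    (\<forall>k\<le>n. square_integrable_on a b (D k)) \<and> (\<forall>k<n. weak_deriv a b (D k) (D (Suc k)))"

text \<open>Elements of \<open>H\<^sup>1(a, b)\<close> are identified with their continuous representative on \<open>[a, b]\<close>,
  so that \<open>u a\<close> is the trace.\<close>

definition has_H1_deriv :: "real \<Rightarrow> real \<Rightarrow> (real \<Rightarrow> real) \<Rightarrow> (real \<Rightarrow> real) \<Rightarrow> bool" where
  "has_H1_deriv a b u v \<longleftrightarrow>
    continuous_on {a..b} u \<and> (\<exists>D. sobolev_derivs a b 1 D \<and> D 0 = u \<and> D 1 = v)"

definition H1 :: "real \<Rightarrow> real \<Rightarrow> (real \<Rightarrow> real) set" where
  "H1 a b = {u. \<exists>v. has_H1_deriv a b u v}"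

text \<open>Derivatives on the closed interval \<open>[0, L]\<close> are one-sided at the end points.\<close>

definition deriv_on :: "real \<Rightarrow> (real \<Rightarrow> real) \<Rightarrow> real \<Rightarrow> real" where
  "deriv_on L p x = vector_derivative p (at x within {0..L})"

definition smooth_on :: "real \<Rightarrow> (real \<Rightarrow> real) \<Rightarrow> bool" where
  "smooth_on L p \<longleftrightarrow> (\<forall>n. \<forall>x\<in>{0..L}. (deriv_on L ^^ n) p differentiable (at x within {0..L}))"


section \<open>Strongly continuous semigroups and mild solutions\<close>

text \<open>Semigroups of bounded operators on a subspace \<open>X\<close>; only times \<open>t \<ge> 0\<close> and vectors in \<open>X\<close>
  matter, the values of \<open>S\<close> elsewhere are irrelevant.\<close>

definition C0_semigroup :: "'a::real_normed_vector set \<Rightarrow> (real \<Rightarrow> 'a \<Rightarrow> 'a) \<Rightarrow> bool" where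
  "C0_semigroup X S \<longleftrightarrow>
    (\<forall>t\<ge>0. \<forall>f\<in>X. S t f \<in> X) \<and>
    (\<forall>t\<ge>0. \<forall>f\<in>X. \<forall>g\<in>X. S t (f + g) = S t f + S t g) \<and>
    (\<forall>t\<ge>0. \<forall>c. \<forall>f\<in>X. S t (c *\<^sub>R f) = c *\<^sub>R S t f) \<and>
    (\<forall>t\<ge>0. \<exists>M. \<forall>f\<in>X. norm (S t f) \<le> M * norm f) \<and>
    (\<forall>f\<in>X. S 0 f = f) \<and>
    (\<forall>s\<ge>0. \<forall>t\<ge>0. \<forall>f\<in>X. S (s + t) f = S s (S t f)) \<and>
    (\<forall>f\<in>X. ((\<lambda>t. S t f) \<longlongrightarrow> f) (at_right 0))"

text \<open>Unbounded operators are represented by their graphs.\<close>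

definition generator ::
  "'a::real_normed_vector set \<Rightarrow> (real \<Rightarrow> 'a \<Rightarrow> 'a) \<Rightarrow> ('a \<times> 'a) set" where
  "generator X S =
    {(f, g). f \<in> X \<and> g \<in> X \<and> ((\<lambda>h. (S h f - f) /\<^sub>R h) \<longlongrightarrow> g) (at_right 0)}"

text \<open>Mild solution on \<open>[0, T]\<close> of \<open>z' = B z + F\<close>, \<open>z(0) = z0\<close>, where \<open>B\<close> generates \<open>S\<close>.\<close>

definition mild_solution ::
  "(real \<Rightarrow> l2 \<Rightarrow> l2) \<Rightarrow> real \<Rightarrow> l2 \<Rightarrow> (real \<Rightarrow> l2) \<Rightarrow> (real \<Rightarrow> l2) \<Rightarrow> bool" where
  "mild_solution S T z0 F z \<longleftrightarrow>
    (\<forall>t\<in>{0..T}. set_integrable lborel {0..t} (\<lambda>s. S (t - s) (F s)) \<and>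
      z t = S t z0 + (LINT s:{0..t}|lborel. S (t - s) (F s)))"


section \<open>The boundary controlled linear Kuramoto-Sivashinsky equation\<close>

text \<open>Graph of \<open>A \<phi> = \<lambda> \<phi>\<^sub>x\<^sub>x + \<phi>\<^sub>x\<^sub>x\<^sub>x\<^sub>x\<close>. The boundary values are those of the continuous representatives
  of \<open>\<phi>\<^sub>x\<close> and \<open>\<phi>\<^sub>x\<^sub>x\<^sub>x\<close>.\<close>

definition ks_operator :: "real \<Rightarrow> real \<Rightarrow> (l2 \<times> l2) set" where
  "ks_operator L lam =
    {(\<phi>, \<psi>). \<exists>D. sobolev_derivs 0 L 4 D \<and>
      continuous_on {0..L} (D 1) \<and> continuous_on {0..L} (D 3) \<and>
      D 1 0 = 0 \<and> D 3 0 = 0 \<and> D 1 L = 0 \<and> D 3 L = 0 \<and>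
      \<phi> = L2_class_on 0 L (D 0) \<and> \<psi> = L2_class_on 0 L (\<lambda>x. lam * D 2 x + D 4 x)}"

definition ks_semigroup :: "real \<Rightarrow> real \<Rightarrow> (real \<Rightarrow> l2 \<Rightarrow> l2) \<Rightarrow> bool" where
  "ks_semigroup L lam S \<longleftrightarrow> C0_semigroup (L2_on 0 L) S \<and>
    generator (L2_on 0 L) S = {(\<phi>, - \<psi>) |\<phi> \<psi>. (\<phi>, \<psi>) \<in> ks_operator L lam}"

definition boundary_lift :: "real \<Rightarrow> real \<Rightarrow> real \<Rightarrow> (real \<Rightarrow> real) \<Rightarrow> bool" where
  "boundary_lift L c1 c3 p \<longleftrightarrow> smooth_on L p \<and>
    deriv_on L p 0 = c1 \<and> (deriv_on L ^^ 3) p 0 = c3 \<and>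
    deriv_on L p L = 0 \<and> (deriv_on L ^^ 3) p L = 0"

definition ks_source :: "real \<Rightarrow> real \<Rightarrow> (real \<Rightarrow> real) \<Rightarrow> (real \<Rightarrow> real) \<Rightarrow> (real \<Rightarrow> real) \<Rightarrow> real \<Rightarrow> l2" where
  "ks_source L lam p u v t =
    v t *\<^sub>R L2_class_on 0 L p +
    u t *\<^sub>R L2_class_on 0 L (\<lambda>x. lam * (deriv_on L ^^ 2) p x + (deriv_on L ^^ 4) p x)"

text \<open>\<open>y\<close> is the solution of \<open>y\<^sub>t + \<lambda> y\<^sub>x\<^sub>x + y\<^sub>x\<^sub>x\<^sub>x\<^sub>x = 0\<close> on \<open>[0, T]\<close> with boundary data
  \<open>y\<^sub>x(t, 0) = u1 t\<close>, \<open>y\<^sub>x\<^sub>x\<^sub>x(t, 0) = u2 t\<close>, \<open>y\<^sub>x(t, L) = y\<^sub>x\<^sub>x\<^sub>x(t, L) = 0\<close> and initial value \<open>y0\<close>, obtained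
  by lifting the boundary data with \<open>p1\<close>, \<open>p2\<close>. The semigroup \<open>S\<close> (on \<open>L\<^sup>2(0, L)\<close>) is determined by its
  generator, and \<open>v1\<close>, \<open>v2\<close> are determined almost everywhere, so there is at most one
  \<open>y\<close> on \<open>[0, T]\<close>.\<close>

definition ks_solution ::
  "real \<Rightarrow> real \<Rightarrow> (real \<Rightarrow> real) \<Rightarrow> (real \<Rightarrow> real) \<Rightarrow> real \<Rightarrow> l2 \<Rightarrow>
    (real \<Rightarrow> real) \<Rightarrow> (real \<Rightarrow> real) \<Rightarrow> (real \<Rightarrow> l2) \<Rightarrow> bool" where
  "ks_solution L lam p1 p2 T y0 u1 u2 y \<longleftrightarrow>
    continuous_on {0..T} y \<and>
    (\<exists>S v1 v2 z. ks_semigroup L lam S \<and> has_H1_deriv 0 T u1 v1 \<and> has_H1_deriv 0 T u2 v2 \<and>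
      mild_solution S T
        (y0 - u1 0 *\<^sub>R L2_class_on 0 L p1 - u2 0 *\<^sub>R L2_class_on 0 L p2)
        (\<lambda>t. - (ks_source L lam p1 u1 v1 t + ks_source L lam p2 u2 v2 t)) z \<and>
      (\<forall>t\<in>{0..T}. y t = z t + u1 t *\<^sub>R L2_class_on 0 L p1 + u2 t *\<^sub>R L2_class_on 0 L p2))"

end

theory Submission
  imports Defs
begin

text \<open>Null controllability is a moment problem, solved here by explicit power series. Let \<open>e\<^sub>k\<close> be the
  normalised cosines on \<open>(0, L)\<close>, \<open>\<kappa>\<^sub>k = (k \<pi> / L)\<^sup>2\<close>, \<open>\<mu>\<^sub>k = \<kappa>\<^sub>k (\<kappa>\<^sub>k - \<lambda>)\<close> and \<open>c\<^sub>k = e\<^sub>k(0)\<close>. Green's formula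
  turns the equation into the scalar equations \<open>y\<^sub>k' = - \<mu>\<^sub>k y\<^sub>k + c\<^sub>k ((\<lambda> - \<kappa>\<^sub>k) u\<^sub>1 + u\<^sub>2)\<close>, so that
  \<open>y(T) = 0\<close> amounts to \<open>(\<lambda> - \<kappa>\<^sub>k) U\<^sub>1(\<mu>\<^sub>k) + U\<^sub>2(\<mu>\<^sub>k) = - y\<^sub>0\<^sub>,\<^sub>k / c\<^sub>k\<close> for all \<open>k\<close>, where
  \<open>U\<^sub>i(\<mu>) = \<integral> exp (\<mu> t) u\<^sub>i(t) dt\<close> over \<open>(0, T)\<close>. If \<open>\<kappa>\<^sub>j + \<kappa>\<^sub>k = \<lambda>\<close> with \<open>j \<noteq> k\<close>, then \<open>\<mu>\<^sub>j = \<mu>\<^sub>k\<close>, and \<open>u\<^sub>2\<close>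
  alone cannot separate the two modes; the factor \<open>\<lambda> - \<kappa>\<close> in front of \<open>U\<^sub>1\<close> does.

  Put \<open>\<mu> = \<kappa> (\<kappa> - \<lambda>)\<close>. Every polynomial in \<open>\<kappa>\<close> can be written as \<open>(\<lambda> - \<kappa>) A(\<mu>) + B(\<mu>)\<close>, and for \<open>\<kappa>\<^sup>m\<close> the
  degrees of \<open>A\<close> and \<open>B\<close> are at most \<open>m / 2\<close>. Fix a bump function \<open>\<theta>\<close> supported inside \<open>(0, T)\<close> with
  transform \<open>M(\<mu>)\<close>. A factor \<open>\<mu>\<close> in front of \<open>M\<close> is a derivative of \<open>\<theta>\<close>, so \<open>\<kappa>\<^sup>m M\<close> is produced by controls
  that are combinations of derivatives of \<open>\<theta>\<close> of order at most \<open>m / 2\<close> (lemma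
  \<open>flat_series_pair_moment\<close>). It therefore suffices to find an entire function \<open>G(\<kappa>) = \<Sum>\<^sub>m g\<^sub>m \<kappa>\<^sup>m\<close>
  with \<open>G(\<kappa>\<^sub>k) = - y\<^sub>0\<^sub>,\<^sub>k / (c\<^sub>k M(\<mu>\<^sub>k))\<close> whose coefficients decay fast enough. A cosine transform does
  this: \<open>G(\<kappa>) = \<integral> F(x) cos (\<surd>\<kappa> x) dx\<close> over \<open>(0, L)\<close> takes at \<open>\<kappa>\<^sub>k\<close> the value \<open>F\<^sub>k / c\<^sub>k\<close>, so one
  takes for \<open>F\<close> the image of the initial datum under the Fourier multiplier \<open>- 1 / M(\<mu>\<^sub>k)\<close>, which is bounded
  because \<open>\<theta> \<ge> 0\<close> and \<open>\<mu>\<^sub>k\<close> is bounded below (lemmas \<open>bump_moment_lower\<close>, \<open>cos_taylor_sums\<close>,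
  \<open>flat_controls_exist\<close>). Expanding the cosine gives \<open>\<bar>g\<^sub>m\<bar> \<le> C L\<^sup>2\<^sup>m / (2 m)!\<close>. The bump function
  satisfies \<open>\<bar>\<theta>\<^sup>(\<^sup>n\<^sup>)\<bar> \<le> 4\<^sup>n (2 n)!\<close>, so with \<open>n\<close> about \<open>m / 2\<close> the \<open>m\<close>-th term of the series for the controls
  is of size \<open>R\<^sup>m m! / (2 m)!\<close>, which is summable.

  What remains is to justify the scalar equations. The cosines are a total orthonormal system
  (\<open>cos_mode_total\<close>), the operator and its domain are exactly described by cosine coefficients
  (\<open>ks_operator_coefficients\<close>, \<open>ks_operator_from_coefficients\<close>), hence the diagonal semigroup has
  the required generator (\<open>ks_semigroup_ks_flow\<close>), and the mild solution is computed
  coefficientwise (\<open>duhamel_coefficient\<close>, \<open>boundary_lift_coefficient\<close>).\<close>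

section \<open>Orthonormal expansions and diagonal semigroups\<close>

lemma tendsto_suminf_dominated:
  fixes a :: "nat \<Rightarrow> 'b \<Rightarrow> real"
  assumes "\<And>k. ((\<lambda>n. a k n) \<longlongrightarrow> b k) F"
    and "\<forall>\<^sub>F n in F. \<forall>k. \<bar>a k n\<bar> \<le> M k" "summable M"
  shows "((\<lambda>n. \<Sum>k. a k n) \<longlongrightarrow> (\<Sum>k. b k)) F"
proof (cases "F = bot")
  case False
  have "eventually (\<lambda>(k,n). norm (a k n) \<le> M k) (at_top \<times>\<^sub>F F)"
    using assms(2) unfolding eventually_prod_filter
    by (intro exI[of _ "\<lambda>_. True"] exI[of _ "\<lambda>n. \<forall>k. \<bar>a k n\<bar> \<le> M k"]) auto
  from tannerys_theorem[OF assms(1) this assms(3) False] show ?thesis by blast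
qed auto

text \<open>The space \<open>X\<close> is a subspace of the ambient Hilbert space because functions on an interval are
  represented by their extensions by zero to the line.\<close>

locale orthonormal_expansion =
  fixes X :: "'a::{real_inner, banach, second_countable_topology} set" and e :: "nat \<Rightarrow> 'a"
  assumes subspace_X: "subspace X" and closed_X: "closed X" and e_in: "\<And>k. e k \<in> X"
    and ortho: "\<And>i j. inner (e i) (e j) = (if i = j then 1 else 0)"
    and total: "\<And>f. f \<in> X \<Longrightarrow> (\<And>k. inner f (e k) = 0) \<Longrightarrow> f = 0"
begin

definition synth :: "(nat \<Rightarrow> real) \<Rightarrow> 'a" where
  "synth c = (\<Sum>k. c k *\<^sub>R e k)"

lemma norm_sum_sq: "finite A \<Longrightarrow> (norm (\<Sum>k\<in>A. c k *\<^sub>R e k))\<^sup>2 = (\<Sum>k\<in>A. (c k)\<^sup>2)"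
  unfolding power2_norm_eq_inner
  by (simp add: inner_sum_left inner_sum_right ortho power2_eq_square if_distrib sum.delta cong: if_cong)

lemma inner_sum_e: "finite A \<Longrightarrow> inner (\<Sum>k\<in>A. c k *\<^sub>R e k) (e j) = (if j \<in> A then c j else 0)"
  by (simp add: inner_sum_left ortho if_distrib sum.delta cong: if_cong)

lemma summable_synth:
  assumes "summable (\<lambda>k. (c k)\<^sup>2)"
  shows "summable (\<lambda>k. c k *\<^sub>R e k)"
  unfolding summable_Cauchy
proof (intro allI impI)
  fix r :: real assume "r > 0"
  then obtain N where N: "\<And>m n. m \<ge> N \<Longrightarrow> norm (\<Sum>k=m..<n. (c k)\<^sup>2) < r\<^sup>2"
    using assms unfolding summable_Cauchy by (meson zero_less_power)
  have "norm (\<Sum>k=m..<n. c k *\<^sub>R e k) < r" if "m \<ge> N" for m n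
    using N[OF that, of n] norm_sum_sq[of "{m..<n}" c] \<open>r > 0\<close> power2_less_imp_less[of _ r] by simp
  then show "\<exists>N. \<forall>m\<ge>N. \<forall>n. norm (\<Sum>k=m..<n. c k *\<^sub>R e k) < r" by blast
qed

lemma synth_sums: "summable (\<lambda>k. (c k)\<^sup>2) \<Longrightarrow> (\<lambda>k. c k *\<^sub>R e k) sums synth c"
  unfolding synth_def by (rule summable_sums[OF summable_synth])

lemma synth_in:
  assumes "summable (\<lambda>k. (c k)\<^sup>2)"
  shows "synth c \<in> X"
proof (rule closed_sequentially[OF closed_X])
  show "(\<lambda>n. \<Sum>k<n. c k *\<^sub>R e k) \<longlonglongrightarrow> synth c" using synth_sums[OF assms] by (simp add: sums_def)
  show "(\<Sum>k<n. c k *\<^sub>R e k) \<in> X" for n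
    by (intro subspace_sum[OF subspace_X] subspace_scale[OF subspace_X] e_in)
qed

lemma inner_synth:
  assumes "summable (\<lambda>k. (c k)\<^sup>2)"
  shows "inner (synth c) (e j) = c j"
proof -
  have "(\<lambda>n. inner (\<Sum>k<n. c k *\<^sub>R e k) (e j)) \<longlonglongrightarrow> inner (synth c) (e j)"
    using synth_sums[OF assms] unfolding sums_def by (intro tendsto_intros)
  moreover have "(\<lambda>n. inner (\<Sum>k<n. c k *\<^sub>R e k) (e j)) \<longlonglongrightarrow> c j"
    by (rule tendsto_eventually, rule eventually_mono[OF eventually_gt_at_top[of j]])
      (simp add: inner_sum_e)
  ultimately show ?thesis by (rule LIMSEQ_unique)
qed

lemma norm_synth_sq:
  assumes "summable (\<lambda>k. (c k)\<^sup>2)"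
  shows "(norm (synth c))\<^sup>2 = (\<Sum>k. (c k)\<^sup>2)"
proof -
  have "(\<lambda>n. (norm (\<Sum>k<n. c k *\<^sub>R e k))\<^sup>2) \<longlonglongrightarrow> (norm (synth c))\<^sup>2"
    using synth_sums[OF assms] unfolding sums_def by (intro tendsto_intros)
  then have "(\<lambda>n. \<Sum>k<n. (c k)\<^sup>2) \<longlonglongrightarrow> (norm (synth c))\<^sup>2"
    by (simp add: norm_sum_sq)
  then show ?thesis by (simp add: sums_def[symmetric] sums_iff)
qed

lemma bessel_summable: "summable (\<lambda>k. (inner f (e k))\<^sup>2)"
proof (rule bounded_imp_summable)
  fix n
  let ?s = "\<Sum>k\<le>n. inner f (e k) *\<^sub>R e k"
  have "inner f ?s = (\<Sum>k\<le>n. (inner f (e k))\<^sup>2)"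
    by (simp add: inner_sum_right power2_eq_square)
  moreover have "inner ?s ?s = (\<Sum>k\<le>n. (inner f (e k))\<^sup>2)"
    using norm_sum_sq[of "{..n}" "\<lambda>k. inner f (e k)"] by (simp add: power2_norm_eq_inner)
  moreover have "0 \<le> inner (f - ?s) (f - ?s)" by simp
  ultimately show "(\<Sum>k\<le>n. (inner f (e k))\<^sup>2) \<le> inner f f"
    by (simp add: inner_diff_left inner_diff_right inner_commute)
qed auto

lemma eqI:
  assumes "f \<in> X" "g \<in> X" "\<And>k. inner f (e k) = inner g (e k)"
  shows "f = g"
  using total[of "f - g"] assms subspace_diff[OF subspace_X] by (simp add: inner_diff_left)

lemma synth_inner:
  assumes "f \<in> X"
  shows "synth (\<lambda>k. inner f (e k)) = f"
  by (rule eqI) (simp_all add: assms synth_in inner_synth bessel_summable)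

lemma bounded_multiplier_summable:
  assumes "\<And>k. \<bar>m k\<bar> \<le> C"
  shows "summable (\<lambda>k. (m k * inner f (e k))\<^sup>2)"
proof (rule summable_comparison_test')
  show "summable (\<lambda>k. C\<^sup>2 * (inner f (e k))\<^sup>2)"
    by (intro summable_mult bessel_summable)
  show "norm ((m n * inner f (e n))\<^sup>2) \<le> C\<^sup>2 * (inner f (e n))\<^sup>2" for n
    using assms[of n] power_mono[OF assms[of n], of 2]
    by (auto simp: power_mult_distrib intro!: mult_right_mono)
qed

text \<open>Fourier multipliers: the semigroup, its difference quotients and the map from the initial datum
  to the density defining the controls are all of this form.\<close>

definition multiplier :: "(nat \<Rightarrow> real) \<Rightarrow> 'a \<Rightarrow> 'a" where
  "multiplier m f = synth (\<lambda>k. m k * inner f (e k))"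

lemma
  assumes "\<And>k. \<bar>m k\<bar> \<le> C"
  shows multiplier_in: "multiplier m f \<in> X"
    and inner_multiplier: "inner (multiplier m f) (e k) = m k * inner f (e k)"
  using bounded_multiplier_summable[OF assms] by (simp_all add: multiplier_def synth_in inner_synth)

lemma norm_multiplier:
  assumes "f \<in> X" "\<And>k. \<bar>m k\<bar> \<le> C"
  shows "norm (multiplier m f) \<le> C * norm f"
proof (rule power2_le_imp_le)
  have C: "C \<ge> 0" using assms(2)[of 0] by linarith
  have "(norm (multiplier m f))\<^sup>2 = (\<Sum>k. (m k * inner f (e k))\<^sup>2)"
    unfolding multiplier_def by (rule norm_synth_sq) (rule bounded_multiplier_summable[OF assms(2)])
  also have "\<dots> \<le> (\<Sum>k. C\<^sup>2 * (inner f (e k))\<^sup>2)"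
  proof (rule suminf_le)
    show "(m k * inner f (e k))\<^sup>2 \<le> C\<^sup>2 * (inner f (e k))\<^sup>2" for k
      using power_mono[OF assms(2)[of k], of 2]
      by (auto simp: power_mult_distrib intro!: mult_right_mono)
  qed (intro summable_mult bessel_summable bounded_multiplier_summable[OF assms(2)])+
  also have "\<dots> = C\<^sup>2 * (\<Sum>k. (inner f (e k))\<^sup>2)"
    by (rule suminf_mult) (rule bessel_summable)
  also have "(\<Sum>k. (inner f (e k))\<^sup>2) = (norm f)\<^sup>2"
    using norm_synth_sq[OF bessel_summable[of f]] synth_inner[OF assms(1)] by simp
  finally show "(norm (multiplier m f))\<^sup>2 \<le> (C * norm f)\<^sup>2" by (simp add: power_mult_distrib)
  show "0 \<le> C * norm f" using C by simp
qed

text \<open>Dominated convergence for the series of squared coefficients. This one statement gives strong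
  continuity of the semigroup as well as the limit of its difference quotients.\<close>

lemma multiplier_tendsto:
  assumes "\<And>k. ((\<lambda>x. m x k) \<longlongrightarrow> m0 k) F" and bound: "\<forall>\<^sub>F x in F. \<forall>k. \<bar>m x k\<bar> \<le> C"
  shows "((\<lambda>x. multiplier (m x) f) \<longlongrightarrow> multiplier m0 f) F"
proof (cases "F = bot")
  case False
  have m0: "\<bar>m0 k\<bar> \<le> C" for k
    by (rule tendsto_upperbound[OF tendsto_rabs[OF assms(1)[of k]] _ False])
      (use bound in \<open>auto elim: eventually_mono\<close>)
  have sq: "((m x k - m0 k) * inner f (e k))\<^sup>2 \<le> (2 * C)\<^sup>2 * (inner f (e k))\<^sup>2"
    if "\<forall>k. \<bar>m x k\<bar> \<le> C" for x k
  proof -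
    have "\<bar>m x k - m0 k\<bar> \<le> 2 * C" using that[rule_format, of k] m0[of k] by linarith
    then have "(m x k - m0 k)\<^sup>2 \<le> (2 * C)\<^sup>2"
      using power_mono[of "\<bar>m x k - m0 k\<bar>" "2 * C" 2] by simp
    then show ?thesis by (simp add: power_mult_distrib mult_right_mono)
  qed
  have "((\<lambda>x. \<Sum>k. ((m x k - m0 k) * inner f (e k))\<^sup>2) \<longlongrightarrow> (\<Sum>k. ((m0 k - m0 k) * inner f (e k))\<^sup>2)) F"
  proof (rule tendsto_suminf_dominated)
    show "summable (\<lambda>k. (2 * C)\<^sup>2 * (inner f (e k))\<^sup>2)"
      by (intro summable_mult bessel_summable)
    show "\<forall>\<^sub>F x in F. \<forall>k. \<bar>((m x k - m0 k) * inner f (e k))\<^sup>2\<bar> \<le> (2 * C)\<^sup>2 * (inner f (e k))\<^sup>2"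
      using bound by eventually_elim (use sq in simp)
    show "((\<lambda>x. ((m x k - m0 k) * inner f (e k))\<^sup>2) \<longlongrightarrow> ((m0 k - m0 k) * inner f (e k))\<^sup>2) F" for k
      by (intro tendsto_intros assms)
  qed
  then have "((\<lambda>x. sqrt (\<Sum>k. ((m x k - m0 k) * inner f (e k))\<^sup>2)) \<longlongrightarrow> 0) F"
    using tendsto_real_sqrt by fastforce
  moreover have "\<forall>\<^sub>F x in F. norm (multiplier (m x) f - multiplier m0 f) =
      sqrt (\<Sum>k. ((m x k - m0 k) * inner f (e k))\<^sup>2)"
    using bound
  proof eventually_elim
    case (elim x)
    have d: "\<bar>m x k - m0 k\<bar> \<le> 2 * C" for k using elim[rule_format, of k] m0[of k] by linarith
    note * = multiplier_in[where C = C] inner_multiplier[where C = C]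
    have "multiplier (m x) f - multiplier m0 f = multiplier (\<lambda>k. m x k - m0 k) f"
    proof (rule eqI)
      show "multiplier (m x) f - multiplier m0 f \<in> X"
        by (intro subspace_diff[OF subspace_X] *) (use elim m0 in auto)
      show "multiplier (\<lambda>k. m x k - m0 k) f \<in> X" by (rule multiplier_in[OF d])
      show "inner (multiplier (m x) f - multiplier m0 f) (e k) = inner (multiplier (\<lambda>k. m x k - m0 k) f) (e k)" for k
        using elim m0 by (subst inner_multiplier[OF d]) (simp add: inner_diff_left * algebra_simps)
    qed
    moreover have "summable (\<lambda>k. ((m x k - m0 k) * inner f (e k))\<^sup>2)"
      by (rule bounded_multiplier_summable[OF d])
    ultimately show ?case
      using norm_synth_sq by (metis multiplier_def norm_ge_zero real_sqrt_unique)
  qed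
  ultimately have "((\<lambda>x. norm (multiplier (m x) f - multiplier m0 f)) \<longlongrightarrow> 0) F"
    by (simp add: tendsto_cong)
  then show ?thesis by (simp add: LIM_zero_iff tendsto_norm_zero_iff)
qed auto

text \<open>The expansion of \<open>f\<close> differs from \<open>f\<close> by a vector orthogonal to \<open>X\<close>. This form of membership in
  \<open>X\<close> passes to integrals of \<open>X\<close>-valued functions.\<close>

lemma in_X_if_orthogonal_to_complement:
  assumes "\<And>r. (\<And>x. x \<in> X \<Longrightarrow> inner x r = 0) \<Longrightarrow> inner f r = 0"
  shows "f \<in> X"
proof -
  let ?p = "synth (\<lambda>k. inner f (e k))"
  have p: "?p \<in> X" by (rule synth_in[OF bessel_summable])
  have orth: "inner x (f - ?p) = 0" if x: "x \<in> X" for x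
  proof -
    have "(\<lambda>k. inner (inner x (e k) *\<^sub>R e k) (f - ?p)) sums inner (synth (\<lambda>k. inner x (e k))) (f - ?p)"
      by (intro bounded_linear.sums[OF bounded_linear_inner_left] synth_sums bessel_summable)
    moreover have "(\<lambda>k. inner (inner x (e k) *\<^sub>R e k) (f - ?p)) = (\<lambda>k. 0)"
      using inner_synth[OF bessel_summable[of f]]
      by (auto simp: inner_diff_right inner_commute[of "e _"])
    ultimately have "(\<lambda>k. 0) sums inner x (f - ?p)" by (simp only: synth_inner[OF x])
    then show ?thesis by (rule sums_unique2[OF _ sums_zero])
  qed
  have "inner (f - ?p) (f - ?p) = 0"
    using assms[OF orth] orth[OF p] by (simp add: inner_diff_left)
  then show ?thesis using p by simp
qed

end

lemma abs_exp_minus_one_le: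
  fixes x :: real
  assumes "x \<le> M" "M \<ge> 0"
  shows "\<bar>exp x - 1\<bar> \<le> \<bar>x\<bar> * exp M"
proof (cases "x \<ge> 0")
  case True
  have "1 - x \<le> exp (- x)" using exp_ge_add_one_self[of "- x"] by simp
  then have "exp x * (1 - x) \<le> exp x * exp (- x)" by (intro mult_left_mono) auto
  then have "exp x - 1 \<le> x * exp x" by (simp add: exp_minus algebra_simps)
  also have "\<dots> \<le> x * exp M" using True assms by (intro mult_left_mono) auto
  finally show ?thesis using True by simp
next
  case False
  have "1 + x \<le> exp x" "exp x \<le> 1" using False by auto
  then have "\<bar>exp x - 1\<bar> \<le> \<bar>x\<bar> * 1" using False by arith
  also have "\<dots> \<le> \<bar>x\<bar> * exp M" using assms by (intro mult_left_mono) auto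
  finally show ?thesis .
qed

locale diagonal_semigroup = orthonormal_expansion +
  fixes \<mu> :: "nat \<Rightarrow> real" and \<omega> :: real
  assumes mu_ge: "\<And>k. - \<omega> \<le> \<mu> k" and omega: "\<omega> \<ge> 0"
begin

definition S :: "real \<Rightarrow> 'a \<Rightarrow> 'a" where
  "S t = multiplier (\<lambda>k. exp (- \<mu> k * t))"

lemma exp_bound:
  assumes "0 \<le> t" "t \<le> T"
  shows "\<bar>exp (- \<mu> k * t)\<bar> \<le> exp (\<omega> * T)"
proof -
  have "- \<mu> k * t \<le> \<omega> * t" using mu_ge[of k] assms by (intro mult_right_mono) auto
  also have "\<dots> \<le> \<omega> * T" using assms omega by (intro mult_left_mono)
  finally show ?thesis by simp
qed

lemma S_in: "t \<ge> 0 \<Longrightarrow> S t f \<in> X"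
  unfolding S_def by (rule multiplier_in[OF exp_bound[of t t]]) auto

lemma inner_S: "t \<ge> 0 \<Longrightarrow> inner (S t f) (e k) = exp (- \<mu> k * t) * inner f (e k)"
  unfolding S_def by (rule inner_multiplier[OF exp_bound[of t t]]) auto

lemma S_add: "t \<ge> 0 \<Longrightarrow> S t (f + g) = S t f + S t g"
  by (rule eqI) (auto simp: S_in inner_S inner_add_left algebra_simps intro: subspace_add[OF subspace_X])

lemma S_scaleR: "t \<ge> 0 \<Longrightarrow> S t (c *\<^sub>R f) = c *\<^sub>R S t f"
  by (rule eqI) (auto simp: S_in inner_S intro: subspace_scale[OF subspace_X])

lemma S_minus: "t \<ge> 0 \<Longrightarrow> S t (- f) = - S t f"
  using S_scaleR[of t "-1" f] by simp

lemma norm_S: "f \<in> X \<Longrightarrow> 0 \<le> t \<Longrightarrow> t \<le> T \<Longrightarrow> norm (S t f) \<le> exp (\<omega> * T) * norm f"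
  unfolding S_def by (rule norm_multiplier) (auto intro: exp_bound[simplified])

lemma continuous_on_S: "continuous_on {0..T} (\<lambda>t. S t f)"
  unfolding continuous_on_def S_def
proof (intro ballI multiplier_tendsto[where C = "exp (\<omega> * T)"])
  fix t k assume "t \<in> {0..T}"
  show "((\<lambda>t. exp (- \<mu> k * t)) \<longlongrightarrow> exp (- \<mu> k * t)) (at t within {0..T})"
    by (intro tendsto_intros)
  show "\<forall>\<^sub>F t in at t within {0..T}. \<forall>k. \<bar>exp (- \<mu> k * t)\<bar> \<le> exp (\<omega> * T)"
    unfolding eventually_at_filter by (intro always_eventually) (use exp_bound in auto)
qed

lemma S_0: "f \<in> X \<Longrightarrow> S 0 f = f"
  by (rule eqI) (auto simp: S_in inner_S)

lemma C0_semigroup_S: "C0_semigroup X S"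
  unfolding C0_semigroup_def
proof (intro conjI ballI allI impI)
  fix t :: real assume "t \<ge> 0"
  then show "\<exists>M. \<forall>f\<in>X. norm (S t f) \<le> M * norm f" using norm_S by blast
next
  fix s t :: real and f assume "s \<ge> 0" "t \<ge> 0" "f \<in> X"
  then show "S (s + t) f = S s (S t f)"
    by (intro eqI) (auto simp: S_in inner_S exp_add[symmetric] algebra_simps)
next
  fix f assume f: "f \<in> X"
  have "((\<lambda>t. S t f) \<longlongrightarrow> S 0 f) (at 0 within {0..1})"
    using continuous_on_S[of 1 f] by (auto simp: continuous_on_def)
  then have "((\<lambda>t. S t f) \<longlongrightarrow> S 0 f) (at_right 0)"
    using at_within_Icc_at_right[of 0 "1::real"] by simp
  then show "((\<lambda>t. S t f) \<longlongrightarrow> f) (at_right 0)" by (simp add: S_0 f)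
qed (auto simp: S_in S_add S_scaleR S_0)

text \<open>If \<open>g\<^sub>k = - \<mu>\<^sub>k f\<^sub>k\<close>, then the difference quotient of the semigroup at \<open>f\<close> is a multiplier applied to \<open>g\<close>
  rather than to \<open>f\<close>, and its symbols are bounded uniformly in the step size.\<close>

lemma generator_S:
  "generator X S = {(f, g). f \<in> X \<and> g \<in> X \<and> (\<forall>k. inner g (e k) = - \<mu> k * inner f (e k))}"
proof (intro set_eqI iffI; clarify)
  fix f g assume "(f, g) \<in> generator X S"
  then have f: "f \<in> X" and g: "g \<in> X" and lim: "((\<lambda>h. (S h f - f) /\<^sub>R h) \<longlongrightarrow> g) (at_right 0)"
    by (auto simp: generator_def)
  have "inner g (e k) = - \<mu> k * inner f (e k)" for k
  proof (rule tendsto_unique)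
    show "((\<lambda>h. inner ((S h f - f) /\<^sub>R h) (e k)) \<longlongrightarrow> inner g (e k)) (at_right 0)"
      by (intro tendsto_intros lim)
    have "((\<lambda>h. exp (- \<mu> k * h)) has_field_derivative - \<mu> k) (at 0 within {0<..})"
      by (auto intro!: derivative_eq_intros)
    then have "((\<lambda>h. (exp (- \<mu> k * h) - 1) / h) \<longlongrightarrow> - \<mu> k) (at_right 0)"
      by (simp add: has_field_derivative_iff)
    then have "((\<lambda>h. (exp (- \<mu> k * h) - 1) / h * inner f (e k)) \<longlongrightarrow> - \<mu> k * inner f (e k)) (at_right 0)"
      by (intro tendsto_intros)
    moreover have "\<forall>\<^sub>F h in at_right 0. inner ((S h f - f) /\<^sub>R h) (e k) = (exp (- \<mu> k * h) - 1) / h * inner f (e k)"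
      using eventually_at_right_less[of "0::real"]
      by eventually_elim (simp add: inner_S inner_diff_left divide_inverse algebra_simps)
    ultimately show "((\<lambda>h. inner ((S h f - f) /\<^sub>R h) (e k)) \<longlongrightarrow> - \<mu> k * inner f (e k)) (at_right 0)"
      by (simp add: tendsto_cong)
  qed auto
  then show "f \<in> X \<and> g \<in> X \<and> (\<forall>k. inner g (e k) = - \<mu> k * inner f (e k))" using f g by blast
next
  fix f g assume f: "f \<in> X" and g: "g \<in> X" and fg: "\<forall>k. inner g (e k) = - \<mu> k * inner f (e k)"
  \<comment> \<open>the difference quotient of \<open>exp\<close> relative to its derivative; bounded although \<open>\<mu>\<close> is not\<close>
  define q where "q h k = (if \<mu> k = 0 then 1 else (exp (- \<mu> k * h) - 1) / (- \<mu> k * h))" for h k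
  have q_bound: "\<bar>q h k\<bar> \<le> exp \<omega>" if "0 < h" "h \<le> 1" for h k
  proof (cases "\<mu> k = 0")
    case False
    have "- \<mu> k * h \<le> \<omega> * h" using mu_ge[of k] that by (intro mult_right_mono) auto
    also have "\<dots> \<le> \<omega>" using that omega by (simp add: mult_left_le)
    finally have "\<bar>exp (- \<mu> k * h) - 1\<bar> \<le> \<bar>- \<mu> k * h\<bar> * exp \<omega>"
      by (rule abs_exp_minus_one_le[OF _ omega])
    then show ?thesis using False that by (simp add: q_def abs_mult field_simps)
  qed (use omega in \<open>simp add: q_def\<close>)
  have ev: "\<forall>\<^sub>F h in at_right (0::real). 0 < h \<and> h \<le> 1"
    using eventually_at_right_real[of 0 "1::real"] by (auto elim: eventually_mono)
  have "((\<lambda>h. multiplier (q h) g) \<longlongrightarrow> multiplier (\<lambda>k. 1) g) (at_right 0)"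
  proof (rule multiplier_tendsto)
    show "\<forall>\<^sub>F h in at_right 0. \<forall>k. \<bar>q h k\<bar> \<le> exp \<omega>"
      using ev by eventually_elim (use q_bound in blast)
    fix k
    show "((\<lambda>h. q h k) \<longlongrightarrow> 1) (at_right 0)"
    proof (cases "\<mu> k = 0")
      case False
      have "((\<lambda>h. exp (- \<mu> k * h)) has_field_derivative - \<mu> k) (at 0 within {0<..})"
        by (auto intro!: derivative_eq_intros)
      then have "((\<lambda>h. (exp (- \<mu> k * h) - 1) / h) \<longlongrightarrow> - \<mu> k) (at_right 0)"
        by (simp add: has_field_derivative_iff)
      then have "((\<lambda>h. (exp (- \<mu> k * h) - 1) / h / (- \<mu> k)) \<longlongrightarrow> - \<mu> k / (- \<mu> k)) (at_right 0)"
        by (intro tendsto_intros) (use False in auto)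
      then show ?thesis using False by (simp add: q_def mult.commute)
    qed (simp add: q_def)
  qed
  moreover have "multiplier (\<lambda>k. 1) g = g" by (simp add: multiplier_def synth_inner g)
  moreover have "\<forall>\<^sub>F h in at_right 0. multiplier (q h) g = (S h f - f) /\<^sub>R h"
    using ev
  proof eventually_elim
    case (elim h)
    show ?case
    proof (rule eqI)
      have q: "\<bar>q h k\<bar> \<le> exp \<omega>" for k using q_bound elim by blast
      show "multiplier (q h) g \<in> X" by (rule multiplier_in[OF q])
      show "(S h f - f) /\<^sub>R h \<in> X"
        using elim by (intro subspace_scale[OF subspace_X] subspace_diff[OF subspace_X] S_in f) auto
      show "inner (multiplier (q h) g) (e k) = inner ((S h f - f) /\<^sub>R h) (e k)" for k
        using elim by (subst inner_multiplier[OF q])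
          (auto simp: inner_S inner_diff_left fg q_def field_simps)
    qed
  qed
  ultimately have "((\<lambda>h. (S h f - f) /\<^sub>R h) \<longlongrightarrow> g) (at_right 0)"
    by (simp add: tendsto_cong)
  then show "(f, g) \<in> generator X S" using f g by (simp add: generator_def)
qed

end

section \<open>Classes of functions on an interval\<close>

lemma continuous_on_square_integrable_on:
  assumes "continuous_on {a..b} f"
  shows "square_integrable_on a b f"
proof -
  have m: "(\<lambda>x. indicator {a..b} x *\<^sub>R f x) \<in> borel_measurable lborel"
    using borel_integrable_compact[OF compact_Icc assms] by blast
  have eq: "(\<lambda>x. indicator {a<..<b} x * f x) = (\<lambda>x. indicator {a<..<b} x * (indicator {a..b} x *\<^sub>R f x))"
    by (auto simp: indicator_def)
  have m': "(\<lambda>x. indicator {a<..<b} x * f x) \<in> borel_measurable lborel"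
    unfolding eq using m by measurable
  have "continuous_on {a..b} (\<lambda>x. (f x)\<^sup>2)" using assms by (intro continuous_intros)
  from borel_integrable_compact[OF compact_Icc this]
  have "integrable lborel (\<lambda>x. (indicator {a<..<b} x * f x)\<^sup>2)"
  proof (rule Bochner_Integration.integrable_bound)
    show "(\<lambda>x. (indicator {a<..<b} x * f x)\<^sup>2) \<in> borel_measurable lborel"
      using m' by measurable
  qed (auto simp: indicator_def)
  with m' show ?thesis by (simp add: square_integrable_on_def square_integrable_def)
qed

lemma square_integrable_onD: "square_integrable_on a b f \<Longrightarrow> square_integrable (\<lambda>x. indicator {a<..<b} x * f x)"
  by (simp add: square_integrable_on_def)

lemma square_integrable_on_rep: "square_integrable_on a b (l2_rep f)"
  unfolding square_integrable_on_def square_integrable_def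
proof
  have f: "l2_rep f \<in> borel_measurable lborel" "integrable lborel (\<lambda>x. (l2_rep f x)\<^sup>2)"
    using square_integrable_l2_rep[of f] by (auto simp: square_integrable_def)
  show m: "(\<lambda>x. indicator {a<..<b} x * l2_rep f x) \<in> borel_measurable lborel" using f by measurable
  show "integrable lborel (\<lambda>x. (indicator {a<..<b} x * l2_rep f x)\<^sup>2)"
    by (rule Bochner_Integration.integrable_bound[OF f(2)]) (use f in \<open>auto simp: indicator_def\<close>)
qed

lemma square_integrable_on_add:
  "square_integrable_on a b f \<Longrightarrow> square_integrable_on a b g \<Longrightarrow> square_integrable_on a b (\<lambda>x. f x + g x)"
  using square_integrable_add[of "\<lambda>x. indicator {a<..<b} x * f x" "\<lambda>x. indicator {a<..<b} x * g x"]
  by (simp add: square_integrable_on_def distrib_left)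

lemma square_integrable_on_diff:
  "square_integrable_on a b f \<Longrightarrow> square_integrable_on a b g \<Longrightarrow> square_integrable_on a b (\<lambda>x. f x - g x)"
  using square_integrable_diff[of "\<lambda>x. indicator {a<..<b} x * f x" "\<lambda>x. indicator {a<..<b} x * g x"]
  by (simp add: square_integrable_on_def right_diff_distrib)

lemma square_integrable_on_scale:
  "square_integrable_on a b f \<Longrightarrow> square_integrable_on a b (\<lambda>x. c * f x)"
  using square_integrable_scale[of "\<lambda>x. indicator {a<..<b} x * f x" c]
  by (simp add: square_integrable_on_def mult.left_commute)

lemma L2_class_on_diff:
  "square_integrable_on a b f \<Longrightarrow> square_integrable_on a b g \<Longrightarrow>
    L2_class_on a b (\<lambda>x. f x - g x) = L2_class_on a b f - L2_class_on a b g"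
  by (simp add: square_integrable_on_def L2_class_on_def l2_class_diff right_diff_distrib)

lemma L2_class_on_scale:
  "square_integrable_on a b f \<Longrightarrow> L2_class_on a b (\<lambda>x. c * f x) = c *\<^sub>R L2_class_on a b f"
  by (simp add: square_integrable_on_def L2_class_on_def l2_class_scaleR mult.left_commute)

lemma L2_class_on_cong:
  "(\<And>x. a < x \<Longrightarrow> x < b \<Longrightarrow> f x = g x) \<Longrightarrow> L2_class_on a b f = L2_class_on a b g"
  unfolding L2_class_on_def by (rule arg_cong[where f = l2_class]) (auto simp: indicator_def)

lemma set_integrable_mult_square_integrable:
  assumes "square_integrable_on a b f" "square_integrable_on a b g"
  shows "set_integrable lborel {a<..<b} (\<lambda>x. f x * g x)"
proof -
  have "(\<lambda>x. indicator {a<..<b} x *\<^sub>R (f x * g x)) =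
      (\<lambda>x. (indicator {a<..<b} x * f x) * (indicator {a<..<b} x * g x))"
    by (auto simp: indicator_def)
  then show ?thesis
    using square_integrable_mult[OF assms[THEN square_integrable_onD]]
    by (simp add: set_integrable_def)
qed

lemma inner_L2_class_on:
  assumes "square_integrable_on a b f" "square_integrable_on a b g"
  shows "inner (L2_class_on a b f) (L2_class_on a b g) = (LINT x:{a<..<b}|lborel. f x * g x)"
proof -
  have "inner (L2_class_on a b f) (L2_class_on a b g) =
      (LINT x|lborel. (indicator {a<..<b} x * f x) * (indicator {a<..<b} x * g x))"
    using assms unfolding L2_class_on_def
    by (intro inner_l2.abs_eq) (auto intro!: l2_eq_refl square_integrable_onD)
  also have "\<dots> = (LINT x:{a<..<b}|lborel. f x * g x)"
    unfolding set_lebesgue_integral_def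
    by (intro Bochner_Integration.integral_cong) (auto simp: indicator_def)
  finally show ?thesis .
qed

lemma L2_on_iff: "f \<in> L2_on a b \<longleftrightarrow> L2_class_on a b (l2_rep f) = f"
proof -
  have "L2_class_on a b (l2_rep f) = f \<longleftrightarrow>
      l2_class (\<lambda>x. indicator {a<..<b} x * l2_rep f x) = l2_class (l2_rep f)"
    by (simp add: L2_class_on_def)
  also have "\<dots> \<longleftrightarrow> (AE x in lborel. indicator {a<..<b} x * l2_rep f x = l2_rep f x)"
    by (intro l2_class_eq_iff square_integrable_onD[OF square_integrable_on_rep]) simp
  also have "\<dots> \<longleftrightarrow> (AE x in lborel. x \<notin> {a<..<b} \<longrightarrow> l2_rep f x = 0)"
    by (rule arg_cong[where f = "\<lambda>P. almost_everywhere lborel P"]) (auto simp: indicator_def)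
  finally show ?thesis by (simp add: L2_on_def)
qed

lemma L2_class_on_rep_cong:
  assumes "square_integrable f"
  shows "L2_class_on a b (l2_rep (l2_class f)) = L2_class_on a b f"
proof -
  have "AE x in lborel. l2_rep (l2_class f) x = f x"
    using l2_class_eq_iff[OF square_integrable_l2_rep[of "l2_class f"] assms] by simp
  then have ae: "AE x in lborel. indicator {a<..<b} x * l2_rep (l2_class f) x = indicator {a<..<b} x * f x"
    by eventually_elim simp
  have "square_integrable (\<lambda>x. indicator {a<..<b} x * f x)"
    unfolding square_integrable_def
  proof
    have f: "f \<in> borel_measurable lborel" "integrable lborel (\<lambda>x. (f x)\<^sup>2)"
      using assms by (auto simp: square_integrable_def)
    show m: "(\<lambda>x. indicator {a<..<b} x * f x) \<in> borel_measurable lborel" using f by measurable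
    show "integrable lborel (\<lambda>x. (indicator {a<..<b} x * f x)\<^sup>2)"
      by (rule Bochner_Integration.integrable_bound[OF f(2)]) (use f in \<open>auto simp: indicator_def\<close>)
  qed
  then show ?thesis
    using ae square_integrable_onD[OF square_integrable_on_rep] by (simp add: L2_class_on_def l2_class_eq_iff)
qed

lemma L2_class_on_in:
  assumes "square_integrable_on a b f"
  shows "L2_class_on a b f \<in> L2_on a b"
proof -
  have "L2_class_on a b (l2_rep (L2_class_on a b f)) = L2_class_on a b (\<lambda>x. indicator {a<..<b} x * f x)"
    using L2_class_on_rep_cong[OF square_integrable_onD[OF assms], of a b] by (simp add: L2_class_on_def)
  also have "\<dots> = L2_class_on a b f" by (rule L2_class_on_cong) auto
  finally show ?thesis by (simp add: L2_on_iff)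
qed

text \<open>Membership in \<open>L\<^sup>2(a, b)\<close> is orthogonality to everything supported off the interval, which makes
  it a closed subspace.\<close>

lemma L2_on_iff_orthogonal:
  "f \<in> L2_on a b \<longleftrightarrow> (\<forall>g. inner f (g - L2_class_on a b (l2_rep g)) = 0)"
proof -
  let ?P = "\<lambda>g. L2_class_on a b (l2_rep g)"
  have sym: "inner f (?P g) = inner (?P f) g" for f g
  proof -
    have 1: "inner (l2_class u) (l2_class v) = (LINT x|lborel. u x * v x)"
      if "square_integrable u" "square_integrable v" for u v
      using that by (simp add: inner_l2.abs_eq l2_eq_refl)
    have "inner (l2_class (l2_rep f)) (?P g) = inner (?P f) (l2_class (l2_rep g))"
      unfolding L2_class_on_def
      by (simp add: 1 square_integrable_onD[OF square_integrable_on_rep] del: l2_class_rep)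
        (rule Bochner_Integration.integral_cong, auto)
    then show ?thesis by simp
  qed
  have "f \<in> L2_on a b \<longleftrightarrow> ?P f = f" by (rule L2_on_iff)
  also have "\<dots> \<longleftrightarrow> (\<forall>g. inner (f - ?P f) g = 0)"
    using inner_eq_zero_iff[of "f - ?P f"] by (auto simp del: inner_eq_zero_iff)
  also have "\<dots> \<longleftrightarrow> (\<forall>g. inner f (g - ?P g) = 0)"
    by (simp add: inner_diff_left inner_diff_right sym)
  finally show ?thesis .
qed

lemma subspace_L2_on: "subspace (L2_on a b)"
  unfolding subspace_def by (auto simp: L2_on_iff_orthogonal inner_add_left)

lemma closed_L2_on: "closed (L2_on a b)"
proof -
  have "L2_on a b = (\<Inter>g. {f. inner f (g - L2_class_on a b (l2_rep g)) = 0})"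
    by (auto simp: L2_on_iff_orthogonal)
  also have "closed \<dots>"
    by (intro closed_INT ballI closed_Collect_eq continuous_intros)
  finally show ?thesis .
qed

lemma LINT_open_eq_closed:
  fixes f :: "real \<Rightarrow> real"
  assumes "continuous_on {a..b} f"
  shows "(LINT x:{a<..<b}|lborel. f x) = (LINT x:{a..b}|lborel. f x)"
  unfolding set_lebesgue_integral_def
proof (rule integral_cong_AE)
  have m: "(\<lambda>x. indicator {a..b} x *\<^sub>R f x) \<in> borel_measurable lborel"
    using borel_integrable_compact[OF compact_Icc assms] by blast
  then show "(\<lambda>x. indicator {a..b} x *\<^sub>R f x) \<in> borel_measurable lborel" .
  have "(\<lambda>x. indicator {a<..<b} x *\<^sub>R f x) = (\<lambda>x. indicator {a<..<b} x * (indicator {a..b} x *\<^sub>R f x))"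
    by (auto simp: indicator_def)
  then show "(\<lambda>x. indicator {a<..<b} x *\<^sub>R f x) \<in> borel_measurable lborel" using m by simp
  show "AE x in lborel. indicator {a<..<b} x *\<^sub>R f x = indicator {a..b} x *\<^sub>R f x"
    using AE_lborel_singleton[of a] AE_lborel_singleton[of b]
    by eventually_elim (auto simp: indicator_def)
qed

lemma LINT_derivative:
  fixes f :: "real \<Rightarrow> real"
  assumes "a \<le> b" "\<And>x. x \<in> {a..b} \<Longrightarrow> (F has_real_derivative f x) (at x within {a..b})"
    and "continuous_on {a..b} f"
  shows "(LINT x:{a<..<b}|lborel. f x) = F b - F a"
proof -
  have "(LINT x:{a..b}|lborel. f x) = F b - F a"
    unfolding set_lebesgue_integral_def
    by (rule integral_FTC_atLeastAtMost)
      (use assms in \<open>auto simp: has_real_derivative_iff_has_vector_derivative\<close>)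
  then show ?thesis by (simp add: LINT_open_eq_closed[OF assms(3)])
qed

lemma set_integrable_open_continuous:
  assumes "continuous_on {a..b::real} (f :: real \<Rightarrow> real)"
  shows "set_integrable lborel {a<..<b} f"
  using set_integrable_mult_square_integrable[OF
      continuous_on_square_integrable_on[OF assms] continuous_on_square_integrable_on[OF continuous_on_const[of _ 1]]]
  by simp

lemma LINT_by_parts:
  fixes f g :: "real \<Rightarrow> real"
  assumes "a \<le> b" "\<And>x. x \<in> {a..b} \<Longrightarrow> (f has_real_derivative f' x) (at x within {a..b})"
    and "\<And>x. x \<in> {a..b} \<Longrightarrow> (g has_real_derivative g' x) (at x within {a..b})"
    and "continuous_on {a..b} f'" "continuous_on {a..b} g'"
  shows "(LINT x:{a<..<b}|lborel. f' x * g x) = f b * g b - f a * g a - (LINT x:{a<..<b}|lborel. f x * g' x)"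
proof -
  have c: "continuous_on {a..b} f" "continuous_on {a..b} g"
    using assms(2,3) DERIV_continuous unfolding continuous_on_eq_continuous_within by blast+
  have "(LINT x:{a<..<b}|lborel. f' x * g x + f x * g' x) = f b * g b - f a * g a"
    by (rule LINT_derivative)
      (use assms c in \<open>auto intro!: continuous_intros derivative_eq_intros\<close>)
  moreover have "(LINT x:{a<..<b}|lborel. f' x * g x + f x * g' x) =
      (LINT x:{a<..<b}|lborel. f' x * g x) + (LINT x:{a<..<b}|lborel. f x * g' x)"
    using assms c by (intro set_integral_add set_integrable_open_continuous continuous_intros)
  ultimately show ?thesis by linarith
qed

lemma LINT_uniform_series:
  fixes f :: "nat \<Rightarrow> real \<Rightarrow> real"
  assumes f: "\<And>k. continuous_on {a..b} (f k)" and bd: "\<And>k x. \<bar>f k x\<bar> \<le> M k" and M: "summable M"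
    and h: "square_integrable_on a b h"
  shows "(\<lambda>k. LINT x:{a<..<b}|lborel. f k x * h x) sums (LINT x:{a<..<b}|lborel. (\<Sum>k. f k x) * h x)"
proof -
  have i: "set_integrable lborel {a<..<b} (\<lambda>x. f k x * h x)" for k
    by (intro set_integrable_mult_square_integrable h continuous_on_square_integrable_on f)
  have i1: "set_integrable lborel {a<..<b} (\<lambda>x. 1 * h x)"
    by (intro set_integrable_mult_square_integrable h continuous_on_square_integrable_on continuous_intros)
  have iN: "set_integrable lborel {a<..<b} (\<lambda>x. (\<Sum>k<N. f k x) * h x)" for N
    by (intro set_integrable_mult_square_integrable h continuous_on_square_integrable_on continuous_intros f)
  have M0: "0 \<le> M k" for k using bd[of k 0] by linarith
  have summ: "summable (\<lambda>k. f k x)" for x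
    by (rule summable_comparison_test'[OF M]) (use bd in auto)
  have bdN: "\<bar>\<Sum>k<N. f k x\<bar> \<le> suminf M" for N x
  proof -
    have "\<bar>\<Sum>k<N. f k x\<bar> \<le> (\<Sum>k<N. M k)" by (intro order_trans[OF sum_abs] sum_mono bd)
    also have "\<dots> \<le> suminf M" by (intro sum_le_suminf M M0) auto
    finally show ?thesis .
  qed
  have "(\<lambda>N. LINT x:{a<..<b}|lborel. (\<Sum>k<N. f k x) * h x) \<longlonglongrightarrow> (LINT x:{a<..<b}|lborel. (\<Sum>k. f k x) * h x)"
    unfolding set_lebesgue_integral_def
  proof (rule integral_dominated_convergence)
    show "integrable lborel (\<lambda>x. suminf M * norm (indicator {a<..<b} x *\<^sub>R (1 * h x)))"
      using i1 by (intro integrable_mult_right integrable_norm) (simp only: set_integrable_def)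
    show m: "(\<lambda>x. indicator {a<..<b} x *\<^sub>R ((\<Sum>k<N. f k x) * h x)) \<in> borel_measurable lborel" for N
      using iN[of N] by (auto simp: set_integrable_def)
    show lim: "AE x in lborel. (\<lambda>N. indicator {a<..<b} x *\<^sub>R ((\<Sum>k<N. f k x) * h x)) \<longlonglongrightarrow> indicator {a<..<b} x *\<^sub>R ((\<Sum>k. f k x) * h x)"
      by (intro AE_I2 tendsto_intros summable_LIMSEQ summ)
    show "(\<lambda>x. indicator {a<..<b} x *\<^sub>R ((\<Sum>k. f k x) * h x)) \<in> borel_measurable lborel"
      by (rule borel_measurable_LIMSEQ_metric[
          where f = "\<lambda>N x. indicator {a<..<b} x *\<^sub>R ((\<Sum>k<N. f k x) * h x)", OF m]) (intro tendsto_intros summable_LIMSEQ summ)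
    show "AE x in lborel. norm (indicator {a<..<b} x *\<^sub>R ((\<Sum>k<N. f k x) * h x)) \<le> suminf M * norm (indicator {a<..<b} x *\<^sub>R (1 * h x))" for N
    proof (rule AE_I2)
      fix x
      have "\<bar>\<Sum>k<N. f k x\<bar> * \<bar>h x\<bar> \<le> suminf M * \<bar>h x\<bar>" by (intro mult_right_mono bdN) auto
      then show "norm (indicator {a<..<b} x *\<^sub>R ((\<Sum>k<N. f k x) * h x)) \<le> suminf M * norm (indicator {a<..<b} x *\<^sub>R (1 * h x))"
        by (simp add: abs_mult indicator_def)
    qed
  qed
  moreover have "(LINT x:{a<..<b}|lborel. (\<Sum>k<N. f k x) * h x) = (\<Sum>k<N. LINT x:{a<..<b}|lborel. f k x * h x)" for N
    unfolding set_lebesgue_integral_def sum_distrib_right scaleR_sum_right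
    using i by (intro Bochner_Integration.integral_sum) (auto simp: set_integrable_def)
  ultimately show ?thesis by (simp add: sums_def)
qed

section \<open>The cosine basis\<close>

definition freq :: "real \<Rightarrow> nat \<Rightarrow> real" where
  "freq L k = real k * pi / L"

text \<open>The normalising constant of the \<open>k\<close>-th cosine, which is also its value at the controlled end point
  and hence the gain with which the controls act on this mode.\<close>

definition cos_norm :: "real \<Rightarrow> nat \<Rightarrow> real" where
  "cos_norm L k = sqrt ((if k = 0 then 1 else 2) / L)"

definition cos_mode :: "real \<Rightarrow> nat \<Rightarrow> l2" where
  "cos_mode L k = L2_class_on 0 L (\<lambda>x. cos_norm L k * cos (freq L k * x))"

lemma cos_norm_pos: "L > 0 \<Longrightarrow> cos_norm L k > 0"
  by (simp add: cos_norm_def)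

lemma square_integrable_on_cos: "square_integrable_on 0 L (\<lambda>x. c * cos (d * x))"
  by (intro continuous_on_square_integrable_on continuous_intros)

lemma cos_mode_in: "cos_mode L k \<in> L2_on 0 L"
  unfolding cos_mode_def by (intro L2_class_on_in square_integrable_on_cos)

lemma inner_cos_mode:
  assumes "square_integrable_on 0 L f"
  shows "inner (L2_class_on 0 L f) (cos_mode L k) =
    cos_norm L k * (LINT x:{0<..<L}|lborel. f x * cos (freq L k * x))"
proof -
  have "inner (L2_class_on 0 L f) (cos_mode L k) =
      (LINT x:{0<..<L}|lborel. f x * (cos_norm L k * cos (freq L k * x)))"
    unfolding cos_mode_def by (intro inner_L2_class_on assms square_integrable_on_cos)
  also have "\<dots> = (LINT x:{0<..<L}|lborel. cos_norm L k * (f x * cos (freq L k * x)))"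
    by (simp add: mult.left_commute)
  finally show ?thesis by simp
qed

lemma LINT_cos_int:
  assumes "L > 0"
  shows "(LINT x:{0<..<L}|lborel. cos (of_int n * pi / L * x)) = (if n = 0 then L else 0)"
proof (cases "n = 0")
  case True
  have "(LINT x:{0<..<L}|lborel. (1::real)) = L - 0"
    by (rule LINT_derivative) (use assms in \<open>auto intro!: derivative_eq_intros\<close>)
  then show ?thesis using True by simp
next
  case False
  let ?r = "of_int n * pi / L"
  have r: "?r \<noteq> 0" using False assms by simp
  have "(LINT x:{0<..<L}|lborel. cos (?r * x)) = sin (?r * L) / ?r - sin (?r * 0) / ?r"
    by (rule LINT_derivative) (use assms r in \<open>auto intro!: derivative_eq_intros continuous_intros\<close>)
  also have "?r * L = of_int n * pi" using assms by simp
  also have "sin (of_int n * pi) = 0" by (simp add: sin_zero_iff_int2)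
  finally show ?thesis using False by simp
qed

lemma inner_cos_mode_cos_mode:
  assumes "L > 0"
  shows "inner (cos_mode L j) (cos_mode L k) = (if j = k then 1 else 0)"
proof -
  have c: "cos (freq L j * x) * cos (freq L k * x) =
      (cos (of_int (int j - int k) * pi / L * x) + cos (of_int (int j + int k) * pi / L * x)) / 2" for x
    unfolding freq_def cos_times_cos by (simp add: ring_distribs add_divide_distrib diff_divide_distrib)
  have int: "set_integrable lborel {0<..<L} (\<lambda>x. cos (r * x))" for r
    by (intro set_integrable_open_continuous continuous_intros)
  have "(LINT x:{0<..<L}|lborel. cos (freq L j * x) * cos (freq L k * x)) =
      ((if int j - int k = 0 then L else 0) + (if int j + int k = 0 then L else 0)) / 2"
    unfolding c
    by (simp only: set_integral_divide_zero set_integral_add(2)[OF int int] LINT_cos_int[OF assms])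
  also have "\<dots> = (if j = k then if k = 0 then L else L / 2 else 0)" by auto
  finally have *: "(LINT x:{0<..<L}|lborel. cos (freq L j * x) * cos (freq L k * x)) = \<dots>" .
  have "inner (cos_mode L j) (cos_mode L k) =
      cos_norm L k * (LINT x:{0<..<L}|lborel. cos_norm L j * cos (freq L j * x) * cos (freq L k * x))"
    unfolding cos_mode_def[of L j] by (rule inner_cos_mode) (rule square_integrable_on_cos)
  also have "\<dots> = cos_norm L k * (cos_norm L j * (LINT x:{0<..<L}|lborel. cos (freq L j * x) * cos (freq L k * x)))"
    by (simp add: mult.assoc)
  also have "\<dots> = (if j = k then 1 else 0)"
    unfolding * using assms real_sqrt_mult_self[of "1 / L"] real_sqrt_mult_self[of "2 / L"]
    by (auto simp: cos_norm_def mult.assoc[symmetric])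
  finally show ?thesis .
qed

text \<open>By the product formula, multiplying a cosine of frequency \<open>k\<close> by \<open>cos (\<pi> x / L)\<close> gives the mean of
  the cosines of frequencies \<open>k + 1\<close> and \<open>\<bar>k - 1\<bar>\<close>.\<close>

lemma LINT_cos_power_eq_0:
  assumes g: "square_integrable_on 0 L g"
    and zero: "\<And>k. (LINT x:{0<..<L}|lborel. g x * cos (freq L k * x)) = 0"
  shows "(LINT x:{0<..<L}|lborel. g x * (cos (freq L 1 * x) ^ n * cos (freq L k * x))) = 0"
proof (induction n arbitrary: k)
  case 0
  then show ?case using zero by simp
next
  case (Suc n)
  have int: "set_integrable lborel {0<..<L} (\<lambda>x. g x * (cos (freq L 1 * x) ^ n * cos (freq L k * x)))" for k
    by (intro set_integrable_mult_square_integrable g continuous_on_square_integrable_on continuous_intros)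
  have *: "cos (freq L 1 * x) * cos (freq L k * x) =
      (cos (freq L (Suc k) * x) + cos (freq L (if k = 0 then 1 else k - 1) * x)) / 2" for x
  proof (cases k)
    case (Suc i)
    have "freq L 1 * x - freq L k * x = - (freq L i * x)" "freq L 1 * x + freq L k * x = freq L (Suc k) * x"
      by (simp_all add: Suc freq_def algebra_simps add_divide_distrib diff_divide_distrib)
    then show ?thesis by (simp add: cos_times_cos Suc)
  qed (simp add: freq_def)
  have aux: "u * (c ^ Suc n * d) = (u * (c ^ n * a) + u * (c ^ n * b)) / 2"
    if "c * d = (a + b) / 2" for u c d a b :: real
  proof -
    have "u * (c ^ Suc n * d) = u * c ^ n * (c * d)" by (simp add: mult_ac)
    then show ?thesis unfolding that by (simp add: algebra_simps)
  qed
  have "(LINT x:{0<..<L}|lborel. g x * (cos (freq L 1 * x) ^ Suc n * cos (freq L k * x))) =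
      (LINT x:{0<..<L}|lborel. (g x * (cos (freq L 1 * x) ^ n * cos (freq L (Suc k) * x)) +
        g x * (cos (freq L 1 * x) ^ n * cos (freq L (if k = 0 then 1 else k - 1) * x))) / 2)"
    by (rule arg_cong[where f = "\<lambda>f. set_lebesgue_integral lborel _ f"], rule ext) (rule aux[OF *])
  then show ?case
    by (simp only: set_integral_divide_zero set_integral_add(2)[OF int int] Suc.IH add_0 div_0)
qed

text \<open>The map \<open>x \<mapsto> cos (\<pi> x / L)\<close> is a homeomorphism from \<open>[0, L]\<close> onto \<open>[-1, 1]\<close>, so by Weierstrass every
  continuous function on \<open>[0, L]\<close> is a uniform limit of polynomials in \<open>cos (\<pi> x / L)\<close>.\<close>

lemma LINT_cos_continuous_eq_0:
  assumes L: "L > 0" and g: "square_integrable_on 0 L g"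
    and zero: "\<And>k. (LINT x:{0<..<L}|lborel. g x * cos (freq L k * x)) = 0"
    and h: "continuous_on {0..L} h"
  shows "(LINT x:{0<..<L}|lborel. g x * h x) = 0"
proof -
  have int: "set_integrable lborel {0<..<L} (\<lambda>x. g x * h x)" if "continuous_on {0..L} h" for h
    by (intro set_integrable_mult_square_integrable g continuous_on_square_integrable_on that)
  have int_abs: "set_integrable lborel {0<..<L} (\<lambda>x. \<bar>g x\<bar>)"
    using set_integrable_abs[OF int[OF continuous_on_const[of _ 1]]] by simp
  define M where "M = (LINT x:{0<..<L}|lborel. \<bar>g x\<bar>)"
  have poly: "(LINT x:{0<..<L}|lborel. g x * p (cos (freq L 1 * x))) = 0"
    if p0: "real_polynomial_function p" for p
  proof -
    obtain a n where p: "p = (\<lambda>x. \<Sum>i\<le>n. a i * x ^ i)"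
      using p0 unfolding real_polynomial_function_iff_sum by blast
    have "(LINT x:{0<..<L}|lborel. g x * p (cos (freq L 1 * x))) =
        (LINT x|lborel. (\<Sum>i\<le>n. a i * (indicator {0<..<L} x *\<^sub>R (g x * (cos (freq L 1 * x) ^ i * cos (freq L 0 * x))))))"
      unfolding set_lebesgue_integral_def p
      by (rule Bochner_Integration.integral_cong)
        (simp_all add: sum_distrib_left freq_def mult_ac)
    also have "\<dots> = (\<Sum>i\<le>n. LINT x|lborel. a i * (indicator {0<..<L} x *\<^sub>R (g x * (cos (freq L 1 * x) ^ i * cos (freq L 0 * x)))))"
    proof (rule Bochner_Integration.integral_sum)
      have "integrable lborel (\<lambda>x. indicator {0<..<L} x *\<^sub>R (g x * (cos (freq L 1 * x) ^ i * cos (freq L 0 * x))))" for i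
        unfolding set_integrable_def[symmetric] by (rule int) (intro continuous_intros)
      then show "integrable lborel (\<lambda>x. a i * (indicator {0<..<L} x *\<^sub>R (g x * (cos (freq L 1 * x) ^ i * cos (freq L 0 * x)))))" for i
        by (intro integrable_mult_right)
    qed
    also have "\<dots> = 0"
      using LINT_cos_power_eq_0[OF g zero, where k = 0]
      by (simp add: set_lebesgue_integral_def)
    finally show ?thesis .
  qed
  have M: "\<bar>LINT x:{0<..<L}|lborel. g x * h x\<bar> \<le> \<epsilon> * M" if eps: "\<epsilon> > 0" for \<epsilon>
  proof -
    have "continuous_on {-1..1} (h \<circ> (\<lambda>s. arccos s / freq L 1))"
    proof (rule continuous_on_compose)
      show "continuous_on {- 1..1} (\<lambda>s. arccos s / freq L 1)"
        using L by (intro continuous_intros) (auto simp: freq_def)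
      have "arccos s / freq L 1 \<in> {0..L}" if "s \<in> {-1..1}" for s
        using that L arccos_ubound[of s] arccos_lbound[of s] by (simp add: freq_def field_simps)
      then have "(\<lambda>s. arccos s / freq L 1) ` {- 1..1} \<subseteq> {0..L}" by blast
      then show "continuous_on ((\<lambda>s. arccos s / freq L 1) ` {- 1..1}) h"
        by (rule continuous_on_subset[OF h])
    qed
    then obtain p where p: "real_polynomial_function p"
      "\<And>s. s \<in> {-1..1} \<Longrightarrow> \<bar>(h \<circ> (\<lambda>s. arccos s / freq L 1)) s - p s\<bar> < \<epsilon>"
      using Stone_Weierstrass_real_polynomial_function[OF compact_Icc _ eps] by metis
    have bound: "\<bar>h x - p (cos (freq L 1 * x))\<bar> \<le> \<epsilon>" if "x \<in> {0<..<L}" for x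
    proof -
      have "arccos (cos (freq L 1 * x)) = freq L 1 * x"
        using that L by (intro arccos_cos) (auto simp: freq_def field_simps)
      then have "arccos (cos (freq L 1 * x)) / freq L 1 = x" using L by (simp add: freq_def)
      then show ?thesis using p(2)[of "cos (freq L 1 * x)"] by simp
    qed
    have "polynomial_function p" using p(1) by (metis real_polynomial_function_eq)
    then have pc: "continuous_on {0..L} (\<lambda>x. p (cos (freq L 1 * x)))"
      by (intro continuous_on_compose2[OF continuous_on_polymonial_function[of p UNIV]] continuous_intros) auto
    have "(LINT x:{0<..<L}|lborel. g x * h x) =
        (LINT x:{0<..<L}|lborel. g x * h x) - (LINT x:{0<..<L}|lborel. g x * p (cos (freq L 1 * x)))"
      by (simp only: poly[OF p(1)] diff_0_right)
    also have "\<dots> = (LINT x:{0<..<L}|lborel. g x * h x - g x * p (cos (freq L 1 * x)))"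
      by (intro set_integral_diff(2)[symmetric] int h pc)
    also have "\<bar>\<dots>\<bar> \<le> (LINT x:{0<..<L}|lborel. \<epsilon> * \<bar>g x\<bar>)"
      unfolding set_lebesgue_integral_def real_norm_def[symmetric]
    proof (rule Bochner_Integration.integral_norm_bound_integral)
      show "integrable lborel (\<lambda>x. indicator {0<..<L} x *\<^sub>R (g x * h x - g x * p (cos (freq L 1 * x))))"
        unfolding set_integrable_def[symmetric] by (intro set_integral_diff(1) int h pc)
      show "integrable lborel (\<lambda>x. indicator {0<..<L} x *\<^sub>R (\<epsilon> * norm (g x)))"
        unfolding set_integrable_def[symmetric] using int_abs by simp
      show "norm (indicator {0<..<L} x *\<^sub>R (g x * h x - g x * p (cos (freq L 1 * x)))) \<le>
          indicator {0<..<L} x *\<^sub>R (\<epsilon> * norm (g x))" for x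
      proof (cases "x \<in> {0<..<L}")
        case True
        have "\<bar>g x * h x - g x * p (cos (freq L 1 * x))\<bar> = \<bar>h x - p (cos (freq L 1 * x))\<bar> * \<bar>g x\<bar>"
          by (simp add: abs_mult[symmetric] algebra_simps)
        also have "\<dots> \<le> \<epsilon> * \<bar>g x\<bar>" by (intro mult_right_mono bound[OF True]) simp
        finally show ?thesis using True by simp
      qed simp
    qed
    finally show ?thesis by (simp add: M_def)
  qed
  have "((\<lambda>\<epsilon>. \<epsilon> * M) \<longlongrightarrow> 0 * M) (at_right 0)" by (intro tendsto_intros)
  then have "\<bar>LINT x:{0<..<L}|lborel. g x * h x\<bar> \<le> 0 * M"
    by (rule tendsto_lowerbound) (auto simp: eventually_at_filter M)
  then show ?thesis by simp
qed

text \<open>The sign of \<open>g\<close> is an almost everywhere limit of bounded continuous functions, whence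
  \<open>\<integral> \<bar>g\<bar> = 0\<close> by dominated convergence.\<close>

lemma L2_class_on_eq_0_if_orthogonal_continuous:
  assumes g: "square_integrable_on a b g"
    and zero: "\<And>h. continuous_on {a..b} h \<Longrightarrow> (LINT x:{a<..<b}|lborel. g x * h x) = 0"
  shows "L2_class_on a b g = 0"
proof -
  let ?G = "\<lambda>x. indicator {a<..<b} x * g x"
  have G: "square_integrable ?G" using g by (rule square_integrable_onD)
  then have Gm [measurable]: "?G \<in> borel_measurable lborel" by (simp add: square_integrable_def)
  have int: "integrable lborel ?G"
    using set_integrable_mult_square_integrable[OF g continuous_on_square_integrable_on[OF continuous_on_const[of _ 1]]]
    by (simp add: set_integrable_def)
  have "(\<lambda>x. sgn (?G x)) \<in> borel_measurable lborel" by measurable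
  then have "(\<lambda>x. sgn (?G x)) \<in> borel_measurable lebesgue"
    by (rule measurable_completion)
  then have "(\<lambda>x. sgn (?G x)) measurable_on UNIV"
    by (rule lebesgue_measurable_imp_measurable_on) simp
  then obtain N h where N: "negligible N" and h: "\<And>n. continuous_on UNIV (h n)"
    and lim: "\<And>x. x \<notin> N \<Longrightarrow> (\<lambda>n. h n x) \<longlonglongrightarrow> sgn (?G x)"
    unfolding measurable_on_def by auto
  \<comment> \<open>clipping keeps the limit, as \<open>sgn\<close> takes values in \<open>[-1, 1]\<close>, and gives domination\<close>
  define c where "c n x = max (-1) (min 1 (h n x))" for n x
  have c: "continuous_on A (c n)" for n A
    unfolding c_def by (intro continuous_intros continuous_on_subset[OF h]) auto
  have "AE x in lebesgue. x \<notin> N"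
    using N by (auto simp: negligible_iff_null_sets intro: AE_not_in)
  then have ae: "AE x in lborel. x \<notin> N" by (simp add: AE_completion_iff)
  have "(\<lambda>n. LINT x|lborel. ?G x * c n x) \<longlonglongrightarrow> (LINT x|lborel. ?G x * sgn (?G x))"
  proof (rule integral_dominated_convergence)
    show "integrable lborel (\<lambda>x. \<bar>?G x\<bar>)" using int by simp
    have [measurable]: "c n \<in> borel_measurable lborel" for n
      using borel_measurable_continuous_onI[OF c[of UNIV n]] by simp
    show "(\<lambda>x. ?G x * c n x) \<in> borel_measurable lborel" for n by measurable
    show "AE x in lborel. norm (?G x * c n x) \<le> \<bar>?G x\<bar>" for n
      by (intro AE_I2) (auto simp: abs_mult c_def intro!: mult_left_le)
    show "AE x in lborel. (\<lambda>n. ?G x * c n x) \<longlonglongrightarrow> ?G x * sgn (?G x)"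
      using ae
    proof eventually_elim
      case (elim x)
      have "(\<lambda>n. c n x) \<longlonglongrightarrow> max (-1) (min 1 (sgn (?G x)))"
        unfolding c_def by (intro tendsto_intros lim elim)
      also have "max (-1) (min 1 (sgn (?G x))) = sgn (?G x)" by (simp add: sgn_if)
      finally show ?case by (intro tendsto_intros)
    qed
  qed simp
  moreover have "(LINT x|lborel. ?G x * c n x) = 0" for n
    using zero[OF c[of _ n]] by (simp add: set_lebesgue_integral_def mult.assoc)
  moreover have "(\<lambda>x. ?G x * sgn (?G x)) = (\<lambda>x. \<bar>?G x\<bar>)" by (auto simp: sgn_if)
  ultimately have "(LINT x|lborel. \<bar>?G x\<bar>) = 0" by (simp add: LIMSEQ_const_iff)
  then have "AE x in lborel. \<bar>?G x\<bar> = 0"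
    using int by (subst (asm) integral_nonneg_eq_0_iff_AE) auto
  then show ?thesis
    using G by (simp add: L2_class_on_def zero_l2_def l2_class_eq_iff square_integrable_zero)
qed

lemma cos_mode_total:
  assumes L: "L > 0" and f: "f \<in> L2_on 0 L" and zero: "\<And>k. inner f (cos_mode L k) = 0"
  shows "f = 0"
proof -
  have f_eq: "L2_class_on 0 L (l2_rep f) = f" using f by (simp add: L2_on_iff)
  have g: "square_integrable_on 0 L (l2_rep f)" by (rule square_integrable_on_rep)
  have "(LINT x:{0<..<L}|lborel. l2_rep f x * cos (freq L k * x)) = 0" for k
    using zero[of k] inner_cos_mode[OF g, of k] cos_norm_pos[OF L, of k] by (simp add: f_eq)
  from LINT_cos_continuous_eq_0[OF L g this] have "L2_class_on 0 L (l2_rep f) = 0"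
    by (intro L2_class_on_eq_0_if_orthogonal_continuous[OF g])
  then show ?thesis by (simp add: f_eq)
qed

section \<open>Integration by parts against functions without compact support\<close>

lemma pos_part_sq_deriv: "((\<lambda>x::real. (max 0 x)\<^sup>2) has_real_derivative 2 * max 0 x) (at x)"
proof -
  consider "x > 0" | "x < 0" | "x = 0" by linarith
  then show ?thesis
  proof cases
    case 1
    have "((\<lambda>x::real. x\<^sup>2) has_real_derivative 2 * x) (at x)" by (auto intro!: derivative_eq_intros)
    then have "((\<lambda>x::real. (max 0 x)\<^sup>2) has_real_derivative 2 * x) (at x)"
      by (rule has_field_derivative_transform_within_open[where S = "{0<..}"]) (use 1 in auto)
    then show ?thesis using 1 by simp
  next
    case 2
    have "((\<lambda>x::real. 0) has_real_derivative 0) (at x)" by simp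
    then have "((\<lambda>x::real. (max 0 x)\<^sup>2) has_real_derivative 0) (at x)"
      by (rule has_field_derivative_transform_within_open[where S = "{..<0}"]) (use 2 in auto)
    then show ?thesis using 2 by simp
  next
    case 3
    have "((\<lambda>h::real. max 0 h) \<longlongrightarrow> max 0 0) (at 0)" by (intro tendsto_intros)
    moreover have "(max 0 h)\<^sup>2 / h = max 0 h" for h :: real by (auto simp: max_def power2_eq_square)
    ultimately show ?thesis unfolding 3 by (simp add: DERIV_def)
  qed
qed

text \<open>A continuously differentiable transition from \<open>0\<close> on \<open>(-\<infinity>, 0]\<close> to \<open>1\<close> on \<open>[1, \<infinity>)\<close>. Composing
  \<open>(max 0 x)\<^sup>2\<close> with itself avoids a case distinction at the gluing points.\<close>

definition ramp :: "real \<Rightarrow> real" where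
  "ramp x = 1 - (max 0 (1 - (max 0 x)\<^sup>2))\<^sup>2"

definition ramp' :: "real \<Rightarrow> real" where
  "ramp' x = 4 * max 0 (1 - (max 0 x)\<^sup>2) * max 0 x"

lemma ramp_deriv: "(ramp has_real_derivative ramp' x) (at x)"
proof -
  have "((\<lambda>x. 1 - (max 0 x)\<^sup>2) has_real_derivative - (2 * max 0 x)) (at x)"
    using DERIV_diff[OF DERIV_const[of 1] pos_part_sq_deriv] by simp
  from DERIV_chain2[OF pos_part_sq_deriv this]
  have "((\<lambda>x. (max 0 (1 - (max 0 x)\<^sup>2))\<^sup>2) has_real_derivative - ramp' x) (at x)"
    by (simp add: ramp'_def mult.assoc)
  from DERIV_diff[OF DERIV_const[of 1] this] show ?thesis
    by (simp add: ramp_def[abs_def])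
qed

lemma continuous_ramp': "continuous_on A ramp'"
  unfolding ramp'_def[abs_def] by (intro continuous_intros)

lemma ramp_nonpos: "x \<le> 0 \<Longrightarrow> ramp x = 0"
  by (simp add: ramp_def)

lemma ramp_ge_1:
  assumes "x \<ge> 1"
  shows "ramp x = 1" "ramp' x = 0"
proof -
  have "max 0 (1 - (max 0 x)\<^sup>2) = 0" using one_le_power[OF assms, of 2] assms by (intro max_absorb1) auto
  then show "ramp x = 1" "ramp' x = 0" by (simp_all add: ramp_def ramp'_def)
qed

lemma ramp_bounds: "0 \<le> ramp x" "ramp x \<le> 1"
  by (auto simp: ramp_def max_def power_le_one)

lemma ramp'_bounds: "0 \<le> ramp' x" "ramp' x \<le> 4"
proof -
  show "0 \<le> ramp' x" by (simp add: ramp'_def)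
  show "ramp' x \<le> 4"
  proof (cases "x \<ge> 1")
    case False
    have "max 0 (1 - (max 0 x)\<^sup>2) * max 0 x \<le> 1 * 1" using False by (intro mult_mono) auto
    then show ?thesis by (simp add: ramp'_def)
  qed (simp add: ramp_ge_1)
qed

text \<open>The support lies in \<open>[1 / n, L - 1 / n]\<close>, and the derivative, of size \<open>n\<close>, lives in two layers of
  width \<open>1 / n\<close>.\<close>

definition cutoff :: "real \<Rightarrow> nat \<Rightarrow> real \<Rightarrow> real" where
  "cutoff L n x = ramp (real n * x - 1) * ramp (real n * (L - x) - 1)"

definition cutoff' :: "real \<Rightarrow> nat \<Rightarrow> real \<Rightarrow> real" where
  "cutoff' L n x = real n * ramp' (real n * x - 1) * ramp (real n * (L - x) - 1) -
    real n * ramp (real n * x - 1) * ramp' (real n * (L - x) - 1)"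

lemma cutoff_deriv: "(cutoff L n has_real_derivative cutoff' L n x) (at x)"
proof -
  have 1: "((\<lambda>x. ramp (real n * x - 1)) has_real_derivative ramp' (real n * x - 1) * real n) (at x)"
    by (rule DERIV_chain2[OF ramp_deriv]) (auto intro!: derivative_eq_intros)
  have 2: "((\<lambda>x. ramp (real n * (L - x) - 1)) has_real_derivative ramp' (real n * (L - x) - 1) * (- real n)) (at x)"
    by (rule DERIV_chain2[OF ramp_deriv]) (auto intro!: derivative_eq_intros)
  show ?thesis
    unfolding cutoff_def[abs_def]
    by (rule DERIV_cong[OF DERIV_mult[OF 1 2]]) (simp add: cutoff'_def algebra_simps)
qed

lemma continuous_ramp: "continuous_on A ramp"
  by (rule DERIV_continuous_on[OF has_field_derivative_at_within[OF ramp_deriv]])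

lemma continuous_cutoff: "continuous_on A (cutoff L n)"
  by (rule DERIV_continuous_on[OF has_field_derivative_at_within[OF cutoff_deriv]])

lemma continuous_cutoff': "continuous_on A (cutoff' L n)"
  unfolding cutoff'_def[abs_def]
  by (intro continuous_intros continuous_on_compose2[OF continuous_ramp[of UNIV]]
      continuous_on_compose2[OF continuous_ramp'[of UNIV]]) auto

lemma cutoff_bounds: "0 \<le> cutoff L n x" "cutoff L n x \<le> 1"
  using ramp_bounds by (auto simp: cutoff_def mult_le_one)

lemma cutoff_support: "n > 0 \<Longrightarrow> x \<notin> {1 / real n..L - 1 / real n} \<Longrightarrow> cutoff L n x = 0"
  unfolding cutoff_def by (auto simp: not_le field_simps intro!: ramp_nonpos)

lemma cutoff'_bound:
  "\<bar>cutoff' L n x\<bar> \<le> 4 * real n * (indicator {0..2 / real n} x + indicator {L - 2 / real n..L} x)"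
  if "n > 0" "x \<in> {0..L}"
proof -
  have 1: "ramp' (real n * x - 1) \<le> 4 * indicator {0..2 / real n} x"
  proof (cases "x \<le> 2 / real n")
    case False
    then have "real n * x - 1 \<ge> 1" using that by (simp add: field_simps)
    then show ?thesis by (simp add: ramp_ge_1)
  qed (use that ramp'_bounds in auto)
  have 2: "ramp' (real n * (L - x) - 1) \<le> 4 * indicator {L - 2 / real n..L} x"
  proof (cases "x \<ge> L - 2 / real n")
    case False
    then have "real n * (L - x) - 1 \<ge> 1" using that by (simp add: field_simps)
    then show ?thesis by (simp add: ramp_ge_1)
  qed (use that ramp'_bounds in auto)
  have "\<bar>cutoff' L n x\<bar> \<le> \<bar>real n * ramp' (real n * x - 1) * ramp (real n * (L - x) - 1)\<bar> +
      \<bar>real n * ramp (real n * x - 1) * ramp' (real n * (L - x) - 1)\<bar>"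
    unfolding cutoff'_def by (rule abs_triangle_ineq4)
  also have "\<dots> = real n * (ramp' (real n * x - 1) * ramp (real n * (L - x) - 1)) +
      real n * (ramp (real n * x - 1) * ramp' (real n * (L - x) - 1))"
    by (simp add: abs_mult ramp_bounds ramp'_bounds mult.assoc)
  also have "\<dots> \<le> real n * (4 * indicator {0..2 / real n} x * 1) + real n * (1 * (4 * indicator {L - 2 / real n..L} x))"
    by (intro add_mono mult_left_mono mult_mono 1 2 ramp_bounds ramp'_bounds) auto
  finally show ?thesis by (simp add: algebra_simps)
qed

lemma cutoff_eventually_1:
  assumes "0 < x" "x < L"
  shows "\<forall>\<^sub>F n in sequentially. cutoff L n x = 1 \<and> cutoff' L n x = 0"
proof -
  obtain N :: nat where N: "max (2 / x) (2 / (L - x)) < real N" using reals_Archimedean2 by blast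
  have "cutoff L n x = 1 \<and> cutoff' L n x = 0" if "n \<ge> N" for n
  proof -
    have "2 / x \<le> real n" "2 / (L - x) \<le> real n" using N that by (auto simp: max_def split: if_splits)
    then have "real n * x - 1 \<ge> 1" "real n * (L - x) - 1 \<ge> 1" using assms by (auto simp: field_simps)
    then show ?thesis by (simp add: cutoff_def cutoff'_def ramp_ge_1)
  qed
  then show ?thesis by (auto simp: eventually_sequentially)
qed

text \<open>Weak derivatives are tested with functions of compact support only. Cutting off a general test
  function \<open>\<psi>\<close> produces an error term carried by the two boundary layers; the next two lemmas show that it
  vanishes when \<open>\<psi>\<close>, respectively \<open>f\<close>, vanishes at the end points.\<close>

lemma weak_deriv_parts_limit:
  assumes w: "weak_deriv 0 L f g" and f: "square_integrable_on 0 L f" and g: "square_integrable_on 0 L g"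
    and psi: "\<And>x. (\<psi> has_real_derivative \<psi>' x) (at x)" "continuous_on UNIV \<psi>'"
    and lim: "(\<lambda>n. LINT x:{0<..<L}|lborel. f x * (\<psi> x * cutoff' L n x)) \<longlonglongrightarrow> 0"
  shows "(LINT x:{0<..<L}|lborel. f x * \<psi>' x) = - (LINT x:{0<..<L}|lborel. g x * \<psi> x)"
proof -
  have psic: "continuous_on A \<psi>" for A
    by (rule DERIV_continuous_on[OF has_field_derivative_at_within[OF psi(1)]])
  have psi'c: "continuous_on A \<psi>'" for A by (rule continuous_on_subset[OF psi(2)]) simp
  have conv: "(\<lambda>n. LINT x:{0<..<L}|lborel. u x * (v x * cutoff L n x)) \<longlonglongrightarrow> (LINT x:{0<..<L}|lborel. u x * v x)"
    if u: "square_integrable_on 0 L u" and v: "continuous_on {0..L} v" for u v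
    unfolding set_lebesgue_integral_def
  proof (rule integral_dominated_convergence)
    have i: "set_integrable lborel {0<..<L} (\<lambda>x. u x * v x)"
      by (intro set_integrable_mult_square_integrable u continuous_on_square_integrable_on v)
    then show "integrable lborel (\<lambda>x. norm (indicator {0<..<L} x *\<^sub>R (u x * v x)))"
      by (simp only: set_integrable_def integrable_norm)
    show "(\<lambda>x. indicator {0<..<L} x *\<^sub>R (u x * v x)) \<in> borel_measurable lborel"
      using i by (auto simp: set_integrable_def)
    have "set_integrable lborel {0<..<L} (\<lambda>x. u x * (v x * cutoff L n x))" for n
      by (intro set_integrable_mult_square_integrable u continuous_on_square_integrable_on continuous_intros v continuous_cutoff)
    then show "(\<lambda>x. indicator {0<..<L} x *\<^sub>R (u x * (v x * cutoff L n x))) \<in> borel_measurable lborel" for n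
      by (auto simp: set_integrable_def)
    show "AE x in lborel. (\<lambda>n. indicator {0<..<L} x *\<^sub>R (u x * (v x * cutoff L n x))) \<longlonglongrightarrow> indicator {0<..<L} x *\<^sub>R (u x * v x)"
    proof (rule AE_I2, rule tendsto_eventually)
      fix x
      show "\<forall>\<^sub>F n in sequentially. indicator {0<..<L} x *\<^sub>R (u x * (v x * cutoff L n x)) = indicator {0<..<L} x *\<^sub>R (u x * v x)"
      proof (cases "x \<in> {0<..<L}")
        case True
        then have "\<forall>\<^sub>F n in sequentially. cutoff L n x = 1 \<and> cutoff' L n x = 0"
          by (intro cutoff_eventually_1) auto
        then show ?thesis by (rule eventually_mono) simp
      qed simp
    qed
    show "AE x in lborel. norm (indicator {0<..<L} x *\<^sub>R (u x * (v x * cutoff L n x))) \<le> norm (indicator {0<..<L} x *\<^sub>R (u x * v x))" for n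
    proof (rule AE_I2)
      fix x
      have "\<bar>u x\<bar> * (\<bar>v x\<bar> * \<bar>cutoff L n x\<bar>) \<le> \<bar>u x\<bar> * (\<bar>v x\<bar> * 1)"
        using cutoff_bounds[of L n x] by (intro mult_left_mono) auto
      then show "norm (indicator {0<..<L} x *\<^sub>R (u x * (v x * cutoff L n x))) \<le> norm (indicator {0<..<L} x *\<^sub>R (u x * v x))"
        by (simp add: abs_mult indicator_def)
    qed
  qed
  have eq: "(LINT x:{0<..<L}|lborel. f x * (\<psi>' x * cutoff L n x)) + (LINT x:{0<..<L}|lborel. f x * (\<psi> x * cutoff' L n x))
      = - (LINT x:{0<..<L}|lborel. g x * (\<psi> x * cutoff L n x))" if n: "n > 0" for n
  proof -
    have "(LINT x:{0<..<L}|lborel. f x * (\<psi>' x * cutoff L n x + \<psi> x * cutoff' L n x)) =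
        - (LINT x:{0<..<L}|lborel. g x * (\<psi> x * cutoff L n x))"
    proof (rule w[unfolded weak_deriv_def, rule_format])
      show "((\<lambda>x. \<psi> x * cutoff L n x) has_real_derivative \<psi>' x * cutoff L n x + \<psi> x * cutoff' L n x) (at x)" for x
        by (rule DERIV_cong[OF DERIV_mult[OF psi(1) cutoff_deriv]]) (simp add: mult.commute)
      show "continuous_on UNIV (\<lambda>x. \<psi>' x * cutoff L n x + \<psi> x * cutoff' L n x)"
        by (intro continuous_intros psi'c psic continuous_cutoff continuous_cutoff')
      show "\<exists>c d. 0 < c \<and> d < L \<and> (\<forall>x. x \<notin> {c..d} \<longrightarrow> \<psi> x * cutoff L n x = 0)"
        using n cutoff_support[OF n, of _ L] by (intro exI[of _ "1 / real n"] exI[of _ "L - 1 / real n"]) auto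
    qed
    moreover have "(LINT x:{0<..<L}|lborel. f x * (\<psi>' x * cutoff L n x + \<psi> x * cutoff' L n x)) =
        (LINT x:{0<..<L}|lborel. f x * (\<psi>' x * cutoff L n x)) + (LINT x:{0<..<L}|lborel. f x * (\<psi> x * cutoff' L n x))"
      unfolding distrib_left
      by (intro set_integral_add set_integrable_mult_square_integrable f continuous_on_square_integrable_on
          continuous_intros psi'c psic continuous_cutoff continuous_cutoff')
    ultimately show ?thesis by simp
  qed
  have A: "(\<lambda>n. (LINT x:{0<..<L}|lborel. f x * (\<psi>' x * cutoff L n x)) + (LINT x:{0<..<L}|lborel. f x * (\<psi> x * cutoff' L n x)))
      \<longlonglongrightarrow> (LINT x:{0<..<L}|lborel. f x * \<psi>' x) + 0"
    by (intro tendsto_add lim conv f psi'c)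
  have B: "(\<lambda>n. - (LINT x:{0<..<L}|lborel. g x * (\<psi> x * cutoff L n x))) \<longlonglongrightarrow> - (LINT x:{0<..<L}|lborel. g x * \<psi> x)"
    by (intro tendsto_minus conv g psic)
  have E: "\<forall>\<^sub>F n in sequentially. (LINT x:{0<..<L}|lborel. f x * (\<psi>' x * cutoff L n x)) + (LINT x:{0<..<L}|lborel. f x * (\<psi> x * cutoff' L n x))
      = - (LINT x:{0<..<L}|lborel. g x * (\<psi> x * cutoff L n x))"
    using eventually_gt_at_top[of 0] by eventually_elim (rule eq)
  from LIMSEQ_unique[OF Lim_transform_eventually[OF A E] B] show ?thesis by simp
qed

text \<open>In the boundary layers \<open>\<bar>\<psi>\<bar>\<close> is of order \<open>1 / n\<close>, which compensates the size of the derivative of the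
  cutoff, so that the error term tends to zero by dominated convergence.\<close>

lemma weak_deriv_parts_test_zero:
  assumes w: "weak_deriv 0 L f g" and f: "square_integrable_on 0 L f" and g: "square_integrable_on 0 L g"
    and psi: "\<And>x. (\<psi> has_real_derivative \<psi>' x) (at x)" "continuous_on UNIV \<psi>'"
    and bd: "\<And>x. \<bar>\<psi>' x\<bar> \<le> K" and zero: "\<psi> 0 = 0" "\<psi> L = 0"
  shows "(LINT x:{0<..<L}|lborel. f x * \<psi>' x) = - (LINT x:{0<..<L}|lborel. g x * \<psi> x)"
proof (rule weak_deriv_parts_limit[OF w f g psi])
  have psic: "continuous_on A \<psi>" for A
    by (rule DERIV_continuous_on[OF has_field_derivative_at_within[OF psi(1)]])
  have K: "K \<ge> 0" using bd[of 0] by linarith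
  have lip: "\<bar>\<psi> x - \<psi> y\<bar> \<le> K * \<bar>x - y\<bar>" for x y
    using field_differentiable_bound[of UNIV \<psi> \<psi>' K x y] psi(1) bd by auto
  have bound: "\<bar>\<psi> x * cutoff' L n x\<bar> \<le> 16 * K" if "x \<in> {0<..<L}" for x n
  proof (cases "n = 0")
    case False
    have i: "indicator {0..2 / real n} x * \<bar>\<psi> x\<bar> \<le> K * (2 / real n)"
    proof (cases "x \<le> 2 / real n")
      case True
      have "\<bar>\<psi> x\<bar> \<le> K * \<bar>x\<bar>" using lip[of x 0] zero by simp
      also have "\<dots> \<le> K * (2 / real n)" using True that K by (intro mult_left_mono) auto
      finally show ?thesis using True that by simp
    qed (use K in simp)
    have j: "indicator {L - 2 / real n..L} x * \<bar>\<psi> x\<bar> \<le> K * (2 / real n)"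
    proof (cases "x \<ge> L - 2 / real n")
      case True
      have "\<bar>\<psi> x\<bar> \<le> K * \<bar>x - L\<bar>" using lip[of x L] zero by simp
      also have "\<dots> \<le> K * (2 / real n)" using True that K by (intro mult_left_mono) auto
      finally show ?thesis using True that by simp
    qed (use K in simp)
    have "\<bar>\<psi> x * cutoff' L n x\<bar> \<le> \<bar>\<psi> x\<bar> * (4 * real n * (indicator {0..2 / real n} x + indicator {L - 2 / real n..L} x))"
      unfolding abs_mult using that False by (intro mult_left_mono cutoff'_bound) auto
    also have "\<dots> = 4 * real n * (indicator {0..2 / real n} x * \<bar>\<psi> x\<bar> + indicator {L - 2 / real n..L} x * \<bar>\<psi> x\<bar>)"
      by (simp add: algebra_simps)
    also have "\<dots> \<le> 4 * real n * (K * (2 / real n) + K * (2 / real n))"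
      by (intro mult_left_mono add_mono i j) auto
    also have "\<dots> = 16 * K" using False by simp
    finally show ?thesis .
  qed (use K in \<open>simp add: cutoff'_def\<close>)
  have int1: "set_integrable lborel {0<..<L} (\<lambda>x. f x * 1)"
    by (intro set_integrable_mult_square_integrable f continuous_on_square_integrable_on continuous_intros)
  have "(\<lambda>n. LINT x:{0<..<L}|lborel. f x * (\<psi> x * cutoff' L n x)) \<longlonglongrightarrow> (LINT x|(lborel :: real measure). (0::real))"
    unfolding set_lebesgue_integral_def
  proof (rule integral_dominated_convergence)
    show "integrable lborel (\<lambda>x. 16 * K * norm (indicator {0<..<L} x *\<^sub>R (f x * 1)))"
      using int1 by (intro integrable_mult_right integrable_norm) (simp only: set_integrable_def)
    have "set_integrable lborel {0<..<L} (\<lambda>x. f x * (\<psi> x * cutoff' L n x))" for n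
      by (intro set_integrable_mult_square_integrable f continuous_on_square_integrable_on continuous_intros psic continuous_cutoff')
    then show "(\<lambda>x. indicator {0<..<L} x *\<^sub>R (f x * (\<psi> x * cutoff' L n x))) \<in> borel_measurable lborel" for n
      by (auto simp: set_integrable_def)
    show "AE x in lborel. (\<lambda>n. indicator {0<..<L} x *\<^sub>R (f x * (\<psi> x * cutoff' L n x))) \<longlonglongrightarrow> 0"
    proof (rule AE_I2, rule tendsto_eventually)
      fix x
      show "\<forall>\<^sub>F n in sequentially. indicator {0<..<L} x *\<^sub>R (f x * (\<psi> x * cutoff' L n x)) = 0"
      proof (cases "x \<in> {0<..<L}")
        case True
        then have "\<forall>\<^sub>F n in sequentially. cutoff L n x = 1 \<and> cutoff' L n x = 0"
          by (intro cutoff_eventually_1) auto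
        then show ?thesis by (rule eventually_mono) simp
      qed simp
    qed
    show "AE x in lborel. norm (indicator {0<..<L} x *\<^sub>R (f x * (\<psi> x * cutoff' L n x))) \<le>
        16 * K * norm (indicator {0<..<L} x *\<^sub>R (f x * 1))" for n
    proof (rule AE_I2)
      fix x
      show "norm (indicator {0<..<L} x *\<^sub>R (f x * (\<psi> x * cutoff' L n x))) \<le> 16 * K * norm (indicator {0<..<L} x *\<^sub>R (f x * 1))"
      proof (cases "x \<in> {0<..<L}")
        case True
        have "\<bar>f x\<bar> * \<bar>\<psi> x * cutoff' L n x\<bar> \<le> \<bar>f x\<bar> * (16 * K)"
          by (intro mult_left_mono bound True) auto
        then show ?thesis using True by (simp add: abs_mult mult_ac)
      qed simp
    qed
  qed simp
  then show "(\<lambda>n. LINT x:{0<..<L}|lborel. f x * (\<psi> x * cutoff' L n x)) \<longlonglongrightarrow> 0" by simp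
qed

text \<open>The derivative of the cutoff is bounded in \<open>L\<^sup>1\<close>, and \<open>f\<close> is uniformly small in the boundary layers.\<close>

lemma weak_deriv_parts_function_zero:
  assumes w: "weak_deriv 0 L f g" and g: "square_integrable_on 0 L g"
    and fc: "continuous_on {0..L} f" and zero: "f 0 = 0" "f L = 0" and L: "L > 0"
    and psi: "\<And>x. (\<psi> has_real_derivative \<psi>' x) (at x)" "continuous_on UNIV \<psi>'"
    and bd: "\<And>x. \<bar>\<psi> x\<bar> \<le> K"
  shows "(LINT x:{0<..<L}|lborel. f x * \<psi>' x) = - (LINT x:{0<..<L}|lborel. g x * \<psi> x)"
proof (rule weak_deriv_parts_limit[OF w continuous_on_square_integrable_on[OF fc] g psi])
  have psic: "continuous_on A \<psi>" for A
    by (rule DERIV_continuous_on[OF has_field_derivative_at_within[OF psi(1)]])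
  have K: "K \<ge> 0" using bd[of 0] by linarith
  show "(\<lambda>n. LINT x:{0<..<L}|lborel. f x * (\<psi> x * cutoff' L n x)) \<longlonglongrightarrow> 0"
  proof (rule LIMSEQ_I)
    fix r :: real assume r: "r > 0"
    \<comment> \<open>the two layers have total width \<open>4 / n\<close> and the cutoff slope is at most \<open>4 n\<close>: the factor is \<open>16 K\<close>\<close>
    define \<epsilon> where "\<epsilon> = r / 2 / (16 * K + 1)"
    have eps: "\<epsilon> > 0" using r K by (simp add: \<epsilon>_def)
    obtain d1 where d1: "d1 > 0" "\<And>x. x \<in> {0..L} \<Longrightarrow> \<bar>x\<bar> < d1 \<Longrightarrow> \<bar>f x\<bar> < \<epsilon>"
      using fc[unfolded continuous_on_iff, rule_format, of 0 \<epsilon>] L eps zero by (auto simp: dist_real_def)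
    obtain d2 where d2: "d2 > 0" "\<And>x. x \<in> {0..L} \<Longrightarrow> \<bar>x - L\<bar> < d2 \<Longrightarrow> \<bar>f x\<bar> < \<epsilon>"
      using fc[unfolded continuous_on_iff, rule_format, of L \<epsilon>] L eps zero by (auto simp: dist_real_def)
    obtain N :: nat where N: "max (2 / d1) (2 / d2) < real N" using reals_Archimedean2 by blast
    have "\<bar>LINT x:{0<..<L}|lborel. f x * (\<psi> x * cutoff' L n x)\<bar> < r" if n: "n \<ge> Suc N" for n
    proof -
      have n0: "n > 0" using n by simp
      have "2 / d1 < real n" "2 / d2 < real n" using N n by (auto simp: max_def split: if_splits)
      then have nd: "2 / real n < d1" "2 / real n < d2" using d1(1) d2(1) n0 by (auto simp: field_simps)
      let ?I = "\<lambda>x. indicator {0..2 / real n} x + indicator {L - 2 / real n..L} x :: real"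
      have pt: "\<bar>f x * (\<psi> x * cutoff' L n x)\<bar> \<le> \<epsilon> * K * (4 * real n) * ?I x" if x: "x \<in> {0<..<L}" for x
      proof -
        have "\<bar>f x\<bar> * ?I x \<le> \<epsilon> * ?I x"
          using d1(2)[of x] d2(2)[of x] nd x eps by (auto simp: indicator_def)
        moreover have "\<bar>f x * (\<psi> x * cutoff' L n x)\<bar> \<le> \<bar>f x\<bar> * (K * (4 * real n * ?I x))"
          unfolding abs_mult using x n0 K by (intro mult_left_mono mult_mono bd cutoff'_bound) auto
        then have "\<bar>f x * (\<psi> x * cutoff' L n x)\<bar> \<le> (K * (4 * real n)) * (\<bar>f x\<bar> * ?I x)" by (simp add: mult_ac)
        moreover have "(K * (4 * real n)) * (\<bar>f x\<bar> * ?I x) \<le> (K * (4 * real n)) * (\<epsilon> * ?I x)"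
          using K calculation(1) by (intro mult_left_mono) auto
        ultimately show ?thesis by (simp add: mult_ac)
      qed
      have intI: "integrable lborel (indicator {0..2 / real n} :: real \<Rightarrow> real)"
        "integrable lborel (indicator {L - 2 / real n..L} :: real \<Rightarrow> real)"
        by (auto intro!: integrable_real_indicator)
      have "\<bar>LINT x:{0<..<L}|lborel. f x * (\<psi> x * cutoff' L n x)\<bar> \<le> (LINT x|lborel. \<epsilon> * K * (4 * real n) * ?I x)"
        unfolding set_lebesgue_integral_def real_norm_def[symmetric]
      proof (rule Bochner_Integration.integral_norm_bound_integral)
        have "set_integrable lborel {0<..<L} (\<lambda>x. f x * (\<psi> x * cutoff' L n x))"
          by (intro set_integrable_open_continuous continuous_intros fc psic continuous_cutoff')
        then show "integrable lborel (\<lambda>x. indicator {0<..<L} x *\<^sub>R (f x * (\<psi> x * cutoff' L n x)))"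
          by (simp only: set_integrable_def)
        show "integrable lborel (\<lambda>x. \<epsilon> * K * (4 * real n) * ?I x)"
          using intI by (intro integrable_mult_right Bochner_Integration.integrable_add)
        show "norm (indicator {0<..<L} x *\<^sub>R (f x * (\<psi> x * cutoff' L n x))) \<le> \<epsilon> * K * (4 * real n) * ?I x" for x
          using pt[of x] K eps by (cases "x \<in> {0<..<L}") auto
      qed
      also have "\<dots> = \<epsilon> * K * (4 * real n) * (2 / real n + 2 / real n)"
        using intI by (simp add: Bochner_Integration.integral_add)
      also have "\<dots> = \<epsilon> * (16 * K)" using n0 by (simp add: field_simps)
      also have "\<dots> < r"
      proof -
        have "\<epsilon> * (16 * K) \<le> \<epsilon> * (16 * K + 1)" using eps by simp
        also have "\<dots> = r / 2"
        proof -
          have "16 * K + 1 \<noteq> 0" using K by linarith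
          from nonzero_eq_divide_eq[OF this, THEN iffD1, OF \<epsilon>_def] show ?thesis .
        qed
        finally show ?thesis using r by simp
      qed
      finally show ?thesis .
    qed
    then show "\<exists>N. \<forall>n\<ge>N. norm ((LINT x:{0<..<L}|lborel. f x * (\<psi> x * cutoff' L n x)) - 0) < r" by auto
  qed
qed

section \<open>The operator in the cosine basis\<close>

definition ks_eigenvalue :: "real \<Rightarrow> real \<Rightarrow> nat \<Rightarrow> real" where
  "ks_eigenvalue L lam k = freq L k ^ 4 - lam * freq L k ^ 2"

lemma freq_nonneg: "L > 0 \<Longrightarrow> 0 \<le> freq L k"
  by (simp add: freq_def)

lemma freq_mult: "L > 0 \<Longrightarrow> freq L k * L = real k * pi"
  by (simp add: freq_def)

lemma ks_eigenvalue_ge: "- (lam\<^sup>2 / 4) \<le> ks_eigenvalue L lam k"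
proof -
  have "0 \<le> (freq L k ^ 2 - lam / 2)\<^sup>2" by simp
  also have "\<dots> = ks_eigenvalue L lam k + lam\<^sup>2 / 4"
    by (simp add: ks_eigenvalue_def power2_eq_square power4_eq_xxxx algebra_simps)
  finally show ?thesis by simp
qed

lemma cos_modes_orthonormal_expansion:
  assumes "L > 0"
  shows "orthonormal_expansion (L2_on 0 L) (cos_mode L)"
  by unfold_locales
    (use assms in \<open>auto intro: subspace_L2_on closed_L2_on cos_mode_in cos_mode_total
      simp: inner_cos_mode_cos_mode\<close>)

text \<open>Four integrations by parts against \<open>cos\<close> and \<open>sin\<close> alternately. The sines vanish at the end
  points, and where the cosines appear the function integrated is \<open>D 1\<close> or \<open>D 3\<close>, whose boundary values are
  prescribed to be zero.\<close>

lemma ks_operator_coefficients: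
  assumes L: "L > 0" and op: "(\<phi>, \<psi>) \<in> ks_operator L lam"
  shows "\<phi> \<in> L2_on 0 L" "\<psi> \<in> L2_on 0 L"
    and "inner \<psi> (cos_mode L k) = ks_eigenvalue L lam k * inner \<phi> (cos_mode L k)"
proof -
  obtain D where D: "sobolev_derivs 0 L 4 D" "continuous_on {0..L} (D 1)" "continuous_on {0..L} (D 3)"
    "D 1 0 = 0" "D 3 0 = 0" "D 1 L = 0" "D 3 L = 0"
    and phi: "\<phi> = L2_class_on 0 L (D 0)" and psi: "\<psi> = L2_class_on 0 L (\<lambda>x. lam * D 2 x + D 4 x)"
    using op unfolding ks_operator_def by blast
  have sq: "square_integrable_on 0 L (D j)" if "j \<le> 4" for j
    using D(1) that by (simp add: sobolev_derivs_def)
  have w: "weak_deriv 0 L (D j) (D (Suc j))" if "j < 4" for j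
    using D(1) that by (simp add: sobolev_derivs_def)
  have sq4: "square_integrable_on 0 L (\<lambda>x. lam * D 2 x + D 4 x)"
    by (intro square_integrable_on_add square_integrable_on_scale sq) auto
  show "\<phi> \<in> L2_on 0 L" "\<psi> \<in> L2_on 0 L"
    unfolding phi psi by (intro L2_class_on_in sq sq4; simp)+
  let ?\<xi> = "freq L k"
  have "sin (?\<xi> * L) = 0" using freq_mult[OF L, of k] by (simp add: sin_npi)
  define Cs Sn where "Cs j = (LINT x:{0<..<L}|lborel. D j x * cos (?\<xi> * x))"
    and "Sn j = (LINT x:{0<..<L}|lborel. D j x * sin (?\<xi> * x))" for j
  have b: "Cs (Suc j) = ?\<xi> * Sn j" if j: "j < 4" "continuous_on {0..L} (D j)" "D j 0 = 0" "D j L = 0" for j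
  proof -
    have "(LINT x:{0<..<L}|lborel. D j x * (- ?\<xi> * sin (?\<xi> * x))) = - (LINT x:{0<..<L}|lborel. D (Suc j) x * cos (?\<xi> * x))"
    proof (rule weak_deriv_parts_function_zero[OF w[OF j(1)] sq j(2-4) L])
      show "((\<lambda>x. cos (?\<xi> * x)) has_real_derivative - ?\<xi> * sin (?\<xi> * x)) (at x)" for x
        by (auto intro!: derivative_eq_intros)
      show "\<bar>cos (?\<xi> * x)\<bar> \<le> 1" for x by simp
      show "continuous_on UNIV (\<lambda>x. - ?\<xi> * sin (?\<xi> * x))" by (intro continuous_intros)
    qed (use j in simp)
    then show ?thesis unfolding mult.left_commute[of "D j _"] set_integral_mult_right
      by (simp add: Cs_def Sn_def)
  qed
  have a: "Sn (Suc j) = - ?\<xi> * Cs j" if j: "j < 4" for j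
  proof -
    have "(LINT x:{0<..<L}|lborel. D j x * (?\<xi> * cos (?\<xi> * x))) = - (LINT x:{0<..<L}|lborel. D (Suc j) x * sin (?\<xi> * x))"
    proof (rule weak_deriv_parts_test_zero[OF w[OF j(1)] sq sq])
      show "((\<lambda>x. sin (?\<xi> * x)) has_real_derivative ?\<xi> * cos (?\<xi> * x)) (at x)" for x
        by (auto intro!: derivative_eq_intros)
      show "\<bar>?\<xi> * cos (?\<xi> * x)\<bar> \<le> ?\<xi>" for x
        using freq_nonneg[OF L, of k] by (simp add: abs_mult mult_left_le)
      show "continuous_on UNIV (\<lambda>x. ?\<xi> * cos (?\<xi> * x))" by (intro continuous_intros)
    qed (use j \<open>sin (?\<xi> * L) = 0\<close> in auto)
    then show ?thesis unfolding mult.left_commute[of "D j _"] set_integral_mult_right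
      by (simp add: Cs_def Sn_def)
  qed
  have C2: "Cs 2 = - (?\<xi> ^ 2) * Cs 0"
    using b[of 1] a[of 0] D by (simp add: numeral_2_eq_2 power2_eq_square)
  have C4: "Cs 4 = - (?\<xi> ^ 2) * Cs 2"
    using b[of 3] a[of 2] D by (simp add: power2_eq_square)
  have "inner \<psi> (cos_mode L k) = cos_norm L k * (LINT x:{0<..<L}|lborel. (lam * D 2 x + D 4 x) * cos (?\<xi> * x))"
    unfolding psi by (rule inner_cos_mode[OF sq4])
  also have "(LINT x:{0<..<L}|lborel. (lam * D 2 x + D 4 x) * cos (?\<xi> * x)) =
      (LINT x:{0<..<L}|lborel. lam * (D 2 x * cos (?\<xi> * x)) + D 4 x * cos (?\<xi> * x))"
    by (simp add: distrib_right mult.assoc)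
  also have "\<dots> = lam * Cs 2 + Cs 4"
  proof -
    have i: "set_integrable lborel {0<..<L} (\<lambda>x. D j x * cos (?\<xi> * x))" if "j \<le> 4" for j
      by (intro set_integrable_mult_square_integrable sq that continuous_on_square_integrable_on continuous_intros)
    show ?thesis unfolding Cs_def
      by (subst set_integral_add(2)) (auto intro!: set_integrable_mult_right i)
  qed
  also have "\<dots> = ks_eigenvalue L lam k * Cs 0"
    unfolding C4 C2 by (simp add: ks_eigenvalue_def algebra_simps power2_eq_square power4_eq_xxxx)
  also have "cos_norm L k * (ks_eigenvalue L lam k * Cs 0) = ks_eigenvalue L lam k * inner \<phi> (cos_mode L k)"
    unfolding phi Cs_def by (subst inner_cos_mode) (auto intro: sq)
  finally show "inner \<psi> (cos_mode L k) = ks_eigenvalue L lam k * inner \<phi> (cos_mode L k)" .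
qed

text \<open>Each derivative shifts the phase by \<open>\<pi> / 2\<close>, so one formula covers the cosine series of a function and
  all its formal derivatives.\<close>

definition trig_term :: "real \<Rightarrow> (nat \<Rightarrow> real) \<Rightarrow> nat \<Rightarrow> nat \<Rightarrow> real \<Rightarrow> real" where
  "trig_term L c j k x = c k * freq L k ^ j * cos (freq L k * x + real j * (pi / 2))"

definition trig_series :: "real \<Rightarrow> (nat \<Rightarrow> real) \<Rightarrow> nat \<Rightarrow> real \<Rightarrow> real" where
  "trig_series L c j x = (\<Sum>k. trig_term L c j k x)"

lemma trig_term_deriv: "(trig_term L c j k has_real_derivative trig_term L c (Suc j) k x) (at x)"
proof -
  have "cos (freq L k * x + real (Suc j) * (pi / 2)) = cos ((freq L k * x + real j * (pi / 2)) + pi / 2)"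
    by (simp add: algebra_simps add_divide_distrib)
  also have "\<dots> = - sin (freq L k * x + real j * (pi / 2))" by (simp only: cos_add cos_pi_half sin_pi_half)
  finally have "trig_term L c (Suc j) k x = c k * freq L k ^ j * (- sin (freq L k * x + real j * (pi / 2)) * freq L k)"
    by (simp add: trig_term_def)
  moreover have "((\<lambda>x. c k * freq L k ^ j * cos (freq L k * x + real j * (pi / 2))) has_real_derivative
      c k * freq L k ^ j * (- sin (freq L k * x + real j * (pi / 2)) * freq L k)) (at x)"
    by (auto intro!: derivative_eq_intros)
  ultimately show ?thesis by (simp add: trig_term_def[abs_def])
qed

lemma continuous_trig_term: "continuous_on A (trig_term L c j k)"
  unfolding trig_term_def[abs_def] by (intro continuous_intros)

lemma trig_term_bound: "L > 0 \<Longrightarrow> \<bar>trig_term L c j k x\<bar> \<le> \<bar>c k\<bar> * freq L k ^ j"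
  using freq_nonneg[of L k] by (simp add: trig_term_def abs_mult mult_left_le)

context
  fixes L :: real and c :: "nat \<Rightarrow> real" and j :: nat
  assumes L: "L > 0" and sm: "summable (\<lambda>k. \<bar>c k\<bar> * freq L k ^ j)"
begin

lemma trig_series_uniform: "uniform_limit UNIV (\<lambda>N x. \<Sum>k<N. trig_term L c j k x) (trig_series L c j) sequentially"
  unfolding trig_series_def[abs_def] by (rule Weierstrass_m_test[OF _ sm]) (use trig_term_bound[OF L] in auto)

lemma continuous_trig_series: "continuous_on A (trig_series L c j)"
  by (rule continuous_on_subset[OF uniform_limit_theorem[OF _ trig_series_uniform]])
    (auto intro!: always_eventually continuous_on_sum continuous_trig_term)

lemma LINT_trig_series:
  "square_integrable_on 0 L h \<Longrightarrow>
    (\<lambda>k. LINT x:{0<..<L}|lborel. trig_term L c j k x * h x) sums (LINT x:{0<..<L}|lborel. trig_series L c j x * h x)"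
  unfolding trig_series_def
  by (rule LINT_uniform_series[where M = "\<lambda>k. \<bar>c k\<bar> * freq L k ^ j"])
    (auto intro: continuous_trig_term trig_term_bound L sm)

end

lemma trig_series_deriv:
  assumes L: "L > 0" and sm: "summable (\<lambda>k. \<bar>c k\<bar> * freq L k ^ j)" "summable (\<lambda>k. \<bar>c k\<bar> * freq L k ^ Suc j)"
  shows "(trig_series L c j has_real_derivative trig_series L c (Suc j) x) (at x)"
proof -
  have "((\<lambda>x. \<Sum>k. trig_term L c j k x) has_real_derivative (\<Sum>k. trig_term L c (Suc j) k x)) (at x)"
  proof (rule has_field_derivative_series'(2)[where S = UNIV and ?x0.0 = 0 and f = "trig_term L c j"])
    show "uniformly_convergent_on UNIV (\<lambda>N x. \<Sum>k<N. trig_term L c (Suc j) k x)"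
      using trig_series_uniform[OF L sm(2)] by (auto simp: uniformly_convergent_on_def)
    show "summable (\<lambda>k. trig_term L c j k 0)"
      by (rule summable_comparison_test'[OF sm(1)]) (use trig_term_bound[OF L] in auto)
  qed (use trig_term_deriv in auto)
  then show ?thesis by (simp add: trig_series_def[abs_def])
qed

lemma trig_term_boundary:
  assumes "L > 0" "j = 1 \<or> j = 3" "x = 0 \<or> x = L"
  shows "trig_term L c j k x = 0"
proof -
  have "cos (real n * pi + real j * (pi / 2)) = 0" for n
    using assms(2) cos_3over2_pi by (auto simp: cos_add sin_npi)
  from this[of k] this[of 0] show ?thesis
    using assms freq_mult[OF assms(1), of k] by (auto simp: trig_term_def)
qed

lemma trig_series_boundary:
  "L > 0 \<Longrightarrow> j = 1 \<or> j = 3 \<Longrightarrow> x = 0 \<or> x = L \<Longrightarrow> trig_series L c j x = 0"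
  by (simp add: trig_series_def trig_term_boundary)

lemma C1_weak_deriv:
  assumes "a \<le> b" "\<And>x. (f has_real_derivative f' x) (at x)" "continuous_on {a..b} f'"
  shows "weak_deriv a b f f'"
  unfolding weak_deriv_def
proof (intro allI impI)
  fix \<psi> \<psi>' :: "real \<Rightarrow> real"
  assume psi: "\<forall>x. (\<psi> has_real_derivative \<psi>' x) (at x)" "continuous_on UNIV \<psi>'"
    and "\<exists>c d. a < c \<and> d < b \<and> (\<forall>x. x \<notin> {c..d} \<longrightarrow> \<psi> x = 0)"
  then have "\<psi> a = 0" "\<psi> b = 0" by fastforce+
  moreover have "(LINT x:{a<..<b}|lborel. f' x * \<psi> x) = f b * \<psi> b - f a * \<psi> a - (LINT x:{a<..<b}|lborel. f x * \<psi>' x)"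
    by (rule LINT_by_parts)
      (use assms psi in \<open>auto intro: has_field_derivative_at_within continuous_on_subset\<close>)
  ultimately show "(LINT x:{a<..<b}|lborel. f x * \<psi>' x) = - (LINT x:{a<..<b}|lborel. f' x * \<psi> x)" by simp
qed

lemma power_le_1_plus_power4:
  fixes \<xi> :: real
  assumes "\<xi> \<ge> 0" "i \<le> 4"
  shows "\<xi> ^ i \<le> 1 + \<xi> ^ 4"
proof (cases "\<xi> \<le> 1")
  case True
  then have "\<xi> ^ i \<le> 1" using assms by (simp add: power_le_one)
  moreover have "0 \<le> \<xi> ^ 4" using assms by simp
  ultimately show ?thesis by linarith
next
  case False
  then have "\<xi> ^ i \<le> \<xi> ^ 4" using assms by (intro power_increasing) auto
  then show ?thesis by simp
qed

lemma summable_inverse_freq: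
  assumes L: "L > 0"
  shows "summable (\<lambda>k. (1 / (1 + freq L k))\<^sup>2)"
proof (rule summable_comparison_test')
  show "summable (\<lambda>k. (L / pi)\<^sup>2 * inverse (real k ^ 2))"
    by (intro summable_mult inverse_power_summable) auto
  show "norm ((1 / (1 + freq L k))\<^sup>2) \<le> (L / pi)\<^sup>2 * inverse (real k ^ 2)" if "k \<ge> 1" for k
  proof -
    have "freq L k > 0" using that L by (simp add: freq_def)
    then have "1 / (1 + freq L k) \<le> 1 / freq L k" by (intro divide_left_mono mult_pos_pos) auto
    also have "\<dots> = L / pi * inverse (real k)" using that L by (simp add: freq_def field_simps)
    finally have "(1 / (1 + freq L k))\<^sup>2 \<le> (L / pi * inverse (real k))\<^sup>2"
      using freq_nonneg[OF L, of k] by (intro power_mono) auto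
    also have "\<dots> = (L / pi)\<^sup>2 * inverse (real k ^ 2)" by (simp only: power_mult_distrib power_inverse)
    finally show ?thesis by simp
  qed
qed

text \<open>Writing \<open>\<xi>\<^sub>k = k \<pi> / L\<close>, the bound \<open>\<xi>\<^sub>k\<^sup>4 \<le> 2 \<bar>\<mu>\<^sub>k\<bar> + 4 \<lambda>\<^sup>2\<close> makes \<open>\<xi>\<^sub>k\<^sup>4 f\<^sub>k\<close> square summable. As the
  inverse frequencies are square summable too, the cosine series of \<open>f\<close> and its first three formal
  derivatives converge uniformly, which gives classical derivatives and the boundary values; only the last
  derivative is an \<open>L\<^sup>2\<close> limit and is identified by duality.\<close>

lemma ks_operator_from_coefficients:
  assumes L: "L > 0" and lam: "lam > 0" and f: "f \<in> L2_on 0 L" and g: "g \<in> L2_on 0 L"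
    and fg: "\<And>k. inner g (cos_mode L k) = ks_eigenvalue L lam k * inner f (cos_mode L k)"
  shows "(f, g) \<in> ks_operator L lam"
proof -
  interpret orthonormal_expansion "L2_on 0 L" "cos_mode L"
    by (rule cos_modes_orthonormal_expansion[OF L])
  define F where "F k = inner f (cos_mode L k)" for k
  define G where "G k = inner g (cos_mode L k)" for k
  define \<xi> where "\<xi> = freq L"
  have xi: "0 \<le> \<xi> k" for k unfolding \<xi>_def by (rule freq_nonneg[OF L])
  have F2: "summable (\<lambda>k. (F k)\<^sup>2)" and G2: "summable (\<lambda>k. (G k)\<^sup>2)"
    unfolding F_def G_def by (rule bessel_summable)+
  have GF: "G k = (\<xi> k ^ 4 - lam * \<xi> k ^ 2) * F k" for k
    using fg[of k] by (simp add: F_def G_def \<xi>_def ks_eigenvalue_def)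
  have F4: "summable (\<lambda>k. (\<xi> k ^ 4 * F k)\<^sup>2)"
  proof (rule summable_comparison_test')
    show "summable (\<lambda>k. 8 * (G k)\<^sup>2 + 32 * lam ^ 4 * (F k)\<^sup>2)"
      by (intro summable_add summable_mult F2 G2)
    show "norm ((\<xi> k ^ 4 * F k)\<^sup>2) \<le> 8 * (G k)\<^sup>2 + 32 * lam ^ 4 * (F k)\<^sup>2" for k
    proof (cases "\<xi> k ^ 2 \<ge> 2 * lam")
      case True
      have x4: "\<xi> k ^ 4 = \<xi> k ^ 2 * \<xi> k ^ 2" by (simp add: power2_eq_square power4_eq_xxxx)
      have "2 * lam * \<xi> k ^ 2 \<le> \<xi> k ^ 2 * \<xi> k ^ 2" using True by (intro mult_right_mono) auto
      then have "\<xi> k ^ 4 \<le> 2 * (\<xi> k ^ 4 - lam * \<xi> k ^ 2)" unfolding x4 by simp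
      then have "(\<xi> k ^ 4)\<^sup>2 \<le> (2 * (\<xi> k ^ 4 - lam * \<xi> k ^ 2))\<^sup>2" using xi by (intro power_mono) auto
      then have "(\<xi> k ^ 4 * F k)\<^sup>2 \<le> (2 * (\<xi> k ^ 4 - lam * \<xi> k ^ 2))\<^sup>2 * (F k)\<^sup>2"
        unfolding power_mult_distrib by (intro mult_right_mono) auto
      also have "\<dots> = 4 * (G k)\<^sup>2" unfolding GF by (simp only: power_mult_distrib) simp
      also have "\<dots> \<le> 8 * (G k)\<^sup>2 + 32 * lam ^ 4 * (F k)\<^sup>2" using lam by simp
      finally show ?thesis by simp
    next
      case False
      have "(\<xi> k ^ 4)\<^sup>2 = (\<xi> k ^ 2) ^ 4" by (simp add: power_mult[symmetric])
      also have "\<dots> \<le> (2 * lam) ^ 4" using False by (intro power_mono) auto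
      finally have "(\<xi> k ^ 4 * F k)\<^sup>2 \<le> (2 * lam) ^ 4 * (F k)\<^sup>2"
        unfolding power_mult_distrib by (intro mult_right_mono) auto
      also have "\<dots> \<le> 8 * (G k)\<^sup>2 + 32 * lam ^ 4 * (F k)\<^sup>2"
        using lam by (simp add: power_mult_distrib mult_right_mono add_increasing)
      finally show ?thesis by simp
    qed
  qed
  define c where "c k = cos_norm L k * F k" for k
  have sm: "summable (\<lambda>k. \<bar>c k\<bar> * freq L k ^ j)" if j: "j \<le> 3" for j
  proof (rule summable_comparison_test')
    show "summable (\<lambda>k. sqrt (2 / L) * (2 * (F k)\<^sup>2 + 2 * (\<xi> k ^ 4 * F k)\<^sup>2 + (1 / (1 + \<xi> k))\<^sup>2))"
      unfolding \<xi>_def by (intro summable_mult summable_add F2 F4[unfolded \<xi>_def] summable_inverse_freq L)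
    show "norm (\<bar>c k\<bar> * freq L k ^ j) \<le> sqrt (2 / L) * (2 * (F k)\<^sup>2 + 2 * (\<xi> k ^ 4 * F k)\<^sup>2 + (1 / (1 + \<xi> k))\<^sup>2)" for k
    proof -
      let ?r = "1 / (1 + \<xi> k)" and ?s = "\<bar>F k\<bar> + \<bar>\<xi> k ^ 4 * F k\<bar>"
      have "\<xi> k ^ j * (1 + \<xi> k) \<le> 2 * (1 + \<xi> k ^ 4)"
        using power_le_1_plus_power4[OF xi, of j k] power_le_1_plus_power4[OF xi, of "Suc j" k] j
        by (simp add: algebra_simps)
      then have "\<xi> k ^ j \<le> 2 * (1 + \<xi> k ^ 4) / (1 + \<xi> k)"
        using xi[of k] by (simp add: pos_le_divide_eq add_pos_nonneg)
      then have "\<bar>F k\<bar> * \<xi> k ^ j \<le> \<bar>F k\<bar> * (2 * (1 + \<xi> k ^ 4) / (1 + \<xi> k))"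
        by (intro mult_left_mono) auto
      also have "\<dots> = 2 * ?s * ?r" using xi[of k] by (simp add: abs_mult algebra_simps add_divide_distrib)
      also have "\<dots> \<le> ?s\<^sup>2 + ?r\<^sup>2" by (rule sum_squares_bound)
      also have "?s\<^sup>2 \<le> 2 * (F k)\<^sup>2 + 2 * (\<xi> k ^ 4 * F k)\<^sup>2"
        using sum_squares_bound[of "\<bar>F k\<bar>" "\<bar>\<xi> k ^ 4 * F k\<bar>"] by (simp add: power2_sum)
      finally have 1: "\<bar>F k\<bar> * \<xi> k ^ j \<le> 2 * (F k)\<^sup>2 + 2 * (\<xi> k ^ 4 * F k)\<^sup>2 + ?r\<^sup>2" by simp
      have "cos_norm L k \<le> sqrt (2 / L)"
        using L by (auto simp: cos_norm_def divide_right_mono)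
      then have "cos_norm L k * (\<bar>F k\<bar> * \<xi> k ^ j) \<le> sqrt (2 / L) * (2 * (F k)\<^sup>2 + 2 * (\<xi> k ^ 4 * F k)\<^sup>2 + ?r\<^sup>2)"
        using 1 xi[of k] L by (intro mult_mono) auto
      then show ?thesis
        using xi[of k] cos_norm_pos[OF L, of k] by (simp add: c_def abs_mult \<xi>_def mult.assoc)
    qed
  qed
  note cont = continuous_trig_series[OF L sm]
  note dr = trig_series_deriv[OF L sm sm]
  have sq: "square_integrable_on 0 L (trig_series L c j)" if "j \<le> 3" for j
    by (intro continuous_on_square_integrable_on cont that)
  have D0: "L2_class_on 0 L (trig_series L c 0) = f"
  proof (rule eqI)
    show "L2_class_on 0 L (trig_series L c 0) \<in> L2_on 0 L" by (intro L2_class_on_in sq) simp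
    fix k
    have "(\<lambda>i. LINT x:{0<..<L}|lborel. trig_term L c 0 i x * (cos_norm L k * cos (freq L k * x))) sums
        (LINT x:{0<..<L}|lborel. trig_series L c 0 x * (cos_norm L k * cos (freq L k * x)))"
      by (intro LINT_trig_series L sm square_integrable_on_cos) simp
    also have "(\<lambda>i. LINT x:{0<..<L}|lborel. trig_term L c 0 i x * (cos_norm L k * cos (freq L k * x))) =
        (\<lambda>i. if i = k then F i else 0)"
    proof
      fix i
      have "(LINT x:{0<..<L}|lborel. trig_term L c 0 i x * (cos_norm L k * cos (freq L k * x))) =
          (LINT x:{0<..<L}|lborel. F i * ((cos_norm L i * cos (freq L i * x)) * (cos_norm L k * cos (freq L k * x))))"
        by (simp add: trig_term_def c_def mult_ac)
      also have "\<dots> = F i * inner (cos_mode L i) (cos_mode L k)"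
        unfolding cos_mode_def by (subst inner_L2_class_on) (auto intro: square_integrable_on_cos)
      also have "\<dots> = (if i = k then F i else 0)" by (simp add: ortho)
      finally show "(LINT x:{0<..<L}|lborel. trig_term L c 0 i x * (cos_norm L k * cos (freq L k * x))) = (if i = k then F i else 0)" .
    qed
    finally have "(LINT x:{0<..<L}|lborel. trig_series L c 0 x * (cos_norm L k * cos (freq L k * x))) = F k"
      using sums_single[of k F] sums_unique2 by blast
    then show "inner (L2_class_on 0 L (trig_series L c 0)) (cos_mode L k) = inner f (cos_mode L k)"
      unfolding cos_mode_def[of L k]
      by (subst inner_L2_class_on) (auto intro: sq square_integrable_on_cos simp: F_def cos_mode_def)
  qed (rule f)
  have D2: "inner (L2_class_on 0 L (trig_series L c 2)) (cos_mode L k) = - (\<xi> k ^ 2) * F k" for k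
  proof -
    have s: "sin (freq L k * L) = 0" using freq_mult[OF L, of k] by (simp add: sin_npi)
    have 1: "(LINT x:{0<..<L}|lborel. trig_series L c (Suc 1) x * cos (freq L k * x)) =
        trig_series L c 1 L * cos (freq L k * L) - trig_series L c 1 0 * cos (freq L k * 0) -
        (LINT x:{0<..<L}|lborel. trig_series L c 1 x * (- freq L k * sin (freq L k * x)))"
      using L by (intro LINT_by_parts has_field_derivative_at_within[OF dr] cont)
        (auto intro!: derivative_eq_intros continuous_intros)
    have 2: "(LINT x:{0<..<L}|lborel. trig_series L c (Suc 0) x * sin (freq L k * x)) =
        trig_series L c 0 L * sin (freq L k * L) - trig_series L c 0 0 * sin (freq L k * 0) -
        (LINT x:{0<..<L}|lborel. trig_series L c 0 x * (freq L k * cos (freq L k * x)))"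
      using L by (intro LINT_by_parts has_field_derivative_at_within[OF dr] cont)
        (auto intro!: derivative_eq_intros continuous_intros)
    have "(LINT x:{0<..<L}|lborel. trig_series L c 2 x * cos (freq L k * x)) =
        - (freq L k ^ 2) * (LINT x:{0<..<L}|lborel. trig_series L c 0 x * cos (freq L k * x))"
      using 1 2 s trig_series_boundary[OF L, of 1 _ c]
      unfolding mult.left_commute[of "trig_series L c _ _"] set_integral_mult_right
      by (simp add: numeral_2_eq_2 power2_eq_square)
    moreover have "F k = cos_norm L k * (LINT x:{0<..<L}|lborel. trig_series L c 0 x * cos (freq L k * x))"
      using inner_cos_mode[OF sq[of 0], of k] by (simp add: D0 F_def)
    ultimately show ?thesis
      using inner_cos_mode[OF sq[of 2], of k] by (simp add: \<xi>_def)
  qed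
  define D where "D j = (if j \<le> 3 then trig_series L c j else (\<lambda>x. l2_rep g x - lam * trig_series L c 2 x))" for j :: nat
  have sq4: "square_integrable_on 0 L (D 4)"
    unfolding D_def by (auto intro!: square_integrable_on_diff square_integrable_on_rep square_integrable_on_scale sq)
  have D4: "L2_class_on 0 L (D 4) = synth (\<lambda>k. \<xi> k ^ 4 * F k)"
  proof (rule eqI)
    show "L2_class_on 0 L (D 4) \<in> L2_on 0 L" by (rule L2_class_on_in[OF sq4])
    show "synth (\<lambda>k. \<xi> k ^ 4 * F k) \<in> L2_on 0 L" by (rule synth_in[OF F4])
    have "L2_class_on 0 L (D 4) = g - lam *\<^sub>R L2_class_on 0 L (trig_series L c 2)"
      using g by (simp add: D_def L2_class_on_diff L2_class_on_scale square_integrable_on_rep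
          square_integrable_on_scale sq L2_on_iff)
    then show "inner (L2_class_on 0 L (D 4)) (cos_mode L k) = inner (synth (\<lambda>k. \<xi> k ^ 4 * F k)) (cos_mode L k)" for k
      by (simp add: inner_synth[OF F4] inner_diff_left D2 GF[unfolded G_def])
        (simp add: algebra_simps)
  qed
  have weak: "weak_deriv 0 L (D 3) (D 4)"
    unfolding weak_deriv_def
  proof (intro allI impI)
    fix \<psi> \<psi>' :: "real \<Rightarrow> real"
    assume psi: "\<forall>x. (\<psi> has_real_derivative \<psi>' x) (at x)" "continuous_on UNIV \<psi>'"
      and "\<exists>c d. 0 < c \<and> d < L \<and> (\<forall>x. x \<notin> {c..d} \<longrightarrow> \<psi> x = 0)"
    then have zero: "\<psi> 0 = 0" "\<psi> L = 0" by fastforce+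
    have psic: "continuous_on A \<psi>" for A
      by (rule DERIV_continuous_on[OF has_field_derivative_at_within]) (use psi in auto)
    have psi'c: "continuous_on A \<psi>'" for A by (rule continuous_on_subset[OF psi(2)]) simp
    have sqp: "square_integrable_on 0 L \<psi>" by (rule continuous_on_square_integrable_on[OF psic])
    have "(\<lambda>k. LINT x:{0<..<L}|lborel. trig_term L c 3 k x * \<psi>' x) sums (LINT x:{0<..<L}|lborel. trig_series L c 3 x * \<psi>' x)"
      by (intro LINT_trig_series L sm continuous_on_square_integrable_on psi'c) simp
    moreover have "(LINT x:{0<..<L}|lborel. trig_term L c 3 k x * \<psi>' x) =
        - inner ((\<xi> k ^ 4 * F k) *\<^sub>R cos_mode L k) (L2_class_on 0 L \<psi>)" for k
    proof -
      have "(LINT x:{0<..<L}|lborel. trig_term L c (Suc 3) k x * \<psi> x) =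
          trig_term L c 3 k L * \<psi> L - trig_term L c 3 k 0 * \<psi> 0 - (LINT x:{0<..<L}|lborel. trig_term L c 3 k x * \<psi>' x)"
      proof (rule LINT_by_parts)
        show "(trig_term L c 3 k has_real_derivative trig_term L c (Suc 3) k x) (at x within {0..L})" for x
          by (rule has_field_derivative_at_within[OF trig_term_deriv])
        show "(\<psi> has_real_derivative \<psi>' x) (at x within {0..L})" for x
          by (rule has_field_derivative_at_within) (use psi in blast)
      qed (use L in \<open>auto intro: continuous_trig_term psi'c\<close>)
      then have "(LINT x:{0<..<L}|lborel. trig_term L c 3 k x * \<psi>' x) = - (LINT x:{0<..<L}|lborel. trig_term L c 4 k x * \<psi> x)"
        by (simp add: zero)
      moreover have "trig_term L c 4 k x * \<psi> x = (\<xi> k ^ 4 * F k) * ((cos_norm L k * cos (freq L k * x)) * \<psi> x)" for x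
      proof -
        have "cos (freq L k * x + real 4 * (pi / 2)) = cos (freq L k * x)"
          using cos_periodic[of "freq L k * x"] by simp
        then show ?thesis unfolding trig_term_def by (simp add: c_def \<xi>_def)
      qed
      ultimately have "(LINT x:{0<..<L}|lborel. trig_term L c 3 k x * \<psi>' x) =
          - (LINT x:{0<..<L}|lborel. (\<xi> k ^ 4 * F k) * ((cos_norm L k * cos (freq L k * x)) * \<psi> x))"
        by (simp only:)
      also have "(LINT x:{0<..<L}|lborel. (\<xi> k ^ 4 * F k) * ((cos_norm L k * cos (freq L k * x)) * \<psi> x)) =
          inner ((\<xi> k ^ 4 * F k) *\<^sub>R cos_mode L k) (L2_class_on 0 L \<psi>)"
        unfolding cos_mode_def inner_scaleR_left
        by (subst inner_L2_class_on) (auto intro: square_integrable_on_cos sqp)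
      finally show ?thesis .
    qed
    ultimately have s1: "(\<lambda>k. - inner ((\<xi> k ^ 4 * F k) *\<^sub>R cos_mode L k) (L2_class_on 0 L \<psi>)) sums
        (LINT x:{0<..<L}|lborel. trig_series L c 3 x * \<psi>' x)" by simp
    have "(\<lambda>k. - inner ((\<xi> k ^ 4 * F k) *\<^sub>R cos_mode L k) (L2_class_on 0 L \<psi>)) sums
        - inner (synth (\<lambda>k. \<xi> k ^ 4 * F k)) (L2_class_on 0 L \<psi>)"
      by (intro sums_minus bounded_linear.sums[OF bounded_linear_inner_left] synth_sums F4)
    then have "(LINT x:{0<..<L}|lborel. trig_series L c 3 x * \<psi>' x) = - inner (L2_class_on 0 L (D 4)) (L2_class_on 0 L \<psi>)"
      unfolding D4 using s1 by (rule sums_unique2[symmetric])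
    also have "\<dots> = - (LINT x:{0<..<L}|lborel. D 4 x * \<psi> x)" by (simp add: inner_L2_class_on sq4 sqp)
    finally show "(LINT x:{0<..<L}|lborel. D 3 x * \<psi>' x) = - (LINT x:{0<..<L}|lborel. D 4 x * \<psi> x)"
      by (simp add: D_def)
  qed
  have "sobolev_derivs 0 L 4 D"
    unfolding sobolev_derivs_def
  proof (intro conjI allI impI)
    fix k :: nat
    show "square_integrable_on 0 L (D k)" if "k \<le> 4"
    proof (cases "k = 4")
      case False
      then show ?thesis using that sq[of k] by (simp add: D_def)
    qed (use sq4 in simp)
    show "weak_deriv 0 L (D k) (D (Suc k))" if "k < 4"
    proof (cases "k = 3")
      case False
      then have "weak_deriv 0 L (trig_series L c k) (trig_series L c (Suc k))"
        using that L by (intro C1_weak_deriv dr cont) auto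
      then show ?thesis using False that by (simp add: D_def)
    qed (use weak in simp)
  qed
  moreover have "g = L2_class_on 0 L (\<lambda>x. lam * D 2 x + D 4 x)"
    using g by (simp add: D_def L2_on_iff)
  ultimately show ?thesis
    unfolding ks_operator_def using trig_series_boundary[OF L, where c = c] D0 cont
    by (auto intro!: exI[of _ D] simp: D_def)
qed

lemma ks_diagonal_semigroup:
  assumes "L > 0"
  shows "diagonal_semigroup (L2_on 0 L) (cos_mode L) (ks_eigenvalue L lam) (lam\<^sup>2 / 4)"
  by (intro diagonal_semigroup.intro cos_modes_orthonormal_expansion diagonal_semigroup_axioms.intro
      ks_eigenvalue_ge assms) simp

abbreviation ks_flow :: "real \<Rightarrow> real \<Rightarrow> real \<Rightarrow> l2 \<Rightarrow> l2" where
  "ks_flow L lam \<equiv> diagonal_semigroup.S (cos_mode L) (ks_eigenvalue L lam)"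

lemma ks_semigroup_ks_flow:
  assumes L: "L > 0" and lam: "lam > 0"
  shows "ks_semigroup L lam (ks_flow L lam)"
proof -
  interpret diagonal_semigroup "L2_on 0 L" "cos_mode L" "ks_eigenvalue L lam" "lam\<^sup>2 / 4"
    by (rule ks_diagonal_semigroup[OF L])
  have "(f, g) \<in> generator (L2_on 0 L) S \<longleftrightarrow> (f, - g) \<in> ks_operator L lam" for f g
  proof
    assume "(f, g) \<in> generator (L2_on 0 L) S"
    then show "(f, - g) \<in> ks_operator L lam"
      unfolding generator_S
      by (intro ks_operator_from_coefficients L lam) (auto intro: subspace_neg[OF subspace_X])
  next
    assume "(f, - g) \<in> ks_operator L lam"
    note * = ks_operator_coefficients[OF L this]
    have "g \<in> L2_on 0 L" using subspace_neg[OF subspace_X *(2)] by simp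
    moreover have "inner g (cos_mode L k) = - ks_eigenvalue L lam k * inner f (cos_mode L k)" for k
      using *(3)[of k] by (simp add: minus_equation_iff)
    ultimately show "(f, g) \<in> generator (L2_on 0 L) S"
      using *(1) by (simp add: generator_S)
  qed
  then have "generator (L2_on 0 L) S = {(\<phi>, - \<psi>) |\<phi> \<psi>. (\<phi>, \<psi>) \<in> ks_operator L lam}"
    by force
  then show ?thesis by (simp add: ks_semigroup_def C0_semigroup_S)
qed

section \<open>A compactly supported function of Gevrey class\<close>

lemma power_mult_exp_neg_le_fact:
  fixes x :: real
  assumes "x \<ge> 0"
  shows "x ^ j * exp (- x) \<le> fact j"
proof -
  have "x ^ j / fact j = (\<Sum>n\<in>{j}. x ^ n / fact n)" by simp
  also have "\<dots> \<le> (\<Sum>n. x ^ n / fact n)"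
    using summable_exp_generic[of x] assms
    by (intro sum_le_suminf) (auto simp: field_simps)
  also have "\<dots> = exp x" by (simp add: exp_def field_simps)
  finally show ?thesis by (simp add: exp_minus field_simps)
qed

text \<open>The functions \<open>t\<^sup>-\<^sup>j exp (- 1 / t)\<close> are bounded by \<open>j!\<close>, and the derivative of each is a combination
  of two others.\<close>

definition flat_exp :: "nat \<Rightarrow> real \<Rightarrow> real" where
  "flat_exp j t = (if t > 0 then (1 / t) ^ j * exp (- (1 / t)) else 0)"

lemma flat_exp_bounds: "0 \<le> flat_exp j t" "flat_exp j t \<le> fact j"
  using power_mult_exp_neg_le_fact[of "1 / t" j] by (auto simp: flat_exp_def)

lemma flat_exp_deriv:
  "(flat_exp j has_real_derivative flat_exp (j + 2) t - real j * flat_exp (j + 1) t) (at t)"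
proof -
  consider "t > 0" | "t < 0" | "t = 0" by linarith
  then show ?thesis
  proof cases
    case 1
    have "((\<lambda>t. (1 / t) ^ j * exp (- (1 / t))) has_real_derivative
        flat_exp (j + 2) t - real j * flat_exp (j + 1) t) (at t)"
    proof (cases j)
      case 0
      show ?thesis unfolding 0 using 1
        by (auto intro!: derivative_eq_intros simp: flat_exp_def power2_eq_square)
    next
      case (Suc i)
      show ?thesis unfolding Suc using 1
        by (auto intro!: derivative_eq_intros simp: flat_exp_def field_simps power2_eq_square)
          (cases i; simp)
    qed
    then show ?thesis
      by (rule has_field_derivative_transform_within_open[where S = "{0<..}"])
        (use 1 in \<open>auto simp: flat_exp_def\<close>)
  next
    case 2
    have "((\<lambda>t. 0) has_real_derivative 0) (at t)" by simp
    then have "(flat_exp j has_real_derivative 0) (at t)"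
      by (rule has_field_derivative_transform_within_open[where S = "{..<0}"])
        (use 2 in \<open>auto simp: flat_exp_def\<close>)
    then show ?thesis using 2 by (simp add: flat_exp_def)
  next
    case 3
    have eq: "flat_exp j h / h = flat_exp (j + 1) h" for h
      by (simp add: flat_exp_def)
    have eq': "flat_exp (j + 1) h = h * flat_exp (j + 2) h" for h
      by (simp add: flat_exp_def)
    have "((\<lambda>h. flat_exp (j + 1) h) \<longlongrightarrow> 0) (at 0)"
    proof (rule tendsto_0_le[where f = "\<lambda>h. h" and K = "fact (j + 2)"])
      show "\<forall>\<^sub>F h in at 0. norm (flat_exp (j + 1) h) \<le> norm h * fact (j + 2)"
        unfolding eq' using flat_exp_bounds[of "j + 2"]
        by (intro always_eventually) (auto simp: abs_mult simp del: fact_Suc intro!: mult_left_mono)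
    qed (rule tendsto_ident_at)
    then have "((\<lambda>h. (flat_exp j (0 + h) - flat_exp j 0) / h) \<longlongrightarrow> 0) (at 0)"
      by (simp add: eq flat_exp_def[of j 0])
    then show ?thesis unfolding 3 by (simp add: DERIV_def flat_exp_def[of _ 0])
  qed
qed

text \<open>The \<open>n\<close>-th derivative of \<open>flat_exp j\<close>. Unfolding the innermost derivative first keeps the whole
  family in \<open>j\<close> in the recursion, so that the Gevrey bound follows by induction without a closed formula for the
  derivatives.\<close>

fun flat_exp_deriv_n :: "nat \<Rightarrow> nat \<Rightarrow> real \<Rightarrow> real" where
  "flat_exp_deriv_n 0 j t = flat_exp j t"
| "flat_exp_deriv_n (Suc n) j t = flat_exp_deriv_n n (j + 2) t - real j * flat_exp_deriv_n n (j + 1) t"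

lemma flat_exp_deriv_n_deriv:
  "(flat_exp_deriv_n n j has_real_derivative flat_exp_deriv_n (Suc n) j t) (at t)"
proof (induction n arbitrary: j)
  case 0
  have "flat_exp_deriv_n 0 j = flat_exp j" by (rule ext) simp
  then show ?case using flat_exp_deriv[of j t] by simp
next
  case (Suc n)
  have "((\<lambda>t. flat_exp_deriv_n n (j + 2) t - real j * flat_exp_deriv_n n (j + 1) t) has_real_derivative
      flat_exp_deriv_n (Suc n) (j + 2) t - real j * flat_exp_deriv_n (Suc n) (j + 1) t) (at t)"
    by (intro derivative_intros DERIV_cmult Suc.IH)
  then show ?case by simp
qed

lemma flat_exp_deriv_n_bound: "\<bar>flat_exp_deriv_n n j t\<bar> \<le> 2 ^ n * fact (j + 2 * n)"
proof (induction n arbitrary: j)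
  case 0
  then show ?case using flat_exp_bounds[of j t] by simp
next
  case (Suc n)
  have "\<bar>flat_exp_deriv_n (Suc n) j t\<bar> \<le> \<bar>flat_exp_deriv_n n (j + 2) t\<bar> + real j * \<bar>flat_exp_deriv_n n (j + 1) t\<bar>"
    using abs_triangle_ineq4[of "flat_exp_deriv_n n (j + 2) t" "real j * flat_exp_deriv_n n (j + 1) t"]
    by (simp add: abs_mult)
  also have "\<dots> \<le> 2 ^ n * fact (j + 2 + 2 * n) + real j * (2 ^ n * fact (j + 1 + 2 * n))"
    using Suc.IH[of "j + 2"] Suc.IH[of "j + 1"] by (intro add_mono mult_left_mono) auto
  also have "real j * (2 ^ n * fact (j + 1 + 2 * n)) \<le> 2 ^ n * fact (j + 2 + 2 * n)"
  proof -
    have "real j * fact (j + 1 + 2 * n) \<le> real (j + 2 + 2 * n) * fact (j + 1 + 2 * n)"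
      by (intro mult_right_mono) auto
    also have "\<dots> = fact (j + 2 + 2 * n)"
      using fact_Suc[of "j + 1 + 2 * n", where 'a = real] by (simp add: add.commute)
    finally show ?thesis by (simp add: mult.left_commute)
  qed
  finally show ?case by (simp add: algebra_simps)
qed

lemma flat_exp_deriv_n_nonpos: "t \<le> 0 \<Longrightarrow> flat_exp_deriv_n n j t = 0"
  by (induction n arbitrary: j) (auto simp: flat_exp_def)

text \<open>The \<open>n\<close>-th derivative of a product of an \<open>i\<close>-th and a \<open>j\<close>-th derivative: the Leibniz rule written as a
  recursion, so that no binomial coefficients occur.\<close>

fun bump_pair :: "real \<Rightarrow> real \<Rightarrow> nat \<Rightarrow> nat \<Rightarrow> nat \<Rightarrow> real \<Rightarrow> real" where
  "bump_pair a b 0 i j t = flat_exp_deriv_n i 0 (t - a) * ((-1) ^ j * flat_exp_deriv_n j 0 (b - t))"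
| "bump_pair a b (Suc n) i j t = bump_pair a b n (i + 1) j t + bump_pair a b n i (j + 1) t"

definition bump :: "real \<Rightarrow> real \<Rightarrow> nat \<Rightarrow> real \<Rightarrow> real" where
  "bump a b n = bump_pair a b n 0 0"

lemma bump_pair_deriv:
  "(bump_pair a b n i j has_real_derivative bump_pair a b (Suc n) i j t) (at t)"
proof (induction n arbitrary: i j)
  case 0
  have 1: "((\<lambda>t. flat_exp_deriv_n i 0 (t - a)) has_real_derivative flat_exp_deriv_n (Suc i) 0 (t - a) * 1) (at t)"
    by (rule DERIV_chain2[OF flat_exp_deriv_n_deriv]) (auto intro!: derivative_eq_intros)
  have 2: "((\<lambda>t. flat_exp_deriv_n j 0 (b - t)) has_real_derivative flat_exp_deriv_n (Suc j) 0 (b - t) * (-1)) (at t)"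
    by (rule DERIV_chain2[OF flat_exp_deriv_n_deriv]) (auto intro!: derivative_eq_intros)
  have "((\<lambda>t. flat_exp_deriv_n i 0 (t - a) * ((-1) ^ j * flat_exp_deriv_n j 0 (b - t))) has_real_derivative
     bump_pair a b (Suc 0) i j t) (at t)"
    by (rule DERIV_cong[OF DERIV_mult[OF 1 DERIV_cmult[OF 2]]])
      (simp del: flat_exp_deriv_n.simps add: algebra_simps)
  then show ?case by (simp del: flat_exp_deriv_n.simps)
next
  case (Suc n)
  have "((\<lambda>t. bump_pair a b n (i + 1) j t + bump_pair a b n i (j + 1) t) has_real_derivative
      bump_pair a b (Suc n) (i + 1) j t + bump_pair a b (Suc n) i (j + 1) t) (at t)"
    by (intro derivative_intros Suc.IH)
  then show ?case by simp
qed

lemma bump_pair_bound: "\<bar>bump_pair a b n i j t\<bar> \<le> 2 ^ n * (2 ^ (i + j + n) * fact (2 * (i + j + n)))"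
proof (induction n arbitrary: i j)
  case 0
  have "\<bar>bump_pair a b 0 i j t\<bar> = \<bar>flat_exp_deriv_n i 0 (t - a)\<bar> * \<bar>flat_exp_deriv_n j 0 (b - t)\<bar>"
    by (simp add: abs_mult)
  also have "\<dots> \<le> (2 ^ i * fact (2 * i)) * (2 ^ j * fact (2 * j))"
    using flat_exp_deriv_n_bound[of i 0 "t - a"] flat_exp_deriv_n_bound[of j 0 "b - t"]
    by (intro mult_mono) auto
  also have "\<dots> = 2 ^ (i + j) * (fact (2 * i) * fact (2 * j))" by (simp add: power_add)
  also have "\<dots> \<le> 2 ^ (i + j) * fact (2 * i + 2 * j)"
  proof (intro mult_left_mono)
    have "fact (2 * i) * fact (2 * j) \<le> (fact (2 * i + 2 * j) :: nat)"
      using fact_fact_dvd_fact[of "2 * i" "2 * j", where 'a = nat] by (intro dvd_imp_le) auto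
    then have "of_nat (fact (2 * i) * fact (2 * j)) \<le> (of_nat (fact (2 * i + 2 * j)) :: real)"
      by (simp only: of_nat_le_iff)
    then show "fact (2 * i) * fact (2 * j) \<le> (fact (2 * i + 2 * j) :: real)" by simp
  qed auto
  finally show ?case by (simp add: algebra_simps)
next
  case (Suc n)
  have "\<bar>bump_pair a b (Suc n) i j t\<bar> \<le> \<bar>bump_pair a b n (i + 1) j t\<bar> + \<bar>bump_pair a b n i (j + 1) t\<bar>"
    by simp
  also have "\<dots> \<le> 2 ^ n * (2 ^ (i + 1 + j + n) * fact (2 * (i + 1 + j + n))) +
      2 ^ n * (2 ^ (i + (j + 1) + n) * fact (2 * (i + (j + 1) + n)))"
    by (intro add_mono Suc.IH)
  also have "\<dots> = 2 ^ Suc n * (2 ^ (i + j + Suc n) * fact (2 * (i + j + Suc n)))" by simp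
  finally show ?case .
qed

lemma bump_deriv: "(bump a b n has_real_derivative bump a b (Suc n) t) (at t)"
  unfolding bump_def by (rule bump_pair_deriv)

text \<open>Gevrey order two. Any order below four would suffice, as half as many derivatives of the bump as
  powers of \<open>\<kappa>\<close> compete with \<open>(2 m)!\<close>.\<close>

lemma bump_bound: "\<bar>bump a b n t\<bar> \<le> 4 ^ n * fact (2 * n)"
  using bump_pair_bound[of a b n 0 0 t]
  by (simp add: bump_def mult.assoc[symmetric] power_mult_distrib[symmetric])

lemma bump_pair_outside: "t \<le> a \<or> t \<ge> b \<Longrightarrow> bump_pair a b n i j t = 0"
  by (induction n arbitrary: i j) (auto simp: flat_exp_deriv_n_nonpos)

lemma bump_outside: "t \<le> a \<or> t \<ge> b \<Longrightarrow> bump a b n t = 0"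
  unfolding bump_def by (rule bump_pair_outside)

lemma bump_0: "bump a b 0 t = flat_exp 0 (t - a) * flat_exp 0 (b - t)"
  by (simp add: bump_def)

lemma bump_nonneg: "0 \<le> bump a b 0 t"
  by (simp add: bump_0 flat_exp_bounds)

lemma bump_lower:
  assumes "d > 0" "a + d \<le> t" "t \<le> b - d"
  shows "exp (- (2 / d)) \<le> bump a b 0 t"
proof -
  have *: "exp (- (1 / d)) \<le> flat_exp 0 s" if "s \<ge> d" for s
    using that assms(1) by (simp add: flat_exp_def frac_le)
  have "exp (- (2 / d)) = exp (- (1 / d)) * exp (- (1 / d))" by (simp add: exp_add[symmetric])
  also have "\<dots> \<le> bump a b 0 t"
    unfolding bump_0 using assms by (intro mult_mono *) (auto simp: flat_exp_bounds)
  finally show ?thesis .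
qed

section \<open>Flat controls\<close>

text \<open>With \<open>\<mu> = \<kappa> (\<kappa> - \<lambda>)\<close>, multiplication of \<open>(\<lambda> - \<kappa>) A(\<mu>) + B(\<mu>)\<close> by \<open>\<kappa>\<close> replaces \<open>(A, B)\<close> by
  \<open>(- B, \<lambda> B - \<mu> A)\<close>. Starting from \<open>\<kappa>\<^sup>0\<close>, that is \<open>(0, 1)\<close>, the polynomials \<open>B\<^sub>m\<close> satisfy
  \<open>B\<^sub>m\<^sub>+\<^sub>2 = \<lambda> B\<^sub>m\<^sub>+\<^sub>1 + \<mu> B\<^sub>m\<close> and \<open>A\<^sub>m\<^sub>+\<^sub>1 = - B\<^sub>m\<close>. In the time domain \<open>\<mu>\<close> acts as minus the derivative, so
  \<open>flat_control lam th m 0\<close> has transform \<open>B\<^sub>m M\<close>, and the index \<open>n\<close> counts further derivatives.\<close>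

fun flat_control :: "real \<Rightarrow> (nat \<Rightarrow> real \<Rightarrow> real) \<Rightarrow> nat \<Rightarrow> nat \<Rightarrow> real \<Rightarrow> real" where
  "flat_control lam th 0 n t = th n t"
| "flat_control lam th (Suc 0) n t = lam * th n t"
| "flat_control lam th (Suc (Suc m)) n t =
    lam * flat_control lam th (Suc m) n t - flat_control lam th m (Suc n) t"

lemma flat_control_deriv:
  assumes th: "\<And>n t. (th n has_real_derivative th (Suc n) t) (at t)"
  shows "(flat_control lam th m n has_real_derivative flat_control lam th m (Suc n) t) (at t)"
proof (induction m arbitrary: n rule: induct_nat_012)
  case 0
  have "flat_control lam th 0 n = th n" by (rule ext) simp
  then show ?case using th by simp
next
  case 1
  have "((\<lambda>t. lam * th n t) has_real_derivative lam * th (Suc n) t) (at t)"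
    by (intro DERIV_cmult th)
  moreover have "flat_control lam th (Suc 0) n = (\<lambda>t. lam * th n t)" by (rule ext) simp
  ultimately show ?case by simp
next
  case (ge2 m)
  have "((\<lambda>t. lam * flat_control lam th (Suc m) n t - flat_control lam th m (Suc n) t) has_real_derivative
      lam * flat_control lam th (Suc m) (Suc n) t - flat_control lam th m (Suc (Suc n)) t) (at t)"
    by (intro derivative_intros DERIV_cmult ge2)
  moreover have "flat_control lam th (Suc (Suc m)) n =
      (\<lambda>t. lam * flat_control lam th (Suc m) n t - flat_control lam th m (Suc n) t)"
    by (rule ext) simp
  ultimately show ?case by simp
qed

lemma flat_control_outside:
  assumes "\<And>n. th n t = 0"
  shows "flat_control lam th m n t = 0"
  by (induction m arbitrary: n rule: induct_nat_012) (auto simp: assms)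

text \<open>Only every second step of the recursion costs a derivative.\<close>

lemma flat_control_bound:
  assumes lam: "lam \<ge> 0" and th: "\<And>n t. \<bar>th n t\<bar> \<le> K n" and K: "mono K"
  shows "\<bar>flat_control lam th m n t\<bar> \<le> (lam + 1) ^ m * K (n + m div 2)"
proof (induction m arbitrary: n rule: induct_nat_012)
  case 0
  then show ?case using th[of n t] by simp
next
  case 1
  have "lam * \<bar>th n t\<bar> \<le> (lam + 1) * K n" using lam th by (intro mult_mono) auto
  then show ?case using lam by (simp add: abs_mult)
next
  case (ge2 m)
  let ?K = "K (n + Suc (Suc m) div 2)"
  have K0: "0 \<le> K n" for n using th[of n t] by (meson abs_ge_zero order_trans)
  have "\<bar>flat_control lam th (Suc m) n t\<bar> \<le> (lam + 1) ^ Suc m * K (n + Suc m div 2)" by (rule ge2)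
  also have "\<dots> \<le> (lam + 1) ^ Suc m * ?K" using lam by (intro mult_left_mono monoD[OF K]) auto
  finally have A: "\<bar>flat_control lam th (Suc m) n t\<bar> \<le> (lam + 1) ^ Suc m * ?K" .
  have B: "\<bar>flat_control lam th m (Suc n) t\<bar> \<le> (lam + 1) ^ m * ?K" using ge2(1)[of "Suc n"] by simp
  have "\<bar>flat_control lam th (Suc (Suc m)) n t\<bar> \<le>
      lam * \<bar>flat_control lam th (Suc m) n t\<bar> + \<bar>flat_control lam th m (Suc n) t\<bar>"
    using abs_triangle_ineq4[of "lam * flat_control lam th (Suc m) n t"] lam by (simp add: abs_mult)
  also have "\<dots> \<le> lam * ((lam + 1) ^ Suc m * ?K) + (lam + 1) ^ m * ?K"
    by (rule add_mono[OF mult_left_mono[OF A lam] B])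
  also have "\<dots> = (lam + 1) ^ m * (lam * (lam + 1) + 1) * ?K"
    by (simp add: algebra_simps)
  also have "\<dots> \<le> (lam + 1) ^ m * (lam + 1) ^ 2 * ?K"
    using lam K0 by (intro mult_right_mono mult_left_mono) (auto simp: power2_eq_square algebra_simps)
  also have "\<dots> = (lam + 1) ^ Suc (Suc m) * ?K"
    by (simp add: power2_eq_square algebra_simps)
  finally show ?case .
qed

lemma summable_factorial_ratio:
  fixes Q :: real
  assumes "Q > 0"
  shows "summable (\<lambda>m. Q ^ m * fact (m + 2) / fact (2 * m))"
proof (rule summable_ratio_test[where c = "1 / 2" and N = "nat \<lceil>Q\<rceil> + 3"])
  fix m assume m: "m \<ge> nat \<lceil>Q\<rceil> + 3"
  have Q: "Q \<le> real m" using m by linarith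
  have "2 * (Q * (m + 3)) \<le> (2 * real m + 1) * (2 * real m + 2)"
  proof -
    have "Q * (real m + 3) \<le> real m * (real m + real m)" using Q m assms by (intro mult_mono) auto
    then show ?thesis by (simp add: algebra_simps)
  qed
  then have *: "Q * (m + 3) / ((2 * real m + 1) * (2 * real m + 2)) \<le> 1 / 2"
    by (simp add: divide_simps)
  have "Q ^ Suc m * fact (Suc m + 2) / fact (2 * Suc m) =
      Q * (m + 3) / ((2 * real m + 1) * (2 * real m + 2)) * (Q ^ m * fact (m + 2) / fact (2 * m))"
  proof -
    have "fact (2 * Suc m) = (2 * real m + 2) * ((2 * real m + 1) * fact (2 * m))"
      by (simp add: algebra_simps)
    moreover have "fact (Suc m + 2) = (real m + 3) * fact (m + 2)" by (simp add: algebra_simps)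
    ultimately show ?thesis by (simp add: mult_ac)
  qed
  also have "\<dots> \<le> 1 / 2 * (Q ^ m * fact (m + 2) / fact (2 * m))"
    using assms by (intro mult_right_mono *) auto
  finally show "norm (Q ^ Suc m * fact (Suc m + 2) / fact (2 * Suc m)) \<le> 1 / 2 * norm (Q ^ m * fact (m + 2) / fact (2 * m))"
    using assms by simp
qed simp

lemma gevrey_const_mono: "mono (\<lambda>n. 4 ^ n * fact (2 * n) :: real)"
  by (intro monoI mult_mono power_increasing fact_mono) auto

locale flat_series =
  fixes lam a b C R :: real and h :: "nat \<Rightarrow> real"
  assumes lam: "lam \<ge> 0" and R: "R > 0" and C: "C \<ge> 0"
    and h: "\<And>m. \<bar>h m\<bar> \<le> C * R ^ m / fact (2 * m)"
begin

abbreviation w :: "nat \<Rightarrow> nat \<Rightarrow> real \<Rightarrow> real" where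
  "w \<equiv> flat_control lam (bump a b)"

definition majorant :: "nat \<Rightarrow> real" where
  "majorant m = C * 4 * ((R * (lam + 1) * 4) ^ m * fact (m + 2) / fact (2 * m))"

lemma summable_majorant: "summable majorant"
  unfolding majorant_def using lam R by (intro summable_mult summable_factorial_ratio) simp

lemma term_bound:
  assumes "n \<le> 1"
  shows "\<bar>h m * w m n t\<bar> \<le> majorant m"
proof -
  have "\<bar>w m n t\<bar> \<le> (lam + 1) ^ m * (4 ^ (n + m div 2) * fact (2 * (n + m div 2)))"
    by (rule flat_control_bound[OF lam bump_bound gevrey_const_mono])
  also have "\<dots> \<le> (lam + 1) ^ m * (4 ^ (m + 1) * fact (m + 2))"
    using assms lam by (intro mult_mono mult_left_mono power_increasing fact_mono) auto
  finally have "\<bar>h m\<bar> * \<bar>w m n t\<bar> \<le> (C * R ^ m / fact (2 * m)) * ((lam + 1) ^ m * (4 ^ (m + 1) * fact (m + 2)))"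
    using C R by (intro mult_mono h) auto
  moreover have "(R * (lam + 1) * 4) ^ m = R ^ m * (lam + 1) ^ m * 4 ^ m"
    by (simp only: power_mult_distrib)
  ultimately show ?thesis by (simp add: majorant_def abs_mult mult_ac)
qed

definition u :: "nat \<Rightarrow> real \<Rightarrow> real" where
  "u n t = (\<Sum>m. h m * w m n t)"

lemma summable_u: "n \<le> 1 \<Longrightarrow> summable (\<lambda>m. h m * w m n t)"
  by (rule summable_comparison_test'[OF summable_majorant]) (use term_bound in auto)

lemma uniform_u: "n \<le> 1 \<Longrightarrow> uniform_limit UNIV (\<lambda>N t. \<Sum>m<N. h m * w m n t) (u n) sequentially"
  unfolding u_def[abs_def] by (rule Weierstrass_m_test[OF _ summable_majorant]) (use term_bound in auto)

lemma w_deriv: "(w m n has_real_derivative w m (Suc n) t) (at t)"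
  by (rule flat_control_deriv) (rule bump_deriv)

lemma continuous_w: "continuous_on A (w m n)"
  by (rule DERIV_continuous_on[OF has_field_derivative_at_within[OF w_deriv]])

lemma continuous_u: "n \<le> 1 \<Longrightarrow> continuous_on A (u n)"
  by (rule continuous_on_subset[OF uniform_limit_theorem[OF _ uniform_u]])
    (auto intro!: always_eventually continuous_intros continuous_w)

lemma u_deriv: "(u 0 has_real_derivative u 1 t) (at t)"
proof -
  have "((\<lambda>t. \<Sum>m. h m * w m 0 t) has_real_derivative (\<Sum>m. h m * w m 1 t)) (at t)"
  proof (rule has_field_derivative_series'(2)[where S = UNIV and ?x0.0 = 0 and x = t
        and f = "\<lambda>m t. h m * w m 0 t" and f' = "\<lambda>m t. h m * w m 1 t"])
    show "((\<lambda>t. h m * w m 0 t) has_real_derivative h m * w m 1 t) (at t within UNIV)" for m t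
      using w_deriv[of m 0 t] by (auto intro!: DERIV_cmult)
    show "uniformly_convergent_on UNIV (\<lambda>N t. \<Sum>m<N. h m * w m 1 t)"
      using uniform_u[of 1] by (auto simp: uniformly_convergent_on_def)
    show "summable (\<lambda>m. h m * w m 0 0)" by (rule summable_u) simp
  qed auto
  then show ?thesis by (simp add: u_def[abs_def])
qed

lemma u_outside: "t \<le> a \<or> t \<ge> b \<Longrightarrow> u n t = 0"
  by (simp add: u_def flat_control_outside bump_outside)

end

section \<open>Exponential moments of flat controls\<close>

definition exp_moment :: "real \<Rightarrow> real \<Rightarrow> (real \<Rightarrow> real) \<Rightarrow> real" where
  "exp_moment T \<mu> f = (LINT t:{0<..<T}|lborel. f t * exp (\<mu> * t))"

lemma exp_moment_deriv:
  assumes "T > 0" "\<And>t. (f has_real_derivative f' t) (at t)" "\<And>A. continuous_on A f'" "f 0 = 0" "f T = 0"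
  shows "exp_moment T \<mu> f' = - \<mu> * exp_moment T \<mu> f"
proof -
  have "(LINT t:{0<..<T}|lborel. f' t * exp (\<mu> * t)) = f T * exp (\<mu> * T) - f 0 * exp (\<mu> * 0) -
      (LINT t:{0<..<T}|lborel. f t * (\<mu> * exp (\<mu> * t)))"
    by (rule LINT_by_parts)
      (use assms in \<open>auto intro!: has_field_derivative_at_within[OF assms(2)] derivative_eq_intros continuous_intros\<close>)
  then show ?thesis
    unfolding mult.left_commute[of "f _"] set_integral_mult_right by (simp add: exp_moment_def assms)
qed

lemma exp_moment_cmult: "exp_moment T \<mu> (\<lambda>t. c * f t) = c * exp_moment T \<mu> f"
  by (simp add: exp_moment_def mult.assoc)

lemma exp_moment_diff:
  assumes "continuous_on {0..T} f" "continuous_on {0..T} g"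
  shows "exp_moment T \<mu> (\<lambda>t. f t - g t) = exp_moment T \<mu> f - exp_moment T \<mu> g"
  unfolding exp_moment_def left_diff_distrib
  by (intro set_integral_diff(2) set_integrable_open_continuous continuous_intros assms)

text \<open>The bump function is nonnegative, so its transform is bounded below by its mass on the middle part of the
  support, uniformly over exponents bounded below.\<close>

lemma bump_moment_lower:
  assumes d: "d > 0" "0 < a + d" "a + d \<le> b - d" "b - d < T" and mu: "- \<omega> \<le> \<mu>" and om: "\<omega> \<ge> 0"
  shows "exp (- (2 / d)) * exp (- \<omega> * T) * (b - a - 2 * d) \<le> exp_moment T \<mu> (bump a b 0)"
proof -
  let ?c = "exp (- (2 / d)) * exp (- \<omega> * T)"
  have bc: "continuous_on A (bump a b 0)" for A
    by (rule DERIV_continuous_on[OF has_field_derivative_at_within[OF bump_deriv]])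
  have "?c * (b - a - 2 * d) = (LINT t|lborel. ?c * indicator {a + d..b - d} t)"
    using d by simp
  also have "\<dots> \<le> (LINT t|lborel. indicator {0<..<T} t *\<^sub>R (bump a b 0 t * exp (\<mu> * t)))"
  proof (rule integral_mono)
    have "integrable lborel (indicator {a + d..b - d} :: real \<Rightarrow> real)"
      by (rule integrable_real_indicator[OF _ emeasure_compact_finite[OF compact_Icc]]) simp
    then show "integrable lborel (\<lambda>t. ?c * indicator {a + d..b - d} t)"
      by (rule integrable_mult_right)
    show "integrable lborel (\<lambda>t. indicator {0<..<T} t *\<^sub>R (bump a b 0 t * exp (\<mu> * t)))"
      unfolding set_integrable_def[symmetric] by (intro set_integrable_open_continuous continuous_intros bc)
    show "?c * indicator {a + d..b - d} t \<le> indicator {0<..<T} t *\<^sub>R (bump a b 0 t * exp (\<mu> * t))" for t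
    proof (cases "t \<in> {a + d..b - d}")
      case True
      then have t: "0 < t" "t < T" using d by auto
      have "- \<omega> * T \<le> - \<omega> * t" using om t by (simp add: mult_left_mono)
      also have "\<dots> \<le> \<mu> * t" using mu t by (intro mult_right_mono) auto
      finally have "?c \<le> bump a b 0 t * exp (\<mu> * t)"
        using True d by (intro mult_mono bump_lower bump_nonneg) auto
      then show ?thesis using True t by simp
    qed (use bump_nonneg in \<open>auto simp: indicator_def\<close>)
  qed
  finally show ?thesis by (simp add: exp_moment_def set_lebesgue_integral_def)
qed

lemma flat_control_moment_step:
  fixes lam a b T :: real
  assumes T: "T > 0" and ab: "0 \<le> a" "b \<le> T"
  defines "w \<equiv> flat_control lam (bump a b)"
  shows "exp_moment T \<mu> (w (Suc 0) 0) = lam * exp_moment T \<mu> (w 0 0)"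
    and "exp_moment T \<mu> (w (Suc (Suc m)) 0) = lam * exp_moment T \<mu> (w (Suc m) 0) + \<mu> * exp_moment T \<mu> (w m 0)"
proof -
  have wd: "(w m n has_real_derivative w m (Suc n) t) (at t)" for m n t
    unfolding w_def by (rule flat_control_deriv) (rule bump_deriv)
  have wc: "continuous_on A (w m n)" for A m n
    by (rule DERIV_continuous_on[OF has_field_derivative_at_within[OF wd]])
  have w0: "w m n 0 = 0" "w m n T = 0" for m n
    unfolding w_def using ab by (auto intro!: flat_control_outside bump_outside)
  have "w (Suc 0) 0 = (\<lambda>t. lam * w 0 0 t)" by (rule ext) (simp add: w_def)
  then show "exp_moment T \<mu> (w (Suc 0) 0) = lam * exp_moment T \<mu> (w 0 0)"
    by (simp add: exp_moment_cmult)
  have "w (Suc (Suc m)) 0 = (\<lambda>t. lam * w (Suc m) 0 t - w m 1 t)" by (rule ext) (simp add: w_def)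
  then have "exp_moment T \<mu> (w (Suc (Suc m)) 0) = lam * exp_moment T \<mu> (w (Suc m) 0) - exp_moment T \<mu> (w m 1)"
    by (simp add: exp_moment_cmult exp_moment_diff wc continuous_intros)
  moreover have "exp_moment T \<mu> (w m 1) = - \<mu> * exp_moment T \<mu> (w m 0)"
    by (rule exp_moment_deriv[OF T _ wc w0]) (use wd in simp)
  ultimately show "exp_moment T \<mu> (w (Suc (Suc m)) 0) = lam * exp_moment T \<mu> (w (Suc m) 0) + \<mu> * exp_moment T \<mu> (w m 0)"
    by simp
qed

text \<open>The identity \<open>\<kappa>\<^sup>m\<^sup>+\<^sup>1 = (\<lambda> - \<kappa>) A\<^sub>m\<^sub>+\<^sub>1(\<mu>) + B\<^sub>m\<^sub>+\<^sub>1(\<mu>)\<close> with \<open>A\<^sub>m\<^sub>+\<^sub>1 = - B\<^sub>m\<close>, multiplied by the transform of the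
  bump function.\<close>

lemma flat_control_moment_power:
  fixes V :: "nat \<Rightarrow> real"
  assumes V: "V (Suc 0) = lam * V 0" "\<And>m. V (Suc (Suc m)) = lam * V (Suc m) + \<mu> * V m"
    and mu: "\<mu> = \<kappa> * (\<kappa> - lam)"
  shows "\<kappa> ^ Suc m * V 0 = V (Suc m) - (lam - \<kappa>) * V m"
proof (induction m)
  case 0
  then show ?case by (simp add: V algebra_simps)
next
  case (Suc m)
  have "\<kappa> ^ Suc (Suc m) * V 0 = \<kappa> * (V (Suc m) - (lam - \<kappa>) * V m)"
    using Suc.IH by simp
  also have "\<dots> = V (Suc (Suc m)) - (lam - \<kappa>) * V (Suc m)"
    unfolding V(2) mu by (simp add: algebra_simps)
  finally show ?case .
qed

context flat_series
begin

lemma exp_moment_u_sums: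
  assumes "T > 0"
  shows "(\<lambda>m. h m * exp_moment T \<mu> (w m 0)) sums exp_moment T \<mu> (u 0)"
proof -
  have "(\<lambda>m. LINT t:{0<..<T}|lborel. (h m * w m 0 t) * exp (\<mu> * t)) sums exp_moment T \<mu> (u 0)"
    unfolding exp_moment_def u_def
    by (rule LINT_uniform_series[where M = majorant])
      (auto intro!: term_bound summable_majorant continuous_on_square_integrable_on continuous_intros continuous_w)
  then show ?thesis by (simp add: exp_moment_def mult.assoc)
qed

lemma u_bound: "n \<le> 1 \<Longrightarrow> \<bar>u n t\<bar> \<le> suminf majorant"
  unfolding u_def
  by (rule order_trans[OF summable_rabs suminf_le])
    (auto intro!: term_bound summable_majorant summable_comparison_test'[OF summable_majorant])

lemma u_has_H1_deriv: "T > 0 \<Longrightarrow> has_H1_deriv 0 T (u 0) (u 1)"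
  unfolding has_H1_deriv_def sobolev_derivs_def
  by (intro conjI continuous_u exI[of _ "\<lambda>k. if k = 0 then u 0 else u 1"])
    (auto intro!: continuous_on_square_integrable_on continuous_u C1_weak_deriv u_deriv[simplified])

end

text \<open>The first control carries the polynomials \<open>A\<^sub>m = - B\<^sub>m\<^sub>-\<^sub>1\<close>, which explains the shifted and negated
  coefficients; together the two controls have the transform \<open>(\<Sum>\<^sub>m g\<^sub>m \<kappa>\<^sup>m) M\<close>.\<close>

lemma flat_series_pair_moment:
  fixes g :: "nat \<Rightarrow> real"
  assumes T: "T > 0" and ab: "0 \<le> a" "b \<le> T" and lam: "lam \<ge> 0" and R: "R > 0" and C: "C \<ge> 0"
    and g: "\<And>m. \<bar>g m\<bar> \<le> C * R ^ m / fact (2 * m)" and mu: "\<mu> = \<kappa> * (\<kappa> - lam)"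
  shows "flat_series lam C R g" "flat_series lam (C * R) R (\<lambda>m. - g (Suc m))"
    and "(\<lambda>m. g m * \<kappa> ^ m * exp_moment T \<mu> (bump a b 0)) sums
      ((lam - \<kappa>) * exp_moment T \<mu> (flat_series.u lam a b (\<lambda>m. - g (Suc m)) 0) +
        exp_moment T \<mu> (flat_series.u lam a b g 0))"
proof -
  show fs2: "flat_series lam C R g" by (rule flat_series.intro) (fact lam R C g)+
  have "\<bar>- g (Suc m)\<bar> \<le> C * R * R ^ m / fact (2 * m)" for m
  proof -
    have "\<bar>- g (Suc m)\<bar> \<le> C * R ^ Suc m / fact (2 * Suc m)" using g[of "Suc m"] by simp
    also have "\<dots> \<le> C * R ^ Suc m / fact (2 * m)"
      using C R by (intro divide_left_mono fact_mono mult_nonneg_nonneg) auto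
    finally show ?thesis by (simp add: mult.assoc)
  qed
  then show fs1: "flat_series lam (C * R) R (\<lambda>m. - g (Suc m))"
    using C R by (intro flat_series.intro lam R) auto
  define V where "V m = exp_moment T \<mu> (flat_control lam (bump a b) m 0)" for m
  have "flat_control lam (bump a b) 0 0 = bump a b 0" by (rule ext) simp
  then have V0: "V 0 = exp_moment T \<mu> (bump a b 0)" by (simp add: V_def)
  have V: "V (Suc 0) = lam * V 0" "V (Suc (Suc m)) = lam * V (Suc m) + \<mu> * V m" for m
    unfolding V_def by (rule flat_control_moment_step[OF T ab])+
  have pw: "\<kappa> ^ Suc m * V 0 = V (Suc m) - (lam - \<kappa>) * V m" for m
    by (rule flat_control_moment_power[OF V mu])
  let ?U1 = "exp_moment T \<mu> (flat_series.u lam a b (\<lambda>m. - g (Suc m)) 0)"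
  let ?U2 = "exp_moment T \<mu> (flat_series.u lam a b g 0)"
  have "(\<lambda>m. g m * V m) sums ?U2"
    unfolding V_def by (rule flat_series.exp_moment_u_sums[OF fs2 T])
  then have "(\<lambda>m. g (Suc m) * V (Suc m)) sums (?U2 - g 0 * V 0)"
    by (simp add: sums_Suc_iff[of "\<lambda>m. g m * V m"])
  moreover have "(\<lambda>m. (lam - \<kappa>) * (- g (Suc m) * V m)) sums ((lam - \<kappa>) * ?U1)"
    unfolding V_def by (intro sums_mult flat_series.exp_moment_u_sums[OF fs1 T])
  ultimately have "(\<lambda>m. g (Suc m) * V (Suc m) + (lam - \<kappa>) * (- g (Suc m) * V m)) sums (?U2 - g 0 * V 0 + (lam - \<kappa>) * ?U1)"
    by (rule sums_add)
  also have "(\<lambda>m. g (Suc m) * V (Suc m) + (lam - \<kappa>) * (- g (Suc m) * V m)) = (\<lambda>m. g (Suc m) * \<kappa> ^ Suc m * V 0)"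
  proof
    fix m
    have "g (Suc m) * \<kappa> ^ Suc m * V 0 = g (Suc m) * (V (Suc m) - (lam - \<kappa>) * V m)"
      by (simp only: mult.assoc pw)
    then show "g (Suc m) * V (Suc m) + (lam - \<kappa>) * (- g (Suc m) * V m) = g (Suc m) * \<kappa> ^ Suc m * V 0"
      by (simp add: algebra_simps)
  qed
  finally have "(\<lambda>m. g m * \<kappa> ^ m * V 0) sums (?U2 - g 0 * V 0 + (lam - \<kappa>) * ?U1 + g 0 * \<kappa> ^ 0 * V 0)"
    by (rule sums_Suc_iff[of "\<lambda>m. g m * \<kappa> ^ m * V 0", THEN iffD1])
  then show "(\<lambda>m. g m * \<kappa> ^ m * exp_moment T \<mu> (bump a b 0)) sums ((lam - \<kappa>) * ?U1 + ?U2)"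
    by (simp add: V0 add.commute)
qed

text \<open>Taylor coefficients in \<open>\<kappa>\<close> of the entire function \<open>\<integral> F(x) cos (\<surd>\<kappa> x) dx\<close>.\<close>

definition cos_taylor :: "real \<Rightarrow> (real \<Rightarrow> real) \<Rightarrow> nat \<Rightarrow> real" where
  "cos_taylor L F m = (-1) ^ m / fact (2 * m) * (LINT x:{0<..<L}|lborel. x ^ (2 * m) * F x)"

lemma cos_taylor_bound:
  assumes "L > 0" "square_integrable_on 0 L F"
  shows "\<bar>cos_taylor L F m\<bar> \<le> (LINT x:{0<..<L}|lborel. \<bar>F x\<bar>) * (L\<^sup>2) ^ m / fact (2 * m)"
proof -
  have i: "set_integrable lborel {0<..<L} (\<lambda>x. x ^ j * F x)" for j
    using set_integrable_mult_square_integrable[OF continuous_on_square_integrable_on[of 0 L "\<lambda>x. x ^ j"] assms(2)]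
    by (simp add: continuous_intros)
  have ia: "set_integrable lborel {0<..<L} (\<lambda>x. \<bar>F x\<bar>)" using set_integrable_abs[OF i[of 0]] by simp
  have "\<bar>LINT x:{0<..<L}|lborel. x ^ (2 * m) * F x\<bar> \<le> (LINT x:{0<..<L}|lborel. L ^ (2 * m) * \<bar>F x\<bar>)"
    unfolding set_lebesgue_integral_def real_norm_def[symmetric]
  proof (rule Bochner_Integration.integral_norm_bound_integral)
    show "integrable lborel (\<lambda>x. indicator {0<..<L} x *\<^sub>R (x ^ (2 * m) * F x))"
      using i by (simp only: set_integrable_def)
    have "set_integrable lborel {0<..<L} (\<lambda>x. L ^ (2 * m) * \<bar>F x\<bar>)" by (intro set_integrable_mult_right ia)
    then show "integrable lborel (\<lambda>x. indicator {0<..<L} x *\<^sub>R (L ^ (2 * m) * norm (F x)))"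
      by (simp add: set_integrable_def)
    show "norm (indicator {0<..<L} x *\<^sub>R (x ^ (2 * m) * F x)) \<le> indicator {0<..<L} x *\<^sub>R (L ^ (2 * m) * norm (F x))" for x
      by (auto simp: indicator_def abs_mult power_abs intro!: mult_right_mono power_mono)
  qed
  then have "\<bar>cos_taylor L F m\<bar> \<le> 1 / fact (2 * m) * (LINT x:{0<..<L}|lborel. L ^ (2 * m) * \<bar>F x\<bar>)"
    by (simp add: cos_taylor_def abs_mult power_abs divide_right_mono)
  then show ?thesis unfolding power_mult set_integral_mult_right by (simp add: field_simps)
qed

lemma cos_taylor_sums:
  assumes L: "L > 0" and F: "square_integrable_on 0 L F"
  shows "(\<lambda>m. cos_taylor L F m * (\<xi>\<^sup>2) ^ m) sums (LINT x:{0<..<L}|lborel. F x * cos (\<xi> * x))"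
proof -
  \<comment> \<open>clipping to \<open>[0, L]\<close> makes the terms of the cosine series bounded on the whole line\<close>
  define cl where "cl x = max 0 (min L x)" for x
  define f where "f m x = (-1) ^ m / fact (2 * m) * (\<xi> * cl x) ^ (2 * m)" for m x
  have clc: "continuous_on A cl" for A unfolding cl_def[abs_def] by (intro continuous_intros)
  have "(\<lambda>m. LINT x:{0<..<L}|lborel. f m x * F x) sums (LINT x:{0<..<L}|lborel. (\<Sum>m. f m x) * F x)"
  proof (rule LINT_uniform_series)
    show "continuous_on {0..L} (f m)" for m
      unfolding f_def[abs_def] by (intro continuous_intros clc)
    show "\<bar>f m x\<bar> \<le> ((\<xi> * L)\<^sup>2 + 1) ^ m * fact (m + 2) / fact (2 * m)" for m x
    proof -
      have "(\<xi> * cl x)\<^sup>2 \<le> (\<xi> * L)\<^sup>2"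
        unfolding power_mult_distrib using L by (intro mult_left_mono power_mono) (auto simp: cl_def)
      then have "((\<xi> * cl x)\<^sup>2) ^ m \<le> ((\<xi> * L)\<^sup>2 + 1) ^ m * 1" by (auto intro: power_mono)
      also have "\<dots> \<le> ((\<xi> * L)\<^sup>2 + 1) ^ m * fact (m + 2)" by (intro mult_left_mono fact_ge_1) auto
      finally show ?thesis by (simp add: f_def abs_mult power_mult divide_right_mono)
    qed
    show "summable (\<lambda>m. ((\<xi> * L)\<^sup>2 + 1) ^ m * fact (m + 2) / fact (2 * m))"
      by (rule summable_factorial_ratio) (simp add: add_nonneg_pos)
  qed (rule F)
  also have "(\<lambda>m. LINT x:{0<..<L}|lborel. f m x * F x) = (\<lambda>m. cos_taylor L F m * (\<xi>\<^sup>2) ^ m)"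
  proof
    fix m
    have "(LINT x:{0<..<L}|lborel. f m x * F x) =
        (LINT x:{0<..<L}|lborel. ((-1) ^ m / fact (2 * m) * (\<xi>\<^sup>2) ^ m) * (x ^ (2 * m) * F x))"
      by (rule set_lebesgue_integral_cong) (auto simp: f_def cl_def power_mult_distrib power_mult)
    then show "(LINT x:{0<..<L}|lborel. f m x * F x) = cos_taylor L F m * (\<xi>\<^sup>2) ^ m"
      by (simp add: cos_taylor_def)
  qed
  also have "(LINT x:{0<..<L}|lborel. (\<Sum>m. f m x) * F x) = (LINT x:{0<..<L}|lborel. F x * cos (\<xi> * x))"
  proof (rule set_lebesgue_integral_cong)
    show "\<forall>x. x \<in> {0<..<L} \<longrightarrow> (\<Sum>m. f m x) * F x = F x * cos (\<xi> * x)"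
    proof (intro allI impI)
      fix x assume x: "x \<in> {0<..<L}"
      have "(\<lambda>m. f m x) sums cos (\<xi> * x)"
        using cos_paired[of "\<xi> * x"] x by (simp add: f_def cl_def)
      then show "(\<Sum>m. f m x) * F x = F x * cos (\<xi> * x)" by (simp add: sums_iff)
    qed
  qed simp
  finally show ?thesis .
qed

section \<open>Duhamel integrals\<close>

context diagonal_semigroup
begin

definition duhamel :: "(real \<Rightarrow> real) \<Rightarrow> 'a \<Rightarrow> real \<Rightarrow> 'a" where
  "duhamel \<alpha> \<Phi> t = (LINT s:{0..t}|lborel. \<alpha> s *\<^sub>R S (t - s) \<Phi>)"

lemma duhamel_integrable:
  assumes "\<And>A. continuous_on A \<alpha>"
  shows "set_integrable lborel {0..t} (\<lambda>s. \<alpha> s *\<^sub>R S (t - s) \<Phi>)"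
proof (rule borel_integrable_atLeastAtMost')
  show "continuous_on {0..t} (\<lambda>s. \<alpha> s *\<^sub>R S (t - s) \<Phi>)"
    by (intro continuous_intros assms continuous_on_compose2[OF continuous_on_S[of t]]) auto
qed

lemma inner_duhamel:
  assumes \<alpha>: "\<And>A. continuous_on A \<alpha>"
  shows "inner (duhamel \<alpha> \<Phi> t) r = (LINT s:{0..t}|lborel. \<alpha> s * inner (S (t - s) \<Phi>) r)"
proof -
  have "(LINT s|lborel. inner (indicator {0..t} s *\<^sub>R (\<alpha> s *\<^sub>R S (t - s) \<Phi>)) r) = inner (duhamel \<alpha> \<Phi> t) r"
    unfolding duhamel_def set_lebesgue_integral_def
    by (rule integral_inner_left) (use duhamel_integrable[OF \<alpha>] in \<open>simp add: set_integrable_def\<close>)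
  then show ?thesis by (simp add: set_lebesgue_integral_def mult.assoc)
qed

lemma duhamel_in:
  assumes "\<And>A. continuous_on A \<alpha>"
  shows "duhamel \<alpha> \<Phi> t \<in> X"
proof (rule in_X_if_orthogonal_to_complement)
  fix r assume r: "\<And>x. x \<in> X \<Longrightarrow> inner x r = 0"
  have "(LINT s:{0..t}|lborel. \<alpha> s * inner (S (t - s) \<Phi>) r) = (LINT s:{0..t}|lborel. (0::real))"
    by (rule set_lebesgue_integral_cong) (auto simp: r S_in)
  then show "inner (duhamel \<alpha> \<Phi> t) r = 0" by (simp add: inner_duhamel[OF assms])
qed

lemma duhamel_coefficient:
  assumes \<alpha>: "\<And>A. continuous_on A \<alpha>"
  shows "inner (duhamel \<alpha> \<Phi> t) (e k) = exp (- \<mu> k * t) * inner \<Phi> (e k) * exp_moment t (\<mu> k) \<alpha>"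
proof -
  have "inner (duhamel \<alpha> \<Phi> t) (e k) = (LINT s:{0..t}|lborel. \<alpha> s * inner (S (t - s) \<Phi>) (e k))"
    by (rule inner_duhamel[OF \<alpha>])
  also have "\<dots> = (LINT s:{0..t}|lborel. (exp (- \<mu> k * t) * inner \<Phi> (e k)) * (\<alpha> s * exp (\<mu> k * s)))"
    by (rule set_lebesgue_integral_cong) (auto simp: inner_S exp_diff exp_minus field_simps)
  also have "\<dots> = exp (- \<mu> k * t) * inner \<Phi> (e k) * (LINT s:{0..t}|lborel. \<alpha> s * exp (\<mu> k * s))"
    by simp
  also have "(LINT s:{0..t}|lborel. \<alpha> s * exp (\<mu> k * s)) = exp_moment t (\<mu> k) \<alpha>"
    unfolding exp_moment_def by (intro LINT_open_eq_closed[symmetric] continuous_intros \<alpha>)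
  finally show ?thesis .
qed

text \<open>The reflection moves the time into the scalar factor and, as \<open>\<alpha>\<close> vanishes on the negative axis, the
  domain of integration no longer depends on it; continuity then follows by dominated convergence.\<close>

lemma duhamel_reflect:
  assumes \<alpha>0: "\<And>s. s \<le> 0 \<Longrightarrow> \<alpha> s = 0" and t: "t \<le> T"
  shows "duhamel \<alpha> \<Phi> t = (LINT s|lborel. indicator {0..T} s *\<^sub>R (\<alpha> (t - s) *\<^sub>R S s \<Phi>))"
proof -
  have "duhamel \<alpha> \<Phi> t = (LINT s|lborel. indicator {0..t} (t + (-1) * s) *\<^sub>R (\<alpha> (t + (-1) * s) *\<^sub>R S (t - (t + (-1) * s)) \<Phi>))"
    unfolding duhamel_def set_lebesgue_integral_def by (subst lborel_integral_real_affine[of "-1" _ t]) auto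
  also have "\<dots> = (LINT s|lborel. indicator {0..T} s *\<^sub>R (\<alpha> (t - s) *\<^sub>R S s \<Phi>))"
  proof (rule Bochner_Integration.integral_cong)
    fix s
    have "\<alpha> (t - s) = 0" if "t < s" using that by (intro \<alpha>0) simp
    then show "indicator {0..t} (t + (-1) * s) *\<^sub>R (\<alpha> (t + (-1) * s) *\<^sub>R S (t - (t + (-1) * s)) \<Phi>) =
        indicator {0..T} s *\<^sub>R (\<alpha> (t - s) *\<^sub>R S s \<Phi>)"
      using t by (cases "t < s") (auto simp: indicator_def)
  qed simp
  finally show ?thesis .
qed

lemma continuous_on_duhamel:
  assumes \<alpha>: "\<And>A. continuous_on A \<alpha>" and \<alpha>0: "\<And>s. s \<le> 0 \<Longrightarrow> \<alpha> s = 0" and B: "\<And>s. \<bar>\<alpha> s\<bar> \<le> B"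
    and \<Phi>: "\<Phi> \<in> X"
  shows "continuous_on {0..T} (duhamel \<alpha> \<Phi>)"
  unfolding continuous_on_sequentially
proof (intro ballI allI impI, elim conjE)
  fix t and \<tau> :: "nat \<Rightarrow> real"
  assume t: "t \<in> {0..T}" and \<tau>: "\<forall>n. \<tau> n \<in> {0..T}" "\<tau> \<longlonglongrightarrow> t"
  have B0: "B \<ge> 0" using B[of 0] by linarith
  have m: "(\<lambda>s. indicator {0..T} s *\<^sub>R (\<alpha> (r - s) *\<^sub>R S s \<Phi>)) \<in> borel_measurable lborel" for r
    by (intro borel_measurable_integrable borel_integrable_compact continuous_intros
        continuous_on_compose2[OF \<alpha>[of UNIV]] continuous_on_S compact_Icc) auto
  have "(\<lambda>n. LINT s|lborel. indicator {0..T} s *\<^sub>R (\<alpha> (\<tau> n - s) *\<^sub>R S s \<Phi>)) \<longlonglongrightarrow>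
      (LINT s|lborel. indicator {0..T} s *\<^sub>R (\<alpha> (t - s) *\<^sub>R S s \<Phi>))"
  proof (rule integral_dominated_convergence[OF m m])
    have "integrable lborel (indicator {0..T} :: real \<Rightarrow> real)"
      by (rule integrable_real_indicator[OF _ emeasure_compact_finite[OF compact_Icc]]) simp
    then show "integrable lborel (\<lambda>s. B * (exp (\<omega> * T) * norm \<Phi>) * indicator {0..T} s)"
      by (rule integrable_mult_right)
    show "AE s in lborel. (\<lambda>n. indicator {0..T} s *\<^sub>R (\<alpha> (\<tau> n - s) *\<^sub>R S s \<Phi>)) \<longlonglongrightarrow> indicator {0..T} s *\<^sub>R (\<alpha> (t - s) *\<^sub>R S s \<Phi>)"
    proof (rule AE_I2)
      fix s
      have "(\<lambda>n. \<alpha> (\<tau> n - s)) \<longlonglongrightarrow> \<alpha> (t - s)"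
        by (rule continuous_on_tendsto_compose[OF \<alpha>[of UNIV]]) (auto intro!: tendsto_intros \<tau>)
      then show "(\<lambda>n. indicator {0..T} s *\<^sub>R (\<alpha> (\<tau> n - s) *\<^sub>R S s \<Phi>)) \<longlonglongrightarrow> indicator {0..T} s *\<^sub>R (\<alpha> (t - s) *\<^sub>R S s \<Phi>)"
        by (intro tendsto_intros)
    qed
    show "AE s in lborel. norm (indicator {0..T} s *\<^sub>R (\<alpha> (\<tau> n - s) *\<^sub>R S s \<Phi>)) \<le> B * (exp (\<omega> * T) * norm \<Phi>) * indicator {0..T} s" for n
    proof (rule AE_I2)
      fix s
      have "s \<in> {0..T} \<Longrightarrow> \<bar>\<alpha> (\<tau> n - s)\<bar> * norm (S s \<Phi>) \<le> B * (exp (\<omega> * T) * norm \<Phi>)"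
        using B0 by (intro mult_mono B norm_S \<Phi>) auto
      then show "norm (indicator {0..T} s *\<^sub>R (\<alpha> (\<tau> n - s) *\<^sub>R S s \<Phi>)) \<le> B * (exp (\<omega> * T) * norm \<Phi>) * indicator {0..T} s"
        by (simp add: indicator_def)
    qed
  qed
  moreover have "duhamel \<alpha> \<Phi> r = (LINT s|lborel. indicator {0..T} s *\<^sub>R (\<alpha> (r - s) *\<^sub>R S s \<Phi>))" if "r \<in> {0..T}" for r
    using that by (intro duhamel_reflect \<alpha>0) auto
  ultimately show "(duhamel \<alpha> \<Phi> \<circ> \<tau>) \<longlonglongrightarrow> duhamel \<alpha> \<Phi> t"
    using t \<tau>(1) by (simp add: o_def)
qed

end

section \<open>The lifted boundary data\<close>

text \<open>Green's formula: the lift misses the boundary conditions of the operator at \<open>0\<close> only, and the defect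
  is the gain of the control on the \<open>k\<close>-th mode.\<close>

lemma boundary_lift_coefficient:
  fixes lam :: real
  assumes L: "L > 0" and p: "boundary_lift L c1 c3 p"
  defines "q \<equiv> \<lambda>x. lam * (deriv_on L ^^ 2) p x + (deriv_on L ^^ 4) p x"
  shows "square_integrable_on 0 L p" "square_integrable_on 0 L q"
    and "inner (L2_class_on 0 L q) (cos_mode L k) =
      ks_eigenvalue L lam k * inner (L2_class_on 0 L p) (cos_mode L k) -
      cos_norm L k * ((lam - freq L k ^ 2) * c1 + c3)"
proof -
  define D where "D n = (deriv_on L ^^ n) p" for n
  have D: "(D n has_real_derivative D (Suc n) x) (at x within {0..L})" if "x \<in> {0..L}" for n x
  proof -
    have "(D n has_vector_derivative vector_derivative (D n) (at x within {0..L})) (at x within {0..L})"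
      using p that unfolding boundary_lift_def smooth_on_def D_def vector_derivative_works[symmetric] by blast
    then show ?thesis by (simp add: D_def deriv_on_def has_real_derivative_iff_has_vector_derivative)
  qed
  have c: "continuous_on {0..L} (D n)" for n
    by (rule DERIV_continuous_on[OF D])
  have bc: "D 1 0 = c1" "D 3 0 = c3" "D 1 L = 0" "D 3 L = 0"
    using p by (simp_all add: boundary_lift_def D_def)
  have q: "q = (\<lambda>x. lam * D 2 x + D 4 x)" by (simp add: q_def D_def)
  have pD: "p = D 0" by (simp add: D_def)
  show sqp: "square_integrable_on 0 L p" unfolding pD by (rule continuous_on_square_integrable_on[OF c])
  show sqq: "square_integrable_on 0 L q"
    unfolding q by (intro continuous_on_square_integrable_on continuous_intros c)
  let ?\<xi> = "freq L k"
  have s: "sin (?\<xi> * L) = 0" using freq_mult[OF L, of k] by (simp add: sin_npi)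
  define Cs Sn where "Cs j = (LINT x:{0<..<L}|lborel. D j x * cos (?\<xi> * x))"
    and "Sn j = (LINT x:{0<..<L}|lborel. D j x * sin (?\<xi> * x))" for j
  have 1: "Cs (Suc j) = D j L * cos (?\<xi> * L) - D j 0 + ?\<xi> * Sn j" for j
  proof -
    have "(LINT x:{0<..<L}|lborel. D (Suc j) x * cos (?\<xi> * x)) = D j L * cos (?\<xi> * L) - D j 0 * cos (?\<xi> * 0) -
        (LINT x:{0<..<L}|lborel. D j x * (- ?\<xi> * sin (?\<xi> * x)))"
      by (rule LINT_by_parts[OF _ D]) (use L c in \<open>auto intro!: derivative_eq_intros continuous_intros\<close>)
    then show ?thesis
      unfolding mult.left_commute[of "D _ _"] set_integral_mult_right by (simp add: Cs_def Sn_def)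
  qed
  have 2: "Sn (Suc j) = - ?\<xi> * Cs j" for j
  proof -
    have "(LINT x:{0<..<L}|lborel. D (Suc j) x * sin (?\<xi> * x)) = D j L * sin (?\<xi> * L) - D j 0 * sin (?\<xi> * 0) -
        (LINT x:{0<..<L}|lborel. D j x * (?\<xi> * cos (?\<xi> * x)))"
      by (rule LINT_by_parts[OF _ D]) (use L c in \<open>auto intro!: derivative_eq_intros continuous_intros\<close>)
    then show ?thesis
      unfolding mult.left_commute[of "D _ _"] set_integral_mult_right by (simp add: Cs_def Sn_def s)
  qed
  have C2: "Cs 2 = - c1 - ?\<xi> ^ 2 * Cs 0"
    using 1[of 1] 2[of 0] bc by (simp add: numeral_2_eq_2 power2_eq_square)
  have C4: "Cs 4 = - c3 - ?\<xi> ^ 2 * Cs 2"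
    using 1[of 3] 2[of 2] bc by (simp add: power2_eq_square)
  have "inner (L2_class_on 0 L q) (cos_mode L k) = cos_norm L k * (LINT x:{0<..<L}|lborel. q x * cos (?\<xi> * x))"
    by (rule inner_cos_mode[OF sqq])
  also have "(LINT x:{0<..<L}|lborel. q x * cos (?\<xi> * x)) =
      (LINT x:{0<..<L}|lborel. lam * (D 2 x * cos (?\<xi> * x)) + D 4 x * cos (?\<xi> * x))"
    by (simp add: q distrib_right mult.assoc)
  also have "\<dots> = (LINT x:{0<..<L}|lborel. lam * (D 2 x * cos (?\<xi> * x))) + Cs 4"
    unfolding Cs_def by (intro set_integral_add(2) set_integrable_open_continuous continuous_intros c)
  also have "\<dots> = lam * Cs 2 + Cs 4" by (simp add: Cs_def)
  also have "\<dots> = ks_eigenvalue L lam k * Cs 0 - ((lam - ?\<xi> ^ 2) * c1 + c3)"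
    unfolding C4 C2 by (simp add: ks_eigenvalue_def algebra_simps power2_eq_square power4_eq_xxxx)
  also have "cos_norm L k * \<dots> = ks_eigenvalue L lam k * inner (L2_class_on 0 L p) (cos_mode L k) -
      cos_norm L k * ((lam - freq L k ^ 2) * c1 + c3)"
    unfolding inner_cos_mode[OF sqp] by (simp add: Cs_def pD algebra_simps)
  finally show "inner (L2_class_on 0 L q) (cos_mode L k) = \<dots>" .
qed

section \<open>Null controllability\<close>

text \<open>The density \<open>\<Phi>\<close> is chosen so that its cosine coefficients, multiplied by the transform of the bump
  function, are the negatives of those of the initial datum.\<close>

lemma flat_controls_exist:
  assumes L: "L > 0" and lam: "lam > 0" and T: "T > 0" and y0: "y0 \<in> L2_on 0 L"
  shows "\<exists>u1 v1 u2 v2 B. (\<forall>(u, v)\<in>{(u1, v1), (u2, v2)}.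
      has_H1_deriv 0 T u v \<and> (\<forall>t. (u has_real_derivative v t) (at t)) \<and>
      continuous_on UNIV u \<and> continuous_on UNIV v \<and>
      (\<forall>t. \<bar>u t\<bar> \<le> B \<and> \<bar>v t\<bar> \<le> B) \<and> (\<forall>t. t \<le> 0 \<or> t \<ge> T \<longrightarrow> u t = 0 \<and> v t = 0)) \<and>
    (\<forall>k. inner y0 (cos_mode L k) + cos_norm L k *
      ((lam - freq L k ^ 2) * exp_moment T (ks_eigenvalue L lam k) u1 +
        exp_moment T (ks_eigenvalue L lam k) u2) = 0)"
proof -
  interpret diagonal_semigroup "L2_on 0 L" "cos_mode L" "ks_eigenvalue L lam" "lam\<^sup>2 / 4"
    by (rule ks_diagonal_semigroup[OF L])
  define a b where "a = T / 3" and "b = 2 * T / 3"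
  define M where "M k = exp_moment T (ks_eigenvalue L lam k) (bump a b 0)" for k
  \<comment> \<open>the bound of \<open>bump_moment_lower\<close> for a margin of \<open>T / 9\<close> inside the support \<open>[T / 3, 2 T / 3]\<close>\<close>
  define c0 where "c0 = exp (- (2 / (T / 9))) * exp (- (lam\<^sup>2 / 4) * T) * (b - a - 2 * (T / 9))"
  have c0: "c0 > 0" unfolding c0_def a_def b_def using T by (intro mult_pos_pos) auto
  have M: "c0 \<le> M k" for k
    unfolding c0_def M_def
    by (rule bump_moment_lower) (use T ks_eigenvalue_ge in \<open>auto simp: a_def b_def\<close>)
  have bd: "\<bar>- 1 / M k\<bar> \<le> 1 / c0" for k
    using M[of k] c0 by (simp add: frac_le)
  define \<Phi> where "\<Phi> = multiplier (\<lambda>k. - 1 / M k) y0"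
  have Phi: "\<Phi> \<in> L2_on 0 L" unfolding \<Phi>_def by (rule multiplier_in[OF bd])
  have Phi_k: "inner \<Phi> (cos_mode L k) = - 1 / M k * inner y0 (cos_mode L k)" for k
    unfolding \<Phi>_def by (rule inner_multiplier[OF bd])
  define g where "g = cos_taylor L (l2_rep \<Phi>)"
  define C where "C = (LINT x:{0<..<L}|lborel. \<bar>l2_rep \<Phi> x\<bar>)"
  have C: "C \<ge> 0" unfolding C_def set_lebesgue_integral_def by (rule Bochner_Integration.integral_nonneg) simp
  have g: "\<bar>g m\<bar> \<le> C * (L\<^sup>2) ^ m / fact (2 * m)" for m
    unfolding g_def C_def by (rule cos_taylor_bound[OF L square_integrable_on_rep])
  have g_sums: "(\<lambda>m. g m * (freq L k ^ 2) ^ m) sums (inner \<Phi> (cos_mode L k) / cos_norm L k)" for k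
  proof -
    have "inner \<Phi> (cos_mode L k) = cos_norm L k * (LINT x:{0<..<L}|lborel. l2_rep \<Phi> x * cos (freq L k * x))"
      using inner_cos_mode[OF square_integrable_on_rep, of L \<Phi> k] Phi by (simp add: L2_on_iff)
    then show ?thesis
      using cos_taylor_sums[OF L square_integrable_on_rep, of \<Phi> "freq L k"] cos_norm_pos[OF L, of k]
      by (simp add: g_def)
  qed
  have ab: "0 \<le> a" "b \<le> T" using T by (auto simp: a_def b_def)
  have L2: "L\<^sup>2 > 0" using L by simp
  note pm = flat_series_pair_moment[OF T ab less_imp_le[OF lam] L2 C g]
  interpret f2: flat_series lam a b C "L\<^sup>2" g by (rule pm(1)) simp
  interpret f1: flat_series lam a b "C * L\<^sup>2" "L\<^sup>2" "\<lambda>m. - g (Suc m)" by (rule pm(2)) simp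
  have moment: "inner y0 (cos_mode L k) + cos_norm L k *
      ((lam - freq L k ^ 2) * exp_moment T (ks_eigenvalue L lam k) (f1.u 0) +
        exp_moment T (ks_eigenvalue L lam k) (f2.u 0)) = 0" for k
  proof -
    have "ks_eigenvalue L lam k = freq L k ^ 2 * (freq L k ^ 2 - lam)"
      by (simp add: ks_eigenvalue_def power2_eq_square power4_eq_xxxx algebra_simps)
    from pm(3)[OF this]
    have "(\<lambda>m. g m * (freq L k ^ 2) ^ m * M k) sums
        ((lam - freq L k ^ 2) * exp_moment T (ks_eigenvalue L lam k) (f1.u 0) +
        exp_moment T (ks_eigenvalue L lam k) (f2.u 0))"
      by (simp only: M_def)
    moreover have "(\<lambda>m. g m * (freq L k ^ 2) ^ m * M k) sums (inner \<Phi> (cos_mode L k) / cos_norm L k * M k)"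
      by (intro sums_mult2 g_sums)
    ultimately have "(lam - freq L k ^ 2) * exp_moment T (ks_eigenvalue L lam k) (f1.u 0) +
        exp_moment T (ks_eigenvalue L lam k) (f2.u 0) = inner \<Phi> (cos_mode L k) / cos_norm L k * M k"
      by (rule sums_unique2)
    also have "\<dots> = - inner y0 (cos_mode L k) / cos_norm L k"
      using M[of k] c0 by (simp add: Phi_k)
    finally show ?thesis using cos_norm_pos[OF L, of k] by simp
  qed
  have bnds: "\<bar>f1.u n t\<bar> \<le> max (suminf f1.majorant) (suminf f2.majorant)"
    "\<bar>f2.u n t\<bar> \<le> max (suminf f1.majorant) (suminf f2.majorant)" if "n \<le> 1" for n t
    using f1.u_bound[OF that, of t] f2.u_bound[OF that, of t] by auto
  have "t \<le> a \<or> t \<ge> b" if "t \<le> 0 \<or> t \<ge> T" for t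
    using that T by (auto simp: a_def b_def)
  then have out: "f1.u n t = 0" "f2.u n t = 0" if "t \<le> 0 \<or> t \<ge> T" for n t
    using that f1.u_outside f2.u_outside by blast+
  show ?thesis
    by (rule exI[of _ "f1.u 0"], rule exI[of _ "f1.u 1"], rule exI[of _ "f2.u 0"], rule exI[of _ "f2.u 1"],
        rule exI[of _ "max (suminf f1.majorant) (suminf f2.majorant)"])
      (use T moment bnds[of 0] bnds[of 1] out f1.u_has_H1_deriv f2.u_has_H1_deriv f1.u_deriv f2.u_deriv
        f1.continuous_u[of 0] f1.continuous_u[of 1] f2.continuous_u[of 0] f2.continuous_u[of 1] in simp)
qed

theorem theorem4p4:
  fixes L lam T :: real and p1 p2 :: "real \<Rightarrow> real" and y0 :: l2
  assumes "L > 0" and "lam > 0"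
    and "boundary_lift L 1 0 p1" and "boundary_lift L 0 1 p2"
    and "T > 0" and "y0 \<in> L2_on 0 L"
  shows "\<exists>u1\<in>H1 0 T. \<exists>u2\<in>H1 0 T. \<exists>y.
    ks_solution L lam p1 p2 T y0 u1 u2 y \<and> y T = 0"
proof -
  note L = assms(1) and lam = assms(2) and T = assms(5) and y0 = assms(6)
  interpret diagonal_semigroup "L2_on 0 L" "cos_mode L" "ks_eigenvalue L lam" "lam\<^sup>2 / 4"
    by (rule ks_diagonal_semigroup[OF L])
  let ?\<mu> = "ks_eigenvalue L lam"
  define q1 q2 where "q1 = (\<lambda>x. lam * (deriv_on L ^^ 2) p1 x + (deriv_on L ^^ 4) p1 x)"
    and "q2 = (\<lambda>x. lam * (deriv_on L ^^ 2) p2 x + (deriv_on L ^^ 4) p2 x)"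
  define P1 P2 Q1 Q2 where "P1 = L2_class_on 0 L p1" and "P2 = L2_class_on 0 L p2"
    and "Q1 = L2_class_on 0 L q1" and "Q2 = L2_class_on 0 L q2"
  note lift1 = boundary_lift_coefficient(1)[OF L assms(3)]
    boundary_lift_coefficient(2,3)[OF L assms(3), where lam = lam, folded q1_def]
  note lift2 = boundary_lift_coefficient(1)[OF L assms(4)]
    boundary_lift_coefficient(2,3)[OF L assms(4), where lam = lam, folded q2_def]
  have X: "P1 \<in> L2_on 0 L" "P2 \<in> L2_on 0 L" "Q1 \<in> L2_on 0 L" "Q2 \<in> L2_on 0 L"
    unfolding P1_def P2_def Q1_def Q2_def by (intro L2_class_on_in lift1 lift2)+
  obtain u1 v1 u2 v2 B where uv: "\<forall>(u, v)\<in>{(u1, v1), (u2, v2)}.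
      has_H1_deriv 0 T u v \<and> (\<forall>t. (u has_real_derivative v t) (at t)) \<and>
      continuous_on UNIV u \<and> continuous_on UNIV v \<and>
      (\<forall>t. \<bar>u t\<bar> \<le> B \<and> \<bar>v t\<bar> \<le> B) \<and> (\<forall>t. t \<le> 0 \<or> t \<ge> T \<longrightarrow> u t = 0 \<and> v t = 0)"
    and moment: "\<And>k. inner y0 (cos_mode L k) + cos_norm L k *
      ((lam - freq L k ^ 2) * exp_moment T (?\<mu> k) u1 + exp_moment T (?\<mu> k) u2) = 0"
    using flat_controls_exist[OF L lam T y0] by blast
  have H1: "has_H1_deriv 0 T u1 v1" "has_H1_deriv 0 T u2 v2" using uv by auto
  have c: "continuous_on A u1" "continuous_on A v1" "continuous_on A u2" "continuous_on A v2" for A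
    using uv by (auto intro: continuous_on_subset)
  have B: "\<bar>u1 t\<bar> \<le> B" "\<bar>v1 t\<bar> \<le> B" "\<bar>u2 t\<bar> \<le> B" "\<bar>v2 t\<bar> \<le> B" for t using uv by auto
  have z0: "u1 t = 0" "v1 t = 0" "u2 t = 0" "v2 t = 0" if "t \<le> 0" for t using uv that by auto
  have zT: "u1 T = 0" "u2 T = 0" using uv by auto
  \<comment> \<open>the controls vanish at both ends of the time interval, so no boundary terms arise\<close>
  have mv: "exp_moment T m v1 = - m * exp_moment T m u1" "exp_moment T m v2 = - m * exp_moment T m u2" for m
    by (rule exp_moment_deriv[OF T]; use uv c z0 zT in simp)+
  define z where "z t = S t y0 - (duhamel v1 P1 t + duhamel u1 Q1 t + (duhamel v2 P2 t + duhamel u2 Q2 t))" for t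
  define y where "y t = z t + u1 t *\<^sub>R P1 + u2 t *\<^sub>R P2" for t
  note dui = duhamel_integrable[OF c(1)] duhamel_integrable[OF c(2)] duhamel_integrable[OF c(3)] duhamel_integrable[OF c(4)]
  let ?F = "\<lambda>t. - (ks_source L lam p1 u1 v1 t + ks_source L lam p2 u2 v2 t)"
  have F: "S (t - s) (?F s) = - (v1 s *\<^sub>R S (t - s) P1 + u1 s *\<^sub>R S (t - s) Q1 +
      (v2 s *\<^sub>R S (t - s) P2 + u2 s *\<^sub>R S (t - s) Q2))" if "s \<in> {0..t}" for s t
    using that unfolding ks_source_def q1_def[symmetric] q2_def[symmetric] P1_def[symmetric] P2_def[symmetric]
      Q1_def[symmetric] Q2_def[symmetric]
    by (simp add: S_minus S_add S_scaleR del: minus_add_distrib)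
  have mild: "mild_solution S T y0 ?F z"
    unfolding mild_solution_def
  proof (intro ballI conjI)
    fix t assume t: "t \<in> {0..T}"
    let ?G = "\<lambda>s. - (v1 s *\<^sub>R S (t - s) P1 + u1 s *\<^sub>R S (t - s) Q1 +
      (v2 s *\<^sub>R S (t - s) P2 + u2 s *\<^sub>R S (t - s) Q2))"
    have eq: "(\<lambda>s. indicator {0..t} s *\<^sub>R S (t - s) (?F s)) = (\<lambda>s. indicator {0..t} s *\<^sub>R ?G s)"
      using F[where t = t] by (auto simp: indicator_def simp del: minus_add_distrib)
    have "set_integrable lborel {0..t} ?G"
      unfolding set_integrable_def scaleR_minus_right
      by (rule Bochner_Integration.integrable_minus) (intro set_integral_add(1)[unfolded set_integrable_def] dui[unfolded set_integrable_def])
    then show "set_integrable lborel {0..t} (\<lambda>s. S (t - s) (?F s))"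
      by (simp only: set_integrable_def eq)
    have "(LINT s:{0..t}|lborel. S (t - s) (?F s)) = (LINT s:{0..t}|lborel. ?G s)"
      by (simp only: set_lebesgue_integral_def eq)
    also have "\<dots> = - (duhamel v1 P1 t + duhamel u1 Q1 t + (duhamel v2 P2 t + duhamel u2 Q2 t))"
      unfolding duhamel_def by (simp add: set_integral_uminus set_integral_add dui del: minus_add_distrib)
    finally show "z t = S t y0 + (LINT s:{0..t}|lborel. S (t - s) (?F s))" by (simp add: z_def)
  qed
  have "continuous_on {0..T} y"
    unfolding y_def z_def
    by (intro continuous_intros c continuous_on_S continuous_on_duhamel[where B = B] X) (auto intro: c z0 B)
  moreover have init: "y0 - u1 0 *\<^sub>R L2_class_on 0 L p1 - u2 0 *\<^sub>R L2_class_on 0 L p2 = y0" by (simp add: z0)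
  have "mild_solution S T (y0 - u1 0 *\<^sub>R L2_class_on 0 L p1 - u2 0 *\<^sub>R L2_class_on 0 L p2) ?F z"
    unfolding init by (rule mild)
  moreover have "\<forall>t\<in>{0..T}. y t = z t + u1 t *\<^sub>R L2_class_on 0 L p1 + u2 t *\<^sub>R L2_class_on 0 L p2"
    by (simp add: y_def P1_def P2_def)
  ultimately have sol: "ks_solution L lam p1 p2 T y0 u1 u2 y"
    unfolding ks_solution_def using ks_semigroup_ks_flow[OF L lam] H1 by blast
  have "y T = 0"
  proof (rule total)
    have yT: "y T = S T y0 - (duhamel v1 P1 T + duhamel u1 Q1 T + (duhamel v2 P2 T + duhamel u2 Q2 T))"
      by (simp add: y_def z_def zT)
    show "y T \<in> L2_on 0 L"
      unfolding yT using T
      by (intro subspace_diff[OF subspace_X] subspace_add[OF subspace_X] S_in duhamel_in c) auto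
    fix k
    let ?i = "\<lambda>f. inner f (cos_mode L k)"
    let ?m = "exp_moment T (?\<mu> k)"
    have q: "?i Q1 = ?\<mu> k * ?i P1 - cos_norm L k * (lam - freq L k ^ 2)"
      "?i Q2 = ?\<mu> k * ?i P2 - cos_norm L k"
      using lift1(3)[of k] lift2(3)[of k] by (simp_all add: P1_def P2_def Q1_def Q2_def)
    have "?i (y T) = exp (- ?\<mu> k * T) * (?i y0 - (?i P1 * ?m v1 + ?i Q1 * ?m u1 + (?i P2 * ?m v2 + ?i Q2 * ?m u2)))"
      unfolding yT inner_diff_left inner_add_left using T
      by (simp add: inner_S duhamel_coefficient[OF c(1)] duhamel_coefficient[OF c(2)]
          duhamel_coefficient[OF c(3)] duhamel_coefficient[OF c(4)] algebra_simps)
    also have "?i y0 - (?i P1 * ?m v1 + ?i Q1 * ?m u1 + (?i P2 * ?m v2 + ?i Q2 * ?m u2)) =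
        ?i y0 + cos_norm L k * ((lam - freq L k ^ 2) * ?m u1 + ?m u2)"
      unfolding mv q by (simp add: algebra_simps)
    also have "\<dots> = 0" by (rule moment)
    finally show "?i (y T) = 0" by simp
  qed
  moreover have "u1 \<in> H1 0 T" "u2 \<in> H1 0 T" using H1 by (auto simp: H1_def)
  ultimately show ?thesis using sol by blast
qed

end
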